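(* For $n\ge3$, the number $N(n)$ of distinct critical values $m^*$, i.e. of positive values of the central mass $m$ corresponding to nontrivial degeneracy of the central $+$ regular $n$-gon configuration $z_0$, is given by $$N(n)=\begin{cases}1,& n=3,\\ \lfloor n/2\rfloor-1,& 4\le n\le6,\\ \lfloor n/2\rfloor-2,& 7\le n\le9,\\ \lfloor n/2\rfloor-1,& n\ge10.\end{cases}$$ In particular, for $n\ge7$, this number increases with $n$.
   Context: Let $\theta=2\pi/n$, $q_k=(\cos k\theta,\sin k\theta)$ and $\tau_k=(-\sin k\theta,\cos k\theta)$ for $k=1,\dots,n$, $q_{n+1}=(0,0)$, and $z_0=(q_1,\dots,q_{n+1})\in(\mathbb R^2)^{n+1}=\mathbb R^{2n+2}$. The masses are $m_1=\dots=m_n=1$, $m_{n+1}=m>0$. For collision-free $z=(x_1,\dots,x_{n+1})$ put $I=\frac12\sum_i m_i|x_i|^2$, $U=\sum_{i<j}\frac{m_im_j}{|x_i-x_j|}$ and $f=\sqrt{2I}\,U$. For every $m$ the kernel of the Hessian $D^2f(z_0)$ contains $v_0=(q_1,\dots,q_n,0)$ and $w_0=(\tau_1,\dots,\tau_n,0)$. The configuration $z_0$ is nontrivially degenerate if $\ker D^2f(z_0)$ is strictly larger than $\operatorname{span}\{v_0,w_0\}$. *)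

theory Defs
  imports "HOL-Analysis.Derivative" "Jordan_Normal_Form.Matrix_Kernel"
begin

text \<open>
  The dimension \<open>2 * n + 2\<close> varies with \<open>n\<close>, so configurations are vectors in
  \<^term>\<open>carrier_vec (2 * n + 2) :: real vec set\<close>. Bodies are numbered \<open>1, \<dots>, n + 1\<close>, whereas
  vector entries are indexed from 0: body \<open>i\<close> occupies the entries \<open>2 * (i - 1)\<close> and
  \<open>2 * (i - 1) + 1\<close>. The norm on \<^typ>\<open>real \<times> real\<close> is the Euclidean one.
\<close>

definition body :: "real vec \<Rightarrow> nat \<Rightarrow> real \<times> real" where
  "body z i = (z $ (2 * (i - 1)), z $ (2 * (i - 1) + 1))"

definition config :: "nat \<Rightarrow> (nat \<Rightarrow> real \<times> real) \<Rightarrow> real vec" where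
  "config n x = vec (2 * n + 2)
     (\<lambda>j. if even j then fst (x (j div 2 + 1)) else snd (x (j div 2 + 1)))"

definition mass :: "nat \<Rightarrow> real \<Rightarrow> nat \<Rightarrow> real" where
  "mass n m i = (if i \<le> n then 1 else m)"

definition inertia :: "nat \<Rightarrow> real \<Rightarrow> real vec \<Rightarrow> real" where
  "inertia n m z = 1 / 2 * (\<Sum>i = 1..n + 1. mass n m i * (norm (body z i))\<^sup>2)"

definition newton_potential :: "nat \<Rightarrow> real \<Rightarrow> real vec \<Rightarrow> real" where
  "newton_potential n m z =
     (\<Sum>(i, j) \<in> {(i, j). 1 \<le> i \<and> i < j \<and> j \<le> n + 1}.
        mass n m i * mass n m j / norm (body z i - body z j))"

definition scaled_potential :: "nat \<Rightarrow> real \<Rightarrow> real vec \<Rightarrow> real" where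
  "scaled_potential n m z = sqrt (2 * inertia n m z) * newton_potential n m z"

definition partial_deriv :: "nat \<Rightarrow> (real vec \<Rightarrow> real) \<Rightarrow> real vec \<Rightarrow> real" where
  "partial_deriv j g z = deriv (\<lambda>t. g (z + t \<cdot>\<^sub>v unit_vec (dim_vec z) j)) 0"

definition hessian :: "(real vec \<Rightarrow> real) \<Rightarrow> real vec \<Rightarrow> real mat" where
  "hessian g z = mat (dim_vec z) (dim_vec z) (\<lambda>(i, j). partial_deriv i (partial_deriv j g) z)"

definition ngon_point :: "nat \<Rightarrow> nat \<Rightarrow> real \<times> real" where
  "ngon_point n k = (cos (k * (2 * pi / n)), sin (k * (2 * pi / n)))"

definition ngon_tangent :: "nat \<Rightarrow> nat \<Rightarrow> real \<times> real" where
  "ngon_tangent n k = (- sin (k * (2 * pi / n)), cos (k * (2 * pi / n)))"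

text \<open>
  As the central body sits at the origin, the configuration \<open>centred_ngon n\<close> is itself the radial
  kernel direction \<open>(q\<^sub>1, \<dots>, q\<^sub>n, 0)\<close>, and no separate vector is introduced for the latter.
\<close>

definition centred_ngon :: "nat \<Rightarrow> real vec" where
  "centred_ngon n = config n (\<lambda>k. if k \<le> n then ngon_point n k else (0, 0))"

definition rotation_direction :: "nat \<Rightarrow> real vec" where
  "rotation_direction n = config n (\<lambda>k. if k \<le> n then ngon_tangent n k else (0, 0))"

definition nontrivially_degenerate :: "nat \<Rightarrow> real \<Rightarrow> bool" where
  "nontrivially_degenerate n m \<longleftrightarrow>
     LinearCombinations.module.span class_ring (module_vec TYPE(real) (2 * n + 2))
       {centred_ngon n, rotation_direction n}
     \<subset> mat_kernel (hessian (scaled_potential n m) (centred_ngon n))"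

definition critical_masses :: "nat \<Rightarrow> real set" where
  "critical_masses n = {m. m > 0 \<and> nontrivially_degenerate n m}"

text \<open>\<^const>\<open>card\<close> is 0 on infinite sets, so results about this number should be accompanied by
  the finiteness of \<^const>\<open>critical_masses\<close>.\<close>

definition num_critical_masses :: "nat \<Rightarrow> nat" where
  "num_critical_masses n = card (critical_masses n)"

end

theory Submission
  imports Defs "HOL-Analysis.Complex_Transcendental"
begin

text \<open>
  Identify the plane with \<open>\<complex>\<close>. At the centred polygon \<open>\<nabla>U = - \<lambda> \<nabla>I\<close>, so up to a positive factor the
  Hessian of \<open>f\<close> is \<open>D\<^sup>2U + \<lambda> M\<close> minus a rank one term along \<open>v\<^sub>0\<close>. Writing the displacement of the
  \<open>k\<close>-th vertex as \<open>\<zeta>\<^sup>k a\<^sub>k\<close>, rotational symmetry splits this operator into Fourier modes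
  \<open>a\<^sub>k = \<alpha> \<zeta>\<^sup>p\<^sup>k + \<beta> \<zeta>\<^sup>-\<^sup>p\<^sup>k\<close> with \<open>0 \<le> p \<le> n / 2\<close>. The mode \<open>p = 0\<close> gives exactly the trivial kernel. For
  \<open>p \<ge> 2\<close> the determinant of the resulting symmetric \<open>2 \<times> 2\<close> matrix is affine in \<open>u = 3 m / 2\<close>, with a
  single root \<open>u\<^sub>p\<close>. For \<open>p = 1\<close> the central body couples to the ring; eliminating it leaves a determinant
  that vanishes where a quadratic polynomial in \<open>u\<close> does.

  The second difference \<open>E\<^sub>p\<close> of \<open>S\<^sub>p = \<Sum>\<^sub>l sin\<^sup>2 (p \<pi> l / n) / (8 sin\<^sup>3 (\<pi> l / n))\<close> satisfies
  \<open>E\<^sub>p - E\<^sub>p\<^sub>+\<^sub>1 = cot ((2 p + 1) \<pi> / (2 n)) / 2 > 0\<close>, which makes \<open>S\<^sub>p\<close>, and for \<open>n \<ge> 8\<close> also \<open>u\<^sub>p\<close>, increase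
  with \<open>p\<close>. Hence the count only depends on signs: \<open>u\<^sub>2 > 0\<close> iff \<open>n \<ge> 10\<close>, \<open>u\<^sub>3 > 0\<close>, and the quadratic has
  one positive root for \<open>n \<le> 6\<close> and none for \<open>n \<ge> 7\<close>.
\<close>

section \<open>Trigonometric sums over the ring\<close>

text \<open>The tidal operator is only real-linear: it contains complex conjugation, which sends the
  frequency p to -p. Hence a mode consists of both exponentials, and its block acts on the vector
  (\<open>\<alpha>\<close>, \<open>cnj \<beta>\<close>). The central mass adds the same u to all
  four entries of the block, so u^2 cancels in the determinant and each p >= 2 yields one root only.
  Roots of different modes must also be kept apart, since a coincidence would lower the count. For p
  >= 2 this is strict monotonicity in p. The obstacle there is the square quotient in u_p, which may
  decrease once the second differences turn negative; its drop is bounded by the growth of S_p. Mode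
  1 has a positive root only for n <= 6, and among these n a mode p >= 2 has one only for n = 6,
  which leaves a single comparison of two roots. All sign questions concern p <= 3, where S_p and
  E_p are rational linear combinations of S_1 and the cotangents of pi/(2n), 3pi/(2n) and 5pi/(2n).
  Enclosures settle n <= 10, elementary bounds for csc and cot the rest.\<close>

locale ngon =
  fixes n :: nat
  assumes n_ge_3: "3 \<le> n"
begin

definition ang :: "nat \<Rightarrow> real" where
  "ang l = pi * l / n"

definition ring_sum :: "int \<Rightarrow> real" where
  "ring_sum p = (\<Sum>l = 1..<n. (sin (p * ang l))\<^sup>2 / (8 * sin (ang l) ^ 3))"

definition bend :: "int \<Rightarrow> real" where
  "bend p = (\<Sum>l = 1..<n. cos (2 * (p * ang l)) / (4 * sin (ang l)))"

definition half_cot :: "int \<Rightarrow> real" where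
  "half_cot j = cot (j * pi / (2 * n))"

abbreviation "s \<equiv> ring_sum 1"

lemma n_pos: "0 < real n"
  using n_ge_3 by simp

lemma sin_ang_pos: "l \<in> {1..<n} \<Longrightarrow> 0 < sin (ang l)"
  unfolding ang_def by (rule sin_gt_zero) (auto simp: field_simps)

lemma ring_sum_0 [simp]: "ring_sum 0 = 0"
  by (simp add: ring_sum_def)

lemma ring_sum_nonneg: "0 \<le> ring_sum p"
  unfolding ring_sum_def by (intro sum_nonneg divide_nonneg_nonneg) (auto simp: sin_ang_pos less_imp_le)

lemma ring_sum_1: "s = (\<Sum>l = 1..<n. 1 / (8 * sin (ang l)))"
  unfolding ring_sum_def
  by (intro sum.cong refl) (use sin_ang_pos in \<open>force simp: power2_eq_square power3_eq_cube\<close>)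

lemma ring_sum_1_pos: "0 < s"
  unfolding ring_sum_1 by (rule sum_pos) (use n_ge_3 sin_ang_pos in auto)

lemma n_ang: "n * ang l = l * pi"
  using n_pos by (simp add: ang_def)

lemma ring_sum_reflect: "ring_sum (int n - p) = ring_sum p"
proof -
  have "(sin (of_int (int n - p) * ang l))\<^sup>2 = (sin (p * ang l))\<^sup>2" for l
  proof -
    have "of_int (int n - p) * ang l = real l * pi - p * ang l"
      using n_ang[of l] by (simp add: algebra_simps)
    moreover have "((- 1 :: real) ^ l)\<^sup>2 = 1" by (simp add: power_mult[symmetric] mult.commute[of l])
    ultimately show ?thesis by (simp only: sin_diff) (simp add: power_mult_distrib)
  qed
  then show ?thesis by (simp add: ring_sum_def)
qed

lemma bend_reflect: "bend (int n - p) = bend p"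
proof -
  have "cos (2 * (of_int (int n - p) * ang l)) = cos (2 * (p * ang l))" for l
  proof -
    have eq: "2 * (of_int (int n - p) * ang l) = of_int (int l) * (2 * pi) - 2 * (p * ang l)"
      using n_ang[of l] by (simp add: algebra_simps)
    have "cos (of_int (int l) * (2 * pi)) = 1" "sin (of_int (int l) * (2 * pi)) = 0"
      using cos_int_2pin[of "int l"] sin_int_2pin[of "int l"] by (simp_all add: mult.commute)
    then show ?thesis by (simp only: eq cos_diff)
  qed
  then show ?thesis by (simp add: bend_def)
qed

text \<open>In the identity for sin^2 (y + x) + sin^2 (y - x) the correction carries a factor sin^2
  x. It reduces the cube below to a first power, which is the weight in \<open>bend\<close>.\<close>

lemma ring_sum_second_difference:
  "ring_sum (p + 1) + ring_sum (p - 1) = 2 * ring_sum p + bend p"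
proof -
  have trig: "(sin ((y::real) + x))\<^sup>2 + (sin (y - x))\<^sup>2 = 2 * (sin y)\<^sup>2 + 2 * cos (2 * y) * (sin x)\<^sup>2" for x y
  proof -
    have "2 * (sin y)\<^sup>2 * (cos x)\<^sup>2 + 2 * (cos y)\<^sup>2 * (sin x)\<^sup>2
        = 2 * (sin y)\<^sup>2 + 2 * ((cos y)\<^sup>2 - (sin y)\<^sup>2) * (sin x)\<^sup>2"
      unfolding cos_squared_eq[of x] by (simp add: algebra_simps)
    then show ?thesis
      unfolding sin_add sin_diff cos_double by (simp add: power2_sum power2_diff power_mult_distrib algebra_simps)
  qed
  have "(sin (of_int (p + 1) * ang l))\<^sup>2 / (8 * sin (ang l) ^ 3) +
        (sin (of_int (p - 1) * ang l))\<^sup>2 / (8 * sin (ang l) ^ 3) =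
        2 * ((sin (p * ang l))\<^sup>2 / (8 * sin (ang l) ^ 3)) + cos (2 * (p * ang l)) / (4 * sin (ang l))"
    if "l \<in> {1..<n}" for l
  proof -
    have "(sin (of_int (p + 1) * ang l))\<^sup>2 + (sin (of_int (p - 1) * ang l))\<^sup>2
        = 2 * (sin (p * ang l))\<^sup>2 + 2 * cos (2 * (p * ang l)) * (sin (ang l))\<^sup>2"
      using trig[of "p * ang l" "ang l"] by (simp add: algebra_simps)
    moreover have "2 * c * x\<^sup>2 / (8 * x ^ 3) = c / (4 * x)" if "0 < x" for c x :: real
      using that by (simp add: power2_eq_square power3_eq_cube)
    ultimately show ?thesis
      using sin_ang_pos[OF that] by (simp only: add_divide_distrib[symmetric]) (simp only: add_divide_distrib times_divide_eq_right)
  qed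
  then show ?thesis
    unfolding ring_sum_def bend_def sum_distrib_left sum.distrib[symmetric]
    by (intro sum.cong refl) auto
qed

section \<open>Bounds and cotangent differences of the bends\<close>

lemma bend_0: "bend 0 = 2 * s"
  unfolding bend_def ring_sum_1 sum_distrib_left by (rule sum.cong) auto

lemma abs_bend_le: "\<bar>bend p\<bar> \<le> 2 * s"
proof -
  have "\<bar>bend p\<bar> \<le> (\<Sum>l = 1..<n. \<bar>cos (2 * (p * ang l)) / (4 * sin (ang l))\<bar>)"
    unfolding bend_def by (rule sum_abs)
  also have "\<dots> \<le> (\<Sum>l = 1..<n. 1 / (4 * sin (ang l)))"
    by (intro sum_mono) (use sin_ang_pos in \<open>auto simp: abs_mult less_imp_le intro!: divide_right_mono\<close>)
  also have "\<dots> = 2 * s"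
    unfolding ring_sum_1 sum_distrib_left by (rule sum.cong) auto
  finally show ?thesis .
qed

text \<open>Termwise, 1 - cos 2y = 2 sin^2 y, and sin^3 <= sin because the sines lie in (0, 1]. This
  is what keeps \<open>stiffness\<close> above 2 S_p.\<close>

lemma bend_drop_le: "(bend 0 - bend p) / 2 \<le> 2 * ring_sum p"
proof -
  have "(1 / (4 * sin (ang l)) - cos (2 * (p * ang l)) / (4 * sin (ang l))) / 2
      \<le> 2 * ((sin (p * ang l))\<^sup>2 / (8 * sin (ang l) ^ 3))" if "l \<in> {1..<n}" for l
  proof -
    let ?x = "sin (ang l)" and ?y = "(sin (p * ang l))\<^sup>2"
    have "cos (2 * (p * ang l)) = 1 - 2 * ?y"
      using cos_double_sin[of "p * ang l"] by (simp add: mult.assoc)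
    then have "(1 / (4 * ?x) - cos (2 * (p * ang l)) / (4 * ?x)) / 2 = ?y / (4 * ?x)"
      by (simp only:) (simp add: diff_divide_distrib)
    also have "\<dots> \<le> ?y / (4 * ?x ^ 3)"
    proof (rule divide_left_mono)
      have "?x ^ 3 \<le> ?x ^ 1"
        by (rule power_decreasing) (use sin_ang_pos[OF that] in auto)
      then show "4 * ?x ^ 3 \<le> 4 * ?x" by simp
    qed (use sin_ang_pos[OF that] in auto)
    finally show ?thesis by simp
  qed
  then have "(\<Sum>l = 1..<n. (1 / (4 * sin (ang l)) - cos (2 * (p * ang l)) / (4 * sin (ang l))) / 2)
     \<le> (\<Sum>l = 1..<n. 2 * ((sin (p * ang l))\<^sup>2 / (8 * sin (ang l) ^ 3)))"
    by (rule sum_mono)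
  then show ?thesis
    by (simp add: bend_def ring_sum_def sum_subtractf sum_distrib_left sum_divide_distrib diff_divide_distrib)
qed

text \<open>Multiplication by 2 sin (y / 2) makes the sum telescope. Since n y is an odd multiple of
  pi, the two boundary terms add up instead of cancelling.\<close>

lemma sum_sin_odd:
  assumes "0 \<le> p" "p < int n"
  shows "(\<Sum>l = 1..<n. sin (of_int (2 * p + 1) * ang l)) = half_cot (2 * p + 1)"
proof -
  define y where "y = of_int (2 * p + 1) * pi / n"
  have y: "of_int (2 * p + 1) * ang l = l * y" for l
    by (simp add: y_def ang_def)
  have sy: "0 < sin (y / 2)"
  proof (rule sin_gt_zero)
    have "real_of_int (2 * p + 1) < 2 * n" using assms by linarith
    then have "of_int (2 * p + 1) * pi < 2 * n * pi" by (rule mult_strict_right_mono) simp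
    then show "y / 2 < pi" using n_pos by (simp add: y_def divide_less_eq mult_ac)
    show "0 < y / 2" using assms n_pos by (simp add: y_def)
  qed
  have "2 * sin (y / 2) * (\<Sum>l = 1..<k + 1. sin (l * y)) = cos (y / 2) - cos (k * y + y / 2)" for k :: nat
  proof (induction k)
    case (Suc k)
    have "2 * sin (y / 2) * sin (Suc k * y) = cos (k * y + y / 2) - cos (Suc k * y + y / 2)"
      using cos_add[of "Suc k * y" "y / 2"] cos_diff[of "Suc k * y" "y / 2"]
      by (simp add: algebra_simps)
    with Suc show ?case by (simp add: algebra_simps)
  qed simp
  from this[of "n - 1"] have "2 * sin (y / 2) * (\<Sum>l = 1..<n. sin (l * y)) = cos (y / 2) - cos (n * y - y / 2)"
    using n_ge_3 by (simp add: algebra_simps of_nat_diff)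
  also have "n * y = pi + of_int p * (2 * pi)"
    using n_pos by (simp add: y_def) (simp add: algebra_simps)
  also have "cos (pi + of_int p * (2 * pi) - y / 2) = - cos (y / 2)"
    using cos_int_2pin[of p] sin_int_2pin[of p]
    by (simp add: cos_diff cos_add sin_add mult.commute mult.left_commute)
  finally have "sin (y / 2) * (\<Sum>l = 1..<n. sin (l * y)) = cos (y / 2)" by simp
  then have "(\<Sum>l = 1..<n. sin (l * y)) = cot (y / 2)"
    using sy by (simp only: cot_def) (simp add: nonzero_eq_divide_eq mult.commute)
  moreover have "y / 2 = of_int (2 * p + 1) * pi / (2 * n)" by (simp add: y_def)
  ultimately show ?thesis unfolding y half_cot_def by (simp only:)
qed

text \<open>cos (X - a) - cos (X + a) = 2 sin X sin a cancels the sine in the denominator, and the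
  weightless sum that remains has a closed form.\<close>

lemma bend_difference:
  assumes "0 \<le> p" "p < int n"
  shows "bend p - bend (p + 1) = half_cot (2 * p + 1) / 2"
proof -
  have "cos (2 * (p * ang l)) / (4 * sin (ang l)) - cos (2 * (of_int (p + 1) * ang l)) / (4 * sin (ang l))
     = sin (of_int (2 * p + 1) * ang l) / 2" if "l \<in> {1..<n}" for l
  proof -
    define X where "X = real_of_int (2 * p + 1) * ang l"
    have eq: "2 * (p * ang l) = X - ang l" "2 * (of_int (p + 1) * ang l) = X + ang l"
      by (simp_all add: X_def algebra_simps)
    then show ?thesis
      using sin_ang_pos[OF that]
      by (simp only: X_def[symmetric] eq) (simp add: cos_diff cos_add field_simps)
  qed
  then have "bend p - bend (p + 1) = (\<Sum>l = 1..<n. sin (of_int (2 * p + 1) * ang l) / 2)"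
    unfolding bend_def sum_subtractf[symmetric] by (intro sum.cong) auto
  then show ?thesis
    using sum_sin_odd[OF assms] by (simp only: sum_divide_distrib[symmetric])
qed

lemma half_cot_pos:
  assumes "0 < j" "j < int n"
  shows "0 < half_cot j"
proof -
  have "real_of_int j < n" using assms by linarith
  then have "of_int j * pi / (2 * n) < pi / 2" using n_pos by (simp add: field_simps)
  then show ?thesis
    unfolding half_cot_def by (intro cot_gt_zero) (use assms n_pos in auto)
qed

lemma bend_decreasing:
  assumes "0 \<le> p" "2 * p + 1 < int n"
  shows "bend (p + 1) < bend p"
  using bend_difference[of p] half_cot_pos[of "2 * p + 1"] assms by simp

lemma bend_antimono:
  assumes "0 \<le> p" "p \<le> q" "2 * q \<le> int n"
  shows "bend q \<le> bend p"
  using assms(2,3)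
proof (induction q rule: int_ge_induct)
  case (step i)
  then show ?case using bend_decreasing[of i] assms(1) by simp
qed simp

text \<open>The bends fall up to n/2 and are symmetric about it, so between mirror indices the ends
  are maximal.\<close>

lemma bend_le_middle:
  assumes "0 \<le> p" "p \<le> q" "q \<le> int n - p"
  shows "bend q \<le> bend p"
proof (cases "2 * q \<le> int n")
  case False
  then show ?thesis
    using bend_antimono[of p "int n - q"] bend_reflect[of q] assms by simp
qed (use bend_antimono assms in simp)

section \<open>First differences and monotonicity of the ring sums\<close>

definition slope :: "int \<Rightarrow> real" where
  "slope p = ring_sum (p + 1) - ring_sum p"

lemma slope_step: "slope p = slope (p - 1) + bend p"
  using ring_sum_second_difference[of p] by (simp add: slope_def)

lemma slope_telescope: "p \<le> q \<Longrightarrow> slope q = slope p + (\<Sum>j = p + 1..q. bend j)"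
proof (induction q rule: int_ge_induct)
  case (step i)
  have "{p + 1..i + 1} = insert (i + 1) {p + 1..i}" using step.hyps by auto
  then show ?case using step slope_step[of "i + 1"] by simp
qed simp

lemma slope_reflect: "slope (int n - 1 - p) = - slope p"
  using ring_sum_reflect[of p] ring_sum_reflect[of "p + 1"] by (simp add: slope_def algebra_simps)

text \<open>From p to the mirror index n - 1 - p the slope only changes its sign, so the bends in
  between sum to minus twice the slope.\<close>

lemma twice_slope:
  assumes "0 \<le> p" "2 * p + 2 \<le> int n"
  shows "2 * slope p = - (\<Sum>j = p + 1..int n - 1 - p. bend j)"
  using slope_telescope[of p "int n - 1 - p"] slope_reflect[of p] assms by simp

text \<open>All bends in the mirror range are at most \<open>bend (p + 1)\<close>, hence
  nonpositive, and the first of them alone already gives the bound.\<close>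

lemma twice_slope_ge_aux:
  assumes "0 \<le> p" "2 * p + 2 \<le> int n" "bend (p + 1) \<le> 0"
  shows "- bend (p + 1) \<le> 2 * slope p"
proof -
  have "{p + 1..int n - 1 - p} = insert (p + 1) {p + 2..int n - 1 - p}"
    using assms by auto
  moreover have "(\<Sum>j = p + 2..int n - 1 - p. bend j) \<le> 0"
    by (rule sum_nonpos) (use bend_le_middle[of "p + 1"] assms in \<open>force intro: order_trans[of _ "bend (p + 1)"]\<close>)
  ultimately show ?thesis using twice_slope[OF assms(1,2)] by simp
qed

text \<open>As long as the bends are nonnegative the slope cannot fall. After their change of sign
  the mirror sum bounds it from below directly, without the induction hypothesis.\<close>

lemma slope_pos:
  assumes "0 \<le> p" "2 * p + 2 \<le> int n"
  shows "0 < slope p"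
  using assms
proof (induction p rule: int_ge_induct)
  case base
  show ?case using ring_sum_1_pos by (simp add: slope_def)
next
  case (step i)
  show ?case
  proof (cases "0 \<le> bend (i + 1)")
    case True
    then show ?thesis using step slope_step[of "i + 1"] by simp
  next
    case False
    then show ?thesis
      using twice_slope_ge_aux[of "i + 1"] bend_decreasing[of "i + 1"] step by simp
  qed
qed

lemma twice_slope_ge:
  assumes "0 \<le> p" "2 * p + 2 \<le> int n"
  shows "- bend (p + 1) \<le> 2 * slope p"
  using twice_slope_ge_aux[OF assms] slope_pos[OF assms] by fastforce

lemma ring_sum_mono:
  assumes "0 \<le> p" "p \<le> q" "2 * q \<le> int n"
  shows "ring_sum p \<le> ring_sum q"
  using assms(2,3)
proof (induction q rule: int_ge_induct)
  case (step i)
  then show ?case using slope_pos[of i] assms(1) by (simp add: slope_def)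
qed simp

section \<open>Mode determinants for p >= 2 and growth of their roots\<close>

definition stiffness :: "int \<Rightarrow> real" where
  "stiffness p = 4 * ring_sum p - (bend 0 - bend p) / 2"

definition central_slope :: "int \<Rightarrow> real" where
  "central_slope p = (ring_sum (p + 1) - ring_sum (p - 1)) / 2"

text \<open>The root \<open>u\<^sub>p\<close> of the determinant of mode \<open>p\<close>, see \<open>mode_det\<close> below.\<close>

definition critical_value :: "int \<Rightarrow> real" where
  "critical_value p = ring_sum p + (bend 0 - bend p) / 4 - 3 * s
     + (central_slope p)\<^sup>2 / (2 * stiffness p)"

lemma stiffness_ge: "2 * ring_sum p \<le> stiffness p"
  using bend_drop_le[of p] by (simp add: stiffness_def)

lemma stiffness_pos:
  assumes "1 \<le> p" "2 * p \<le> int n"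
  shows "0 < stiffness p"
  using stiffness_ge[of p] ring_sum_mono[of 1 p] ring_sum_1_pos assms by linarith

text \<open>With F = (E_0 - E_p) / 2 and G the central slope, the neighbours of S_p are S_p + s - F
  + G and S_p + s - F - G. The determinant becomes a difference of two squares minus G^2. One factor
  of that difference is K = 4 S_p - F, free of u, which is the stiffness.\<close>

lemma mode_det:
  assumes "1 \<le> p" "2 * p \<le> int n"
  shows "(ring_sum (p + 1) + 2 * s + u) * (ring_sum (p - 1) + 2 * s + u) - (3 * (s - ring_sum p) + u)\<^sup>2
    = 2 * stiffness p * (u - critical_value p)"
proof -
  define K G X where "K = stiffness p" and "G = central_slope p" and "X = ring_sum p"
  define F where "F = (bend 0 - bend p) / 2"
  have "ring_sum (p + 1) = X + s - F + G" "ring_sum (p - 1) = X + s - F - G"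
    using ring_sum_second_difference[of p] bend_0 by (simp_all add: X_def G_def F_def central_slope_def field_simps)
  moreover have K: "K = 4 * X - F" by (simp add: K_def stiffness_def X_def F_def)
  moreover have "K > 0" using stiffness_pos[OF assms] by (simp add: K_def)
  moreover have "2 * K * (u - critical_value p) = 2 * K * (u - X - F / 2 + 3 * s) - G\<^sup>2"
    using \<open>K > 0\<close> by (simp add: critical_value_def K_def[symmetric] G_def[symmetric] X_def[symmetric] F_def field_simps)
  ultimately have eqs: "ring_sum (p + 1) = X + s - F + G" "ring_sum (p - 1) = X + s - F - G"
    "2 * K * (u - critical_value p) = 2 * (4 * X - F) * (u - X - F / 2 + 3 * s) - G\<^sup>2"
    by simp_all
  show ?thesis
    unfolding K_def[symmetric] X_def[symmetric] eqs
    by (simp add: power2_eq_square algebra_simps)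
qed

text \<open>The other terms of u_p grow by at least D = \<open>slope p\<close>, so it suffices that
  G^2 / (2 K) drops by less than D. The drop is split into the change of the numerator over the new
  denominator, below 3 D / 4, and the change of the denominator, at most D / 4. The hypothesis
  \<open>big\<close> lifts the new stiffness above 4 s, twice the largest possible size of a
  negative bend.\<close>

lemma critical_value_increasing:
  assumes "2 \<le> p" "2 * p + 2 \<le> int n" and big: "2 * s < ring_sum (p + 1)"
  shows "critical_value p < critical_value (p + 1)"
proof -
  define K K' G G' D where "K = stiffness p" and "K' = stiffness (p + 1)"
    and "G = central_slope p" and "G' = central_slope (p + 1)" and "D = slope p"
  define e e' where "e = bend p" and "e' = bend (p + 1)"
  have D: "0 < D" unfolding D_def using slope_pos assms by simp
  have e'D: "- e' \<le> 2 * D" unfolding e'_def D_def using twice_slope_ge assms by simp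
  have ee: "e' < e" unfolding e_def e'_def using bend_decreasing[of p] assms by simp
  have e's: "- e' \<le> 2 * s" "e' \<le> 2 * s" "e \<le> 2 * s"
    unfolding e_def e'_def using abs_bend_le[of p] abs_bend_le[of "p + 1"] by auto
  have K': "4 * s < K'" "2 * ring_sum (p + 1) \<le> K'" unfolding K'_def using stiffness_ge[of "p + 1"] big by auto
  have K: "0 < K" "2 * ring_sum p \<le> K" unfolding K_def using stiffness_pos[of p] stiffness_ge assms by auto
  have s0: "0 < s" by (rule ring_sum_1_pos)
  have GD: "2 * G = D + (D - e)"
    using slope_step[of p] by (simp add: G_def D_def e_def central_slope_def slope_def)
  have G'D: "2 * G' = D + e' + D"
    using slope_step[of "p + 1"] by (simp add: G'_def D_def e'_def central_slope_def slope_def)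
  have KK: "K' - K = 4 * D - (e - e') / 2"
    by (simp add: K'_def K_def stiffness_def D_def slope_def e_def e'_def field_simps)
  have G0: "0 \<le> G"
    using slope_pos[of p] slope_pos[of "p - 1"] assms by (simp add: G_def central_slope_def slope_def)
  have GK: "2 * G \<le> K"
    using GD D_def slope_step[of p] ring_sum_mono[of 1 "p - 1"] K e's assms
    by (simp add: e_def slope_def)
  have GK': "4 * G \<le> K'"
    using K' ring_sum_nonneg[of "p - 1"] by (simp add: G_def central_slope_def)
  have diff: "critical_value (p + 1) - critical_value p = D + (e - e') / 4 + (G'\<^sup>2 / (2 * K') - G\<^sup>2 / (2 * K))"
    by (simp add: critical_value_def K_def K'_def G_def G'_def D_def e_def e'_def slope_def field_simps)
  have K'0: "0 < K'" using K' s0 by linarith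
  have split: "G\<^sup>2 / (2 * K) - G'\<^sup>2 / (2 * K')
      = (G - G') * (G + G') / (2 * K') + G\<^sup>2 * (K' - K) / (2 * K * K')"
    using K(1) K'0 by (simp add: field_simps power2_eq_square)
  have second: "G\<^sup>2 * (K' - K) / (2 * K * K') \<le> D / 4"
  proof -
    have "G\<^sup>2 * (K' - K) \<le> G\<^sup>2 * (4 * D)" by (rule mult_left_mono) (use KK ee in auto)
    also have "8 * G\<^sup>2 = 2 * G * (4 * G)" by (simp add: power2_eq_square)
    then have "8 * G\<^sup>2 \<le> K * K'"
      using mult_mono[OF GK GK'] G0 K(1) by simp
    then have "G\<^sup>2 * (4 * D) \<le> K * K' / 8 * (4 * D)"
      by (intro mult_right_mono) (use D in auto)
    finally show ?thesis using K(1) K'0 by (simp add: field_simps)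
  qed
  \<comment> \<open>G - G' = - (e + e') / 2. For e + e' >= 0 the numerator does not shrink;
    otherwise G - G' is at most - e', hence at most 2 s.\<close>
  have first: "(G - G') * (G + G') / (2 * K') < D * 3 / 4"
  proof (cases "0 \<le> e + e'")
    case True
    have "G - G' \<le> 0" using GD G'D True by simp
    moreover have "0 \<le> G + G'" using G0 G'D e'D by simp
    ultimately have "(G - G') * (G + G') \<le> 0" by (simp add: mult_nonpos_nonneg)
    then have "(G - G') * (G + G') / (2 * K') \<le> 0"
      using K'0 by (simp add: divide_nonpos_pos)
    then show ?thesis using D by simp
  next
    case False
    have a: "0 \<le> G - G'" "G - G' \<le> - e'" using GD G'D False ee by auto
    have b: "0 \<le> G + G'" "G + G' \<le> 3 * D" using GD G'D False ee e'D G0 by auto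
    have "(G - G') * (G + G') \<le> (- e') * (3 * D)"
      using a b by (intro mult_mono) auto
    also have "\<dots> \<le> (2 * s) * (3 * D)" by (rule mult_right_mono) (use e's D in auto)
    also have "\<dots> < K' / 2 * (3 * D)" by (rule mult_strict_right_mono) (use K' D in auto)
    finally show ?thesis using K'0 by (simp add: field_simps)
  qed
  have "a < b" if "b - a = D + (e - e') / 4 + (x' - x)" "x - x' = y + z" "y < D * 3 / 4" "z \<le> D / 4"
    for a b x x' y z :: real
    using that ee by (simp add: field_simps)
  from this[OF diff split first second] show ?thesis .
qed

end

section \<open>Numerical estimates\<close>

lemma sin_coeff_values:
  "sin_coeff 0 = 0" "sin_coeff (Suc 0) = 1" "sin_coeff 2 = 0" "sin_coeff 3 = - 1 / 6" "sin_coeff 4 = 0"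
  "sin_coeff 5 = 1 / 120" "sin_coeff 6 = 0" "sin_coeff 7 = - 1 / 5040" "sin_coeff 8 = 0"
  by (simp_all add: sin_coeff_def fact_numeral)

lemma sin_taylor_enclosure:
  fixes x :: real
  assumes "0 \<le> x"
  shows "x - x ^ 3 / 6 + x ^ 5 / 120 - x ^ 7 / 5040 - x ^ 9 / 362880 \<le> sin x"
    "sin x \<le> x - x ^ 3 / 6 + x ^ 5 / 120 - x ^ 7 / 5040 + x ^ 9 / 362880"
proof -
  have poly: "(\<Sum>k<9. sin_coeff k * x ^ k) = x - x ^ 3 / 6 + x ^ 5 / 120 - x ^ 7 / 5040"
  proof -
    have "{..<9::nat} = {8, 7, 6, 5, 4, 3, 2, 1, 0}" by (auto; presburger)
    then show ?thesis by (simp add: sin_coeff_values)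
  qed
  have rest: "inverse (fact 9) * \<bar>x\<bar> ^ 9 = x ^ 9 / 362880"
    using assms by (simp add: fact_numeral)
  have "\<bar>sin x - (x - x ^ 3 / 6 + x ^ 5 / 120 - x ^ 7 / 5040)\<bar> \<le> x ^ 9 / 362880"
    using Maclaurin_sin_bound[of x 9] unfolding poly rest .
  then show "x - x ^ 3 / 6 + x ^ 5 / 120 - x ^ 7 / 5040 - x ^ 9 / 362880 \<le> sin x"
    "sin x \<le> x - x ^ 3 / 6 + x ^ 5 / 120 - x ^ 7 / 5040 + x ^ 9 / 362880"
    by linarith+
qed

text \<open>
  Numerators of the Taylor bounds at \<open>a / b\<close> over the common denominator \<open>362880 b\<^sup>9\<close>; clearing denominators
  keeps the numerical checks below fast.
\<close>

definition sin_num :: "real \<Rightarrow> real \<Rightarrow> real \<Rightarrow> real" where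
  "sin_num e a b = 362880 * a * b ^ 8 - 60480 * a ^ 3 * b ^ 6 + 3024 * a ^ 5 * b ^ 4 - 72 * a ^ 7 * b ^ 2 + e * a ^ 9"

lemma sin_num_eq:
  assumes "0 < b"
  shows "a / b - (a / b) ^ 3 / 6 + (a / b) ^ 5 / 120 - (a / b) ^ 7 / 5040 + e * ((a / b) ^ 9 / 362880)
    = sin_num e a b / (362880 * b ^ 9)"
proof -
  have "x * (b ^ k / b ^ 9) = x / b ^ j" if "j + k = 9" for x j k
  proof -
    have "b ^ 9 = b ^ j * b ^ k" by (simp only: that[symmetric] power_add)
    then show ?thesis using assms by simp
  qed
  from this[of 1 8 a] this[of 3 6 "a ^ 3"] this[of 5 4 "a ^ 5"] this[of 7 2 "a ^ 7"]
  have red: "a * (b ^ 8 / b ^ 9) = a / b" "a ^ 3 * (b ^ 6 / b ^ 9) = a ^ 3 / b ^ 3"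
    "a ^ 5 * (b ^ 4 / b ^ 9) = a ^ 5 / b ^ 5" "a ^ 7 * (b ^ 2 / b ^ 9) = a ^ 7 / b ^ 7"
    by (simp_all only: power_one_right)
  have "sin_num e a b / b ^ 9 = 362880 * (a / b) - 60480 * (a ^ 3 / b ^ 3) + 3024 * (a ^ 5 / b ^ 5)
     - 72 * (a ^ 7 / b ^ 7) + e * (a ^ 9 / b ^ 9)"
    by (simp only: sin_num_def add_divide_distrib diff_divide_distrib mult.assoc times_divide_eq_right[symmetric] red)
  moreover have "A - B / 6 + C / 120 - D / 5040 + e * (E / 362880) =
     (362880 * A - 60480 * B + 3024 * C - 72 * D + e * E) / 362880" for A B C D E :: real
    by (simp add: field_simps)
  moreover have "S / (362880 * b ^ 9) = (S / b ^ 9) / 362880" for S by simp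
  ultimately show ?thesis by (simp only: power_divide)
qed

text \<open>The condition 100 a' <= 157 b keeps the angles below 1.57 < pi / 2, where the sine is
  monotone.\<close>

lemma sin_enclosure:
  assumes "0 < b" "0 \<le> a" "a / b \<le> x" "x \<le> a' / b" "100 * a' \<le> 157 * b"
  shows "sin_num (- 1) a b \<le> sin x * (362880 * b ^ 9)" "sin x * (362880 * b ^ 9) \<le> sin_num 1 a' b"
proof -
  have ab: "0 \<le> a / b" "0 \<le> a' / b" using assms by (auto intro: order_trans[of 0 "a / b"])
  have "a' / b \<le> 157 / 100" using assms(1,5) by (simp add: field_simps)
  then have "a' / b \<le> pi / 2" using pi_approx(1) by simp
  then have "sin (a / b) \<le> sin x" "sin x \<le> sin (a' / b)"
    using assms ab by (intro sin_monotone_2pi_le; linarith)+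
  then have "sin_num (- 1) a b / (362880 * b ^ 9) \<le> sin x" "sin x \<le> sin_num 1 a' b / (362880 * b ^ 9)"
    using sin_taylor_enclosure(1)[OF ab(1)] sin_taylor_enclosure(2)[OF ab(2)]
      sin_num_eq[OF assms(1), of a "- 1"] sin_num_eq[OF assms(1), of a' 1] by linarith+
  then show "sin_num (- 1) a b \<le> sin x * (362880 * b ^ 9)" "sin x * (362880 * b ^ 9) \<le> sin_num 1 a' b"
    using assms(1) by (simp_all add: pos_divide_le_eq pos_le_divide_eq)
qed

text \<open>The factor 362880 b^9 cancels, so that with numerals for all parameters each end point
  costs one comparison of integers.\<close>

lemma csc_enclosure:
  assumes "0 < b" "0 < a" "a / b \<le> x" "x \<le> a' / b" "100 * a' \<le> 157 * b"
    and "0 < q" "0 < p" "0 < p'" "p * sin_num 1 a' b \<le> q * (362880 * b ^ 9)"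
    and "q * (362880 * b ^ 9) \<le> p' * sin_num (- 1) a b"
  shows "p / q \<le> 1 / sin x \<and> 1 / sin x \<le> p' / q"
proof -
  define M where "M = 362880 * b ^ 9"
  have M: "0 < M" using assms(1) by (simp add: M_def)
  have e: "sin_num (- 1) a b \<le> sin x * M" "sin x * M \<le> sin_num 1 a' b"
    using sin_enclosure[of b a x a'] assms by (simp_all add: M_def)
  have "p * (sin x * M) \<le> p * sin_num 1 a' b" using e(2) assms(7) by (intro mult_left_mono) auto
  then have "(p * sin x) * M \<le> q * M" using assms(9) by (simp add: M_def mult.assoc)
  then have 1: "p * sin x \<le> q" using M by simp
  have "p' * sin_num (- 1) a b \<le> p' * (sin x * M)" using e(1) assms(8) by (intro mult_left_mono) auto
  then have "q * M \<le> (p' * sin x) * M" using assms(10) by (simp add: M_def mult.assoc)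
  then have 2: "q \<le> p' * sin x" using M by simp
  then have "0 < sin x" using assms(6,8) by (smt (verit) mult_nonneg_nonpos)
  then show ?thesis using 1 2 assms(6) by (simp add: field_simps)
qed

text \<open>The cosine is treated as the sine of the complementary angle, which c and c' enclose.
  Both angles share the grid b, so the factor 362880 b^9 cancels again.\<close>

lemma cot_enclosure:
  assumes "0 < b" "0 < a" "a / b \<le> x" "x \<le> a' / b" "100 * a' \<le> 157 * b"
    and "0 < c" "c / b \<le> pi / 2 - x" "pi / 2 - x \<le> c' / b" "100 * c' \<le> 157 * b"
    and "0 < q" "0 < p" "0 < p'" "p * sin_num 1 a' b \<le> q * sin_num (- 1) c b"
    and "q * sin_num 1 c' b \<le> p' * sin_num (- 1) a b"
  shows "p / q \<le> cot x \<and> cot x \<le> p' / q"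
proof -
  define M where "M = 362880 * b ^ 9"
  have M: "0 < M" using assms(1) by (simp add: M_def)
  have e: "sin_num (- 1) a b \<le> sin x * M" "sin x * M \<le> sin_num 1 a' b"
    "sin_num (- 1) c b \<le> cos x * M" "cos x * M \<le> sin_num 1 c' b"
    using sin_enclosure[of b a x a'] sin_enclosure[of b c "pi / 2 - x" c'] assms
    by (simp_all add: M_def cos_sin_eq)
  have "0 < a / b" "0 < c / b" using assms by simp_all
  then have x: "0 < sin x" using assms(3,7) by (intro sin_gt_zero) linarith+
  have "p * (sin x * M) \<le> p * sin_num 1 a' b" using e(2) assms(11) by (intro mult_left_mono) auto
  also have "\<dots> \<le> q * sin_num (- 1) c b" by (rule assms(13))
  also have "\<dots> \<le> q * (cos x * M)" using e(3) assms(10) by (intro mult_left_mono) auto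
  finally have "(p * sin x) * M \<le> (q * cos x) * M" by (simp add: mult.assoc)
  then have 1: "p * sin x \<le> q * cos x" using M by simp
  have "q * (cos x * M) \<le> q * sin_num 1 c' b" using e(4) assms(10) by (intro mult_left_mono) auto
  also have "\<dots> \<le> p' * sin_num (- 1) a b" by (rule assms(14))
  also have "\<dots> \<le> p' * (sin x * M)" using e(1) assms(12) by (intro mult_left_mono) auto
  finally have "(q * cos x) * M \<le> (p' * sin x) * M" by (simp add: mult.assoc)
  then have "q * cos x \<le> p' * sin x" using M by simp
  then show ?thesis using 1 x assms(10) by (simp add: cot_def field_simps)
qed

section \<open>Enclosures for the polygons with 3 to 10 vertices\<close>

context ngon
begin

lemma sin_ang_reflect: "l \<le> n \<Longrightarrow> sin (ang (n - l)) = sin (ang l)"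
proof -
  assume "l \<le> n"
  then have "ang (n - l) = pi - ang l"
    using n_pos by (simp add: ang_def of_nat_diff field_simps)
  then show ?thesis by simp
qed

text \<open>csc is symmetric about pi / 2, so the k outer terms on either side agree and the weight
  1/8 doubles. The middle range is empty for odd n with maximal k, a single 1 for even n, and
  droppable in lower bounds.\<close>

lemma ring_sum_1_halves:
  assumes "2 * k < n"
  shows "s = (\<Sum>l = 1..k. 1 / sin (ang l)) / 4 + (\<Sum>l = k + 1..<n - k. 1 / sin (ang l)) / 8"
proof -
  let ?f = "\<lambda>l. 1 / sin (ang l)"
  have "{1..<n} = {1..k} \<union> {k + 1..<n - k} \<union> {n - k..<n}" using assms by auto
  then have "(\<Sum>l = 1..<n. ?f l) = (\<Sum>l\<in>{1..k} \<union> {k + 1..<n - k}. ?f l) + (\<Sum>l = n - k..<n. ?f l)"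
    using assms by (simp only:) (intro sum.union_disjoint; auto)
  also have "(\<Sum>l\<in>{1..k} \<union> {k + 1..<n - k}. ?f l) = (\<Sum>l = 1..k. ?f l) + (\<Sum>l = k + 1..<n - k. ?f l)"
    by (intro sum.union_disjoint) auto
  also have "(\<Sum>l = n - k..<n. ?f l) = (\<Sum>l = 1..k. ?f l)"
    by (rule sum.reindex_bij_witness[of _ "\<lambda>l. n - l" "\<lambda>l. n - l"]) (use assms sin_ang_reflect in auto)
  finally have "(\<Sum>l = 1..<n. ?f l) = 2 * (\<Sum>l = 1..k. ?f l) + (\<Sum>l = k + 1..<n - k. ?f l)" by simp
  moreover have "s = (\<Sum>l = 1..<n. ?f l) / 8"
    unfolding ring_sum_1 sum_divide_distrib by (simp add: mult.commute)
  ultimately show ?thesis by (simp add: add_divide_distrib)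
qed

lemma ring_sum_1_odd:
  assumes "n = 2 * k + 1"
  shows "s = (\<Sum>l = 1..k. 1 / sin (ang l)) / 4"
  using ring_sum_1_halves[of k] assms by simp

lemma ring_sum_1_even:
  assumes "n = 2 * k + 2"
  shows "s = (\<Sum>l = 1..k. 1 / sin (ang l)) / 4 + 1 / 8"
proof -
  have "{k + 1..<n - k} = {k + 1}" using assms by auto
  moreover have mid: "ang (k + 1) = pi / 2" unfolding ang_def using assms by (simp add: field_simps)
  ultimately have "(\<Sum>l = k + 1..<n - k. 1 / sin (ang l)) = 1"
    by (simp only: sum.insert sum.empty finite.emptyI empty_iff not_False_eq_True mid) simp
  then show ?thesis using ring_sum_1_halves[of k] assms by simp
qed

lemma sum_upto_numeral:
  fixes f :: "nat \<Rightarrow> real"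
  shows "(\<Sum>l = 1..1. f l) = f 1" "(\<Sum>l = 1..2. f l) = f 1 + f 2" "(\<Sum>l = 1..3. f l) = f 1 + f 2 + f 3"
    "(\<Sum>l = 1..4. f l) = f 1 + f 2 + f 3 + f 4" "(\<Sum>l = 1..5. f l) = f 1 + f 2 + f 3 + f 4 + f 5"
    "(\<Sum>l = 1..6. f l) = f 1 + f 2 + f 3 + f 4 + f 5 + f 6"
  by (simp_all add: numeral_eq_Suc)

text \<open>The numerals are the angles in units of 10^-4, rounded down and up; in the cotangent the
  second pair does this for the complementary angle. The cases up to n = 9 follow the same pattern,
  with a further 1/8 in s for even n.\<close>

lemma trig_enclosure_3:
  assumes n: "n = 3"
  shows "5773/20000 \<le> s" "s \<le> 2887/10000"
    "17319/10000 \<le> half_cot 1" "half_cot 1 \<le> 17324/10000"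
proof -
  define x1 where "x1 = 1 / sin (ang 1)"
  have c1: "11546/10000 \<le> x1 \<and> x1 \<le> 11548/10000"
    unfolding x1_def ang_def
    by (rule csc_enclosure[of "10000" "10471" _ "10472"]) (use pi_approx in \<open>simp_all add: n sin_num_def\<close>)
  have h1: "17319/10000 \<le> half_cot 1 \<and> half_cot 1 \<le> 17324/10000"
    unfolding half_cot_def
    by (rule cot_enclosure[of "10000" "5235" _ "5236" "10471" "10472"]) (use pi_approx in \<open>simp_all add: n sin_num_def\<close>)
  have "s = (\<Sum>l = 1..1. 1 / sin (ang l)) / 4"
    by (rule ring_sum_1_odd) (simp add: n)
  then have eq: "s = x1 / 4"
    unfolding x1_def sum_upto_numeral by (simp only: add_divide_distrib)
  show "5773/20000 \<le> s" unfolding eq using c1[THEN conjunct1] c1[THEN conjunct2] by linarith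
  show "s \<le> 2887/10000" unfolding eq using c1[THEN conjunct1] c1[THEN conjunct2] by linarith
  show "17319/10000 \<le> half_cot 1" "half_cot 1 \<le> 17324/10000"
    using h1 by simp_all
qed

lemma trig_enclosure_4:
  assumes n: "n = 4"
  shows "9571/20000 \<le> s" "s \<le> 2393/5000"
    "24140/10000 \<le> half_cot 1" "half_cot 1 \<le> 24148/10000"
    "4141/10000 \<le> half_cot 3" "half_cot 3 \<le> 4143/10000"
proof -
  define x1 where "x1 = 1 / sin (ang 1)"
  have c1: "14142/10000 \<le> x1 \<and> x1 \<le> 14144/10000"
    unfolding x1_def ang_def
    by (rule csc_enclosure[of "10000" "7853" _ "7854"]) (use pi_approx in \<open>simp_all add: n sin_num_def\<close>)
  have h1: "24140/10000 \<le> half_cot 1 \<and> half_cot 1 \<le> 24148/10000"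
    unfolding half_cot_def
    by (rule cot_enclosure[of "10000" "3926" _ "3927" "11780" "11781"]) (use pi_approx in \<open>simp_all add: n sin_num_def\<close>)
  have h3: "4141/10000 \<le> half_cot 3 \<and> half_cot 3 \<le> 4143/10000"
    unfolding half_cot_def
    by (rule cot_enclosure[of "10000" "11780" _ "11781" "3926" "3927"]) (use pi_approx in \<open>simp_all add: n sin_num_def\<close>)
  have "s = (\<Sum>l = 1..1. 1 / sin (ang l)) / 4 + 1 / 8"
    by (rule ring_sum_1_even) (simp add: n)
  then have eq: "s = x1 / 4 + 1 / 8"
    unfolding x1_def sum_upto_numeral by (simp only: add_divide_distrib)
  show "9571/20000 \<le> s" unfolding eq using c1[THEN conjunct1] c1[THEN conjunct2] by linarith
  show "s \<le> 2393/5000" unfolding eq using c1[THEN conjunct1] c1[THEN conjunct2] by linarith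
  show "24140/10000 \<le> half_cot 1" "half_cot 1 \<le> 24148/10000"
    using h1 by simp_all
  show "4141/10000 \<le> half_cot 3" "half_cot 3 \<le> 4143/10000"
    using h3 by simp_all
qed

lemma trig_enclosure_5:
  assumes n: "n = 5"
  shows "1101/1600 \<le> s" "s \<le> 2753/4000"
    "30771/10000 \<le> half_cot 1" "half_cot 1 \<le> 30784/10000"
    "7265/10000 \<le> half_cot 3" "half_cot 3 \<le> 7267/10000"
proof -
  define x1 where "x1 = 1 / sin (ang 1)"
  have c1: "17011/10000 \<le> x1 \<and> x1 \<le> 17014/10000"
    unfolding x1_def ang_def
    by (rule csc_enclosure[of "10000" "6283" _ "6284"]) (use pi_approx in \<open>simp_all add: n sin_num_def\<close>)
  define x2 where "x2 = 1 / sin (ang 2)"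
  have c2: "10514/10000 \<le> x2 \<and> x2 \<le> 10516/10000"
    unfolding x2_def ang_def
    by (rule csc_enclosure[of "10000" "12566" _ "12567"]) (use pi_approx in \<open>simp_all add: n sin_num_def\<close>)
  have h1: "30771/10000 \<le> half_cot 1 \<and> half_cot 1 \<le> 30784/10000"
    unfolding half_cot_def
    by (rule cot_enclosure[of "10000" "3141" _ "3142" "12566" "12567"]) (use pi_approx in \<open>simp_all add: n sin_num_def\<close>)
  have h3: "7265/10000 \<le> half_cot 3 \<and> half_cot 3 \<le> 7267/10000"
    unfolding half_cot_def
    by (rule cot_enclosure[of "10000" "9424" _ "9425" "6283" "6284"]) (use pi_approx in \<open>simp_all add: n sin_num_def\<close>)
  have "s = (\<Sum>l = 1..2. 1 / sin (ang l)) / 4"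
    by (rule ring_sum_1_odd) (simp add: n)
  then have eq: "s = x1 / 4 + x2 / 4"
    unfolding x1_def x2_def sum_upto_numeral by (simp only: add_divide_distrib)
  show "1101/1600 \<le> s" unfolding eq using c1[THEN conjunct1] c1[THEN conjunct2] c2[THEN conjunct1] c2[THEN conjunct2] by linarith
  show "s \<le> 2753/4000" unfolding eq using c1[THEN conjunct1] c1[THEN conjunct2] c2[THEN conjunct1] c2[THEN conjunct2] by linarith
  show "30771/10000 \<le> half_cot 1" "half_cot 1 \<le> 30784/10000"
    using h1 by simp_all
  show "7265/10000 \<le> half_cot 3" "half_cot 3 \<le> 7267/10000"
    using h3 by simp_all
qed

lemma trig_enclosure_6:
  assumes n: "n = 6"
  shows "7309/8000 \<le> s" "s \<le> 4569/5000"
    "37317/10000 \<le> half_cot 1" "half_cot 1 \<le> 37335/10000"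
    "9998/10000 \<le> half_cot 3" "half_cot 3 \<le> 10002/10000"
    "2678/10000 \<le> half_cot 5" "half_cot 5 \<le> 2680/10000"
proof -
  define x1 where "x1 = 1 / sin (ang 1)"
  have c1: "19999/10000 \<le> x1 \<and> x1 \<le> 20004/10000"
    unfolding x1_def ang_def
    by (rule csc_enclosure[of "10000" "5235" _ "5236"]) (use pi_approx in \<open>simp_all add: n sin_num_def\<close>)
  define x2 where "x2 = 1 / sin (ang 2)"
  have c2: "11546/10000 \<le> x2 \<and> x2 \<le> 11548/10000"
    unfolding x2_def ang_def
    by (rule csc_enclosure[of "10000" "10471" _ "10472"]) (use pi_approx in \<open>simp_all add: n sin_num_def\<close>)
  have h1: "37317/10000 \<le> half_cot 1 \<and> half_cot 1 \<le> 37335/10000"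
    unfolding half_cot_def
    by (rule cot_enclosure[of "10000" "2617" _ "2618" "13089" "13090"]) (use pi_approx in \<open>simp_all add: n sin_num_def\<close>)
  have h3: "9998/10000 \<le> half_cot 3 \<and> half_cot 3 \<le> 10002/10000"
    unfolding half_cot_def
    by (rule cot_enclosure[of "10000" "7853" _ "7854" "7853" "7854"]) (use pi_approx in \<open>simp_all add: n sin_num_def\<close>)
  have h5: "2678/10000 \<le> half_cot 5 \<and> half_cot 5 \<le> 2680/10000"
    unfolding half_cot_def
    by (rule cot_enclosure[of "10000" "13089" _ "13090" "2617" "2618"]) (use pi_approx in \<open>simp_all add: n sin_num_def\<close>)
  have "s = (\<Sum>l = 1..2. 1 / sin (ang l)) / 4 + 1 / 8"
    by (rule ring_sum_1_even) (simp add: n)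
  then have eq: "s = x1 / 4 + x2 / 4 + 1 / 8"
    unfolding x1_def x2_def sum_upto_numeral by (simp only: add_divide_distrib)
  show "7309/8000 \<le> s" unfolding eq using c1[THEN conjunct1] c1[THEN conjunct2] c2[THEN conjunct1] c2[THEN conjunct2] by linarith
  show "s \<le> 4569/5000" unfolding eq using c1[THEN conjunct1] c1[THEN conjunct2] c2[THEN conjunct1] c2[THEN conjunct2] by linarith
  show "37317/10000 \<le> half_cot 1" "half_cot 1 \<le> 37335/10000"
    using h1 by simp_all
  show "9998/10000 \<le> half_cot 3" "half_cot 3 \<le> 10002/10000"
    using h3 by simp_all
  show "2678/10000 \<le> half_cot 5" "half_cot 5 \<le> 2680/10000"
    using h5 by simp_all
qed

lemma trig_enclosure_7:
  assumes n: "n = 7"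
  shows "23047/20000 \<le> s" "s \<le> 5763/5000"
    "43808/10000 \<le> half_cot 1" "half_cot 1 \<le> 43833/10000"
    "12538/10000 \<le> half_cot 3" "half_cot 3 \<le> 12542/10000"
proof -
  define x1 where "x1 = 1 / sin (ang 1)"
  have c1: "23047/10000 \<le> x1 \<and> x1 \<le> 23053/10000"
    unfolding x1_def ang_def
    by (rule csc_enclosure[of "10000" "4487" _ "4488"]) (use pi_approx in \<open>simp_all add: n sin_num_def\<close>)
  define x2 where "x2 = 1 / sin (ang 2)"
  have c2: "12790/10000 \<le> x2 \<and> x2 \<le> 12792/10000"
    unfolding x2_def ang_def
    by (rule csc_enclosure[of "10000" "8975" _ "8976"]) (use pi_approx in \<open>simp_all add: n sin_num_def\<close>)
  define x3 where "x3 = 1 / sin (ang 3)"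
  have c3: "10257/10000 \<le> x3 \<and> x3 \<le> 10259/10000"
    unfolding x3_def ang_def
    by (rule csc_enclosure[of "10000" "13463" _ "13464"]) (use pi_approx in \<open>simp_all add: n sin_num_def\<close>)
  have h1: "43808/10000 \<le> half_cot 1 \<and> half_cot 1 \<le> 43833/10000"
    unfolding half_cot_def
    by (rule cot_enclosure[of "10000" "2243" _ "2244" "13463" "13464"]) (use pi_approx in \<open>simp_all add: n sin_num_def\<close>)
  have h3: "12538/10000 \<le> half_cot 3 \<and> half_cot 3 \<le> 12542/10000"
    unfolding half_cot_def
    by (rule cot_enclosure[of "10000" "6731" _ "6732" "8975" "8976"]) (use pi_approx in \<open>simp_all add: n sin_num_def\<close>)
  have "s = (\<Sum>l = 1..3. 1 / sin (ang l)) / 4"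
    by (rule ring_sum_1_odd) (simp add: n)
  then have eq: "s = x1 / 4 + x2 / 4 + x3 / 4"
    unfolding x1_def x2_def x3_def sum_upto_numeral by (simp only: add_divide_distrib)
  show "23047/20000 \<le> s" unfolding eq using c1[THEN conjunct1] c1[THEN conjunct2] c2[THEN conjunct1] c2[THEN conjunct2] c3[THEN conjunct1] c3[THEN conjunct2] by linarith
  show "s \<le> 5763/5000" unfolding eq using c1[THEN conjunct1] c1[THEN conjunct2] c2[THEN conjunct1] c2[THEN conjunct2] c3[THEN conjunct1] c3[THEN conjunct2] by linarith
  show "43808/10000 \<le> half_cot 1" "half_cot 1 \<le> 43833/10000"
    using h1 by simp_all
  show "12538/10000 \<le> half_cot 3" "half_cot 3 \<le> 12542/10000"
    using h3 by simp_all
qed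

lemma trig_enclosure_8:
  assumes n: "n = 8"
  shows "1753/1250 \<le> s" "s \<le> 56107/40000"
    "50255/10000 \<le> half_cot 1" "half_cot 1 \<le> 50287/10000"
    "14964/10000 \<le> half_cot 3" "half_cot 3 \<le> 14968/10000"
proof -
  define x1 where "x1 = 1 / sin (ang 1)"
  have c1: "26131/10000 \<le> x1 \<and> x1 \<le> 26138/10000"
    unfolding x1_def ang_def
    by (rule csc_enclosure[of "10000" "3926" _ "3927"]) (use pi_approx in \<open>simp_all add: n sin_num_def\<close>)
  define x2 where "x2 = 1 / sin (ang 2)"
  have c2: "14142/10000 \<le> x2 \<and> x2 \<le> 14144/10000"
    unfolding x2_def ang_def
    by (rule csc_enclosure[of "10000" "7853" _ "7854"]) (use pi_approx in \<open>simp_all add: n sin_num_def\<close>)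
  define x3 where "x3 = 1 / sin (ang 3)"
  have c3: "10823/10000 \<le> x3 \<and> x3 \<le> 10825/10000"
    unfolding x3_def ang_def
    by (rule csc_enclosure[of "10000" "11780" _ "11781"]) (use pi_approx in \<open>simp_all add: n sin_num_def\<close>)
  have h1: "50255/10000 \<le> half_cot 1 \<and> half_cot 1 \<le> 50287/10000"
    unfolding half_cot_def
    by (rule cot_enclosure[of "10000" "1963" _ "1964" "13744" "13745"]) (use pi_approx in \<open>simp_all add: n sin_num_def\<close>)
  have h3: "14964/10000 \<le> half_cot 3 \<and> half_cot 3 \<le> 14968/10000"
    unfolding half_cot_def
    by (rule cot_enclosure[of "10000" "5890" _ "5891" "9817" "9818"]) (use pi_approx in \<open>simp_all add: n sin_num_def\<close>)
  have "s = (\<Sum>l = 1..3. 1 / sin (ang l)) / 4 + 1 / 8"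
    by (rule ring_sum_1_even) (simp add: n)
  then have eq: "s = x1 / 4 + x2 / 4 + x3 / 4 + 1 / 8"
    unfolding x1_def x2_def x3_def sum_upto_numeral by (simp only: add_divide_distrib)
  show "1753/1250 \<le> s" unfolding eq using c1[THEN conjunct1] c1[THEN conjunct2] c2[THEN conjunct1] c2[THEN conjunct2] c3[THEN conjunct1] c3[THEN conjunct2] by linarith
  show "s \<le> 56107/40000" unfolding eq using c1[THEN conjunct1] c1[THEN conjunct2] c2[THEN conjunct1] c2[THEN conjunct2] c3[THEN conjunct1] c3[THEN conjunct2] by linarith
  show "50255/10000 \<le> half_cot 1" "half_cot 1 \<le> 50287/10000"
    using h1 by simp_all
  show "14964/10000 \<le> half_cot 3" "half_cot 3 \<le> 14968/10000"
    using h3 by simp_all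
qed

lemma trig_enclosure_9:
  assumes n: "n = 9"
  shows "6649/4000 \<le> s" "s \<le> 33253/20000"
    "56684/10000 \<le> half_cot 1" "half_cot 1 \<le> 56724/10000"
    "17319/10000 \<le> half_cot 3" "half_cot 3 \<le> 17324/10000"
proof -
  define x1 where "x1 = 1 / sin (ang 1)"
  have c1: "29235/10000 \<le> x1 \<and> x1 \<le> 29244/10000"
    unfolding x1_def ang_def
    by (rule csc_enclosure[of "10000" "3490" _ "3491"]) (use pi_approx in \<open>simp_all add: n sin_num_def\<close>)
  define x2 where "x2 = 1 / sin (ang 2)"
  have c2: "15555/10000 \<le> x2 \<and> x2 \<le> 15558/10000"
    unfolding x2_def ang_def
    by (rule csc_enclosure[of "10000" "6981" _ "6982"]) (use pi_approx in \<open>simp_all add: n sin_num_def\<close>)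
  define x3 where "x3 = 1 / sin (ang 3)"
  have c3: "11546/10000 \<le> x3 \<and> x3 \<le> 11548/10000"
    unfolding x3_def ang_def
    by (rule csc_enclosure[of "10000" "10471" _ "10472"]) (use pi_approx in \<open>simp_all add: n sin_num_def\<close>)
  define x4 where "x4 = 1 / sin (ang 4)"
  have c4: "10154/10000 \<le> x4 \<and> x4 \<le> 10156/10000"
    unfolding x4_def ang_def
    by (rule csc_enclosure[of "10000" "13962" _ "13963"]) (use pi_approx in \<open>simp_all add: n sin_num_def\<close>)
  have h1: "56684/10000 \<le> half_cot 1 \<and> half_cot 1 \<le> 56724/10000"
    unfolding half_cot_def
    by (rule cot_enclosure[of "10000" "1745" _ "1746" "13962" "13963"]) (use pi_approx in \<open>simp_all add: n sin_num_def\<close>)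
  have h3: "17319/10000 \<le> half_cot 3 \<and> half_cot 3 \<le> 17324/10000"
    unfolding half_cot_def
    by (rule cot_enclosure[of "10000" "5235" _ "5236" "10471" "10472"]) (use pi_approx in \<open>simp_all add: n sin_num_def\<close>)
  have "s = (\<Sum>l = 1..4. 1 / sin (ang l)) / 4"
    by (rule ring_sum_1_odd) (simp add: n)
  then have eq: "s = x1 / 4 + x2 / 4 + x3 / 4 + x4 / 4"
    unfolding x1_def x2_def x3_def x4_def sum_upto_numeral by (simp only: add_divide_distrib)
  show "6649/4000 \<le> s" unfolding eq using c1[THEN conjunct1] c1[THEN conjunct2] c2[THEN conjunct1] c2[THEN conjunct2] c3[THEN conjunct1] c3[THEN conjunct2] c4[THEN conjunct1] c4[THEN conjunct2] by linarith
  show "s \<le> 33253/20000" unfolding eq using c1[THEN conjunct1] c1[THEN conjunct2] c2[THEN conjunct1] c2[THEN conjunct2] c3[THEN conjunct1] c3[THEN conjunct2] c4[THEN conjunct1] c4[THEN conjunct2] by linarith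
  show "56684/10000 \<le> half_cot 1" "half_cot 1 \<le> 56724/10000"
    using h1 by simp_all
  show "17319/10000 \<le> half_cot 3" "half_cot 3 \<le> 17324/10000"
    using h3 by simp_all
qed

text \<open>u_2 is only about 0.0016 for n = 10, hence one more decimal digit.\<close>

lemma trig_enclosure_10:
  assumes n: "n = 10"
  shows "772487/400000 \<le> s" "s \<le> 77251/40000"
    "631294/100000 \<le> half_cot 1" "half_cot 1 \<le> 631415/100000"
    "196257/100000 \<le> half_cot 3" "half_cot 3 \<le> 196265/100000"
proof -
  define x1 where "x1 = 1 / sin (ang 1)"
  have c1: "323606/100000 \<le> x1 \<and> x1 \<le> 323617/100000"
    unfolding x1_def ang_def
    by (rule csc_enclosure[of "100000" "31415" _ "31416"]) (use pi_approx in \<open>simp_all add: n sin_num_def\<close>)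
  define x2 where "x2 = 1 / sin (ang 2)"
  have c2: "170129/100000 \<le> x2 \<and> x2 \<le> 170133/100000"
    unfolding x2_def ang_def
    by (rule csc_enclosure[of "100000" "62831" _ "62832"]) (use pi_approx in \<open>simp_all add: n sin_num_def\<close>)
  define x3 where "x3 = 1 / sin (ang 3)"
  have c3: "123606/100000 \<le> x3 \<and> x3 \<le> 123608/100000"
    unfolding x3_def ang_def
    by (rule csc_enclosure[of "100000" "94247" _ "94248"]) (use pi_approx in \<open>simp_all add: n sin_num_def\<close>)
  define x4 where "x4 = 1 / sin (ang 4)"
  have c4: "105146/100000 \<le> x4 \<and> x4 \<le> 105152/100000"
    unfolding x4_def ang_def
    by (rule csc_enclosure[of "100000" "125663" _ "125664"]) (use pi_approx in \<open>simp_all add: n sin_num_def\<close>)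
  have h1: "631294/100000 \<le> half_cot 1 \<and> half_cot 1 \<le> 631415/100000"
    unfolding half_cot_def
    by (rule cot_enclosure[of "100000" "15707" _ "15708" "141371" "141372"]) (use pi_approx in \<open>simp_all add: n sin_num_def\<close>)
  have h3: "196257/100000 \<le> half_cot 3 \<and> half_cot 3 \<le> 196265/100000"
    unfolding half_cot_def
    by (rule cot_enclosure[of "100000" "47123" _ "47124" "109955" "109956"]) (use pi_approx in \<open>simp_all add: n sin_num_def\<close>)
  have "s = (\<Sum>l = 1..4. 1 / sin (ang l)) / 4 + 1 / 8"
    by (rule ring_sum_1_even) (simp add: n)
  then have eq: "s = x1 / 4 + x2 / 4 + x3 / 4 + x4 / 4 + 1 / 8"
    unfolding x1_def x2_def x3_def x4_def sum_upto_numeral by (simp only: add_divide_distrib)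
  show "772487/400000 \<le> s" unfolding eq using c1[THEN conjunct1] c1[THEN conjunct2] c2[THEN conjunct1] c2[THEN conjunct2] c3[THEN conjunct1] c3[THEN conjunct2] c4[THEN conjunct1] c4[THEN conjunct2] by linarith
  show "s \<le> 77251/40000" unfolding eq using c1[THEN conjunct1] c1[THEN conjunct2] c2[THEN conjunct1] c2[THEN conjunct2] c3[THEN conjunct1] c3[THEN conjunct2] c4[THEN conjunct1] c4[THEN conjunct2] by linarith
  show "631294/100000 \<le> half_cot 1" "half_cot 1 \<le> 631415/100000"
    using h1 by simp_all
  show "196257/100000 \<le> half_cot 3" "half_cot 3 \<le> 196265/100000"
    using h3 by simp_all
qed

section \<open>Low modes in closed form and bounds for general n\<close>

lemma bend_1: "bend 1 = 2 * s - half_cot 1 / 2"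
  using bend_difference[of 0] bend_0 n_ge_3 by simp

lemma bend_2: "bend 2 = 2 * s - half_cot 1 / 2 - half_cot 3 / 2"
  using bend_difference[of 1] bend_1 n_ge_3 by simp

lemma ring_sum_2: "ring_sum 2 = 4 * s - half_cot 1 / 2"
  using ring_sum_second_difference[of 1] bend_1 by simp

lemma ring_sum_3: "ring_sum 3 = 9 * s - 3 * half_cot 1 / 2 - half_cot 3 / 2"
  using ring_sum_second_difference[of 2] ring_sum_2 bend_2 by simp

lemma half_cot_le:
  assumes "0 < j" "j < int n"
  shows "half_cot j \<le> 2 * n / (j * pi)"
proof -
  define x where "x = j * pi / (2 * n)"
  have "real_of_int j < n" using assms by linarith
  then have x: "0 < x" "x < pi / 2" using assms n_pos by (simp_all add: x_def field_simps)
  then have "x \<le> tan x" using abs_tan_ge[of x] tan_gt_zero[of x] by simp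
  then have "cot x \<le> 1 / x"
    using x tan_gt_zero[of x] by (simp add: cot_altdef inverse_eq_divide frac_le)
  then show ?thesis by (simp add: half_cot_def x_def)
qed

text \<open>cot x >= 1 / x - x / 2, from cos x >= 1 - x^2 / 2 and sin x <= x.\<close>

lemma half_cot_ge:
  assumes "0 < j" "j < int n"
  shows "2 * n / (j * pi) - j * pi / (4 * n) \<le> half_cot j"
proof -
  define x where "x = j * pi / (2 * n)"
  have "real_of_int j < n" using assms by linarith
  then have x: "0 < x" "x < pi / 2" using assms n_pos by (simp_all add: x_def field_simps)
  have "(sin (x / 2))\<^sup>2 \<le> (x / 2)\<^sup>2"
    using x sin_x_le_x[of "x / 2"] sin_gt_zero[of "x / 2"] by (intro power_mono) auto
  then have c: "1 - x\<^sup>2 / 2 \<le> cos x"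
    using cos_double_sin[of "x / 2"] by (simp add: power_divide)
  have s: "0 < sin x" "sin x \<le> x" using x sin_x_le_x[of x] sin_gt_zero[of x] by auto
  have "cos x / x \<le> cot x"
    using s x cos_gt_zero[of x] by (simp add: cot_def frac_le)
  moreover have "(1 - x\<^sup>2 / 2) / x \<le> cos x / x" using c x by (intro divide_right_mono) auto
  moreover have "(1 - x\<^sup>2 / 2) / x = 1 / x - x / 2" using x by (simp add: field_simps power2_eq_square)
  ultimately show ?thesis by (simp add: half_cot_def x_def)
qed

lemma half_cot_1_le: "half_cot 1 \<le> n"
proof -
  have "2 * real n / pi \<le> n" using n_pos pi_ge_two by (simp add: field_simps)
  then show ?thesis using half_cot_le[of 1] n_ge_3 by simp
qed

text \<open>The left side is the beginning of the Laurent series. Multiplied by the Taylor bound of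
  the sine, its quadratic terms cancel and 1 - x^4 (14 - x^2) / 720 remains.\<close>

lemma csc_ge:
  assumes "0 < x" "x \<le> (2 :: real)"
  shows "1 / x + x / 6 \<le> 1 / sin x"
proof -
  have poly: "(\<Sum>k<5. sin_coeff k * x ^ k) = x - x ^ 3 / 6"
  proof -
    have "{..<5::nat} = {4, 3, 2, 1, 0}" by (auto; presburger)
    then show ?thesis by (simp add: sin_coeff_values)
  qed
  have rest: "inverse (fact 5) * \<bar>x\<bar> ^ 5 = x ^ 5 / 120"
    using assms by (simp add: fact_numeral)
  have up: "sin x \<le> x - x ^ 3 / 6 + x ^ 5 / 120"
    using Maclaurin_sin_bound[of x 5] unfolding poly rest by linarith
  have pos: "0 < sin x" using assms pi_gt3 by (intro sin_gt_zero) auto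
  have "(1 / x + x / 6) * sin x \<le> (1 / x + x / 6) * (x - x ^ 3 / 6 + x ^ 5 / 120)"
    by (intro mult_left_mono up) (use assms in auto)
  also have "\<dots> = 1 - x ^ 4 * (14 - x\<^sup>2) / 720"
    using assms by (simp add: field_simps eval_nat_numeral)
  also have "\<dots> \<le> 1"
  proof -
    have "x\<^sup>2 \<le> 2\<^sup>2" using assms by (intro power_mono) auto
    then show ?thesis by simp
  qed
  finally show ?thesis using pos by (simp add: field_simps)
qed

text \<open>For fixed k this is an explicit combination of n / pi and pi / n: the k outer pairs are
  estimated by \<open>csc_ge\<close>, the middle terms dropped.\<close>

lemma ring_sum_1_ge:
  assumes "2 * k < n"
  shows "(\<Sum>l = 1..k. 1 / ang l + ang l / 6) / 4 \<le> s"
proof -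
  have "1 / ang l + ang l / 6 \<le> 1 / sin (ang l)" if "l \<in> {1..k}" for l
  proof (rule csc_ge)
    show "0 < ang l" using that n_pos by (simp add: ang_def)
    have "2 * real l \<le> n" using that assms by auto
    then have "pi * (2 * real l) \<le> 4 * real n" using pi_less_4 by (intro mult_mono) auto
    then show "ang l \<le> 2" using n_pos by (simp add: ang_def field_simps)
  qed
  then have "(\<Sum>l = 1..k. 1 / ang l + ang l / 6) \<le> (\<Sum>l = 1..k. 1 / sin (ang l))"
    by (rule sum_mono)
  moreover have "0 \<le> (\<Sum>l = k + 1..<n - k. 1 / sin (ang l))"
  proof (rule sum_nonneg)
    fix l assume "l \<in> {k + 1..<n - k}"
    then have "l \<in> {1..<n}" by auto
    then have "0 < sin (ang l)" by (rule sin_ang_pos)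
    then show "0 \<le> 1 / sin (ang l)" by simp
  qed
  ultimately show ?thesis
    unfolding ring_sum_1_halves[OF assms] by linarith
qed

text \<open>The determinant of mode 1 multiplied by \<open>elimination\<close>, see
  \<open>mode_det_1\<close>. With x = 3 m / 2 that factor n + 2 m + 4 s reads n + 4 x / 3 + 4
  s.\<close>

definition centre_poly :: "real \<Rightarrow> real" where
  "centre_poly x = (real n + 4 * x / 3 + 4 * s) * ((ring_sum 2 + 2 * s) * (2 * s) + x * (ring_sum 2 + 4 * s))
     - real n * x * ((ring_sum 2 + 2 * s) / 3 + 6 * s + 4 * x / 3)"

lemma centre_poly_eq:
  "centre_poly x = 4 / 3 * (8 * s - half_cot 1 / 2 - n) * x\<^sup>2
     + (48 * s\<^sup>2 - 10 / 3 * (s * half_cot 1) - real n * half_cot 1 / 3) * x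
     + (n + 4 * s) * (ring_sum 2 + 2 * s) * (2 * s)"
  unfolding centre_poly_def ring_sum_2 by (simp add: field_simps power2_eq_square)

lemma centre_poly_0_pos: "0 < (n + 4 * s) * (ring_sum 2 + 2 * s) * (2 * s)"
  using n_pos ring_sum_1_pos ring_sum_nonneg[of 2] by (intro mult_pos_pos add_pos_pos add_nonneg_pos) auto

text \<open>The first assumption says that the leading coefficient is nonnegative. Together with
  \<open>half_cot 1\<close> <= n it makes the linear coefficient nonnegative too, and the constant
  term is positive.\<close>

lemma centre_poly_pos:
  assumes "n \<le> 8 * s - half_cot 1 / 2" "0 < x"
  shows "0 < centre_poly x"
proof -
  let ?c = "half_cot 1"
  have c: "0 < ?c" "?c \<le> n" using half_cot_pos[of 1] half_cot_1_le n_ge_3 by auto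
  have sn: "n \<le> 8 * s" using assms c by simp
  have "6 * (s * real n) + 3 * (s * ?c) \<le> 48 * s\<^sup>2"
    using mult_left_mono[OF assms(1), of "6 * s"] ring_sum_1_pos by (simp add: algebra_simps power2_eq_square)
  moreover have "s * ?c \<le> s * real n" using c ring_sum_1_pos by (intro mult_left_mono) auto
  moreover have "real n * ?c \<le> 8 * (s * real n)"
    using mult_left_mono[of ?c "8 * s" "real n"] c sn by (simp add: mult_ac)
  ultimately have "0 \<le> 48 * s\<^sup>2 - 10 / 3 * (s * ?c) - real n * ?c / 3"
    using mult_nonneg_nonneg[of s "real n"] ring_sum_1_pos by linarith
  then have "0 \<le> (48 * s\<^sup>2 - 10 / 3 * (s * ?c) - real n * ?c / 3) * x"
    using assms(2) by (intro mult_nonneg_nonneg) auto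
  moreover have "0 \<le> 4 / 3 * (8 * s - ?c / 2 - n) * x\<^sup>2"
    using assms by (intro mult_nonneg_nonneg) auto
  ultimately show ?thesis
    unfolding centre_poly_eq using centre_poly_0_pos by linarith
qed

text \<open>The product c / a of the roots is negative. For uniqueness, y times the equation for x
  minus x times the equation for y eliminates b.\<close>

lemma quadratic_unique_positive_root:
  fixes a b c :: real
  assumes "a < 0" "0 < c"
  shows "\<exists>!x. 0 < x \<and> a * x\<^sup>2 + b * x + c = 0"
proof (rule ex_ex1I)
  define d where "d = b\<^sup>2 - 4 * a * c"
  have "a * c < 0" using assms by (simp add: mult_neg_pos)
  then have "b\<^sup>2 < d" by (simp add: d_def)
  then have "\<bar>b\<bar> < sqrt d" using real_less_rsqrt[of "\<bar>b\<bar>" d] by simp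
  then have pos: "0 < (- b - sqrt d) / (2 * a)" using assms by (intro divide_neg_neg) auto
  have sd: "(sqrt d)\<^sup>2 = d" using \<open>b\<^sup>2 < d\<close> by (simp add: order_trans[OF zero_le_power2 less_imp_le])
  define x where "x = (- b - sqrt d) / (2 * a)"
  have ax: "2 * a * x = - b - sqrt d" using assms by (simp add: x_def)
  have "4 * a * (a * x\<^sup>2 + b * x + c) = (2 * a * x)\<^sup>2 + 2 * b * (2 * a * x) + 4 * a * c"
    by (simp add: algebra_simps power2_eq_square)
  also have "\<dots> = 0"
    unfolding ax using sd by (simp add: d_def algebra_simps power2_eq_square)
  finally show "\<exists>x. 0 < x \<and> a * x\<^sup>2 + b * x + c = 0"
    using assms pos by (auto simp: x_def[symmetric])
next
  fix x y assume x: "0 < x \<and> a * x\<^sup>2 + b * x + c = 0" and y: "0 < y \<and> a * y\<^sup>2 + b * y + c = 0"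
  have "(x - y) * (a * x * y - c) = x * (a * y\<^sup>2 + b * y + c) * (- 1) + y * (a * x\<^sup>2 + b * x + c)"
    by (simp add: algebra_simps power2_eq_square)
  also have "\<dots> = 0" using x y by simp
  finally have "(x - y) * (a * x * y - c) = 0" .
  moreover have "a * x * y < 0" using x y assms by (simp add: mult_neg_pos)
  ultimately show "x = y" using assms by simp
qed

section \<open>Signs of u_2, u_3 and of the leading coefficient of mode 1\<close>

lemma critical_value_2:
  "critical_value 2 = s - 3 / 8 * half_cot 1 + half_cot 3 / 8
     + (4 * s - 3 / 4 * half_cot 1 - half_cot 3 / 4)\<^sup>2 / (2 * (16 * s - 9 / 4 * half_cot 1 - half_cot 3 / 4))"
proof -
  have "central_slope 2 = 4 * s - 3 / 4 * half_cot 1 - half_cot 3 / 4"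
    using ring_sum_3 by (simp add: central_slope_def diff_divide_distrib)
  moreover have "stiffness 2 = 16 * s - 9 / 4 * half_cot 1 - half_cot 3 / 4"
    using ring_sum_2 bend_0 bend_2 by (simp add: stiffness_def add_divide_distrib)
  moreover have "ring_sum 2 + (bend 0 - bend 2) / 4 - 3 * s = s - 3 / 8 * half_cot 1 + half_cot 3 / 8"
    using ring_sum_2 bend_0 bend_2 by (simp add: add_divide_distrib)
  ultimately show ?thesis unfolding critical_value_def by simp
qed

text \<open>The tangent bound \<open>G\<^sup>2 / (2 K) \<ge> \<theta> G - \<theta>\<^sup>2 K / 2\<close> makes the estimate linear in the trigonometric sums.\<close>

lemma critical_value_2_pos:
  assumes "4 \<le> n"
    and pos: "0 < (1 + 4 * \<theta> - 8 * \<theta>\<^sup>2) * s - (3 / 8 + 3 / 4 * \<theta> - 9 / 8 * \<theta>\<^sup>2) * half_cot 1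
      + (1 / 8 - \<theta> / 4 + \<theta>\<^sup>2 / 8) * half_cot 3"
  shows "0 < critical_value 2"
proof -
  define G where "G = 4 * s - 3 / 4 * half_cot 1 - half_cot 3 / 4"
  define K where "K = 16 * s - 9 / 4 * half_cot 1 - half_cot 3 / 4"
  have "0 < K"
    using stiffness_pos[of 2] assms(1) ring_sum_2 bend_0 bend_2
    by (simp add: stiffness_def K_def add_divide_distrib)
  have "0 \<le> (G - \<theta> * K)\<^sup>2 / (2 * K)" using \<open>0 < K\<close> by simp
  also have "\<dots> = G\<^sup>2 / (2 * K) - (\<theta> * G - \<theta>\<^sup>2 / 2 * K)"
    using \<open>0 < K\<close> by (simp add: field_simps power2_eq_square)
  finally have "\<theta> * G - \<theta>\<^sup>2 / 2 * K \<le> G\<^sup>2 / (2 * K)" by simp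
  moreover have "s - 3 / 8 * half_cot 1 + half_cot 3 / 8 + (\<theta> * G - \<theta>\<^sup>2 / 2 * K)
    = (1 + 4 * \<theta> - 8 * \<theta>\<^sup>2) * s - (3 / 8 + 3 / 4 * \<theta> - 9 / 8 * \<theta>\<^sup>2) * half_cot 1
      + (1 / 8 - \<theta> / 4 + \<theta>\<^sup>2 / 8) * half_cot 3"
    by (simp add: G_def K_def field_simps power2_eq_square)
  ultimately show ?thesis
    using pos unfolding critical_value_2 G_def[symmetric] K_def[symmetric] by linarith
qed

text \<open>A certificate from rounded data: g bounds the central slope, k the stiffness from below,
  and the square quotient is at most g^2 / (2 k), which y must absorb.\<close>

lemma critical_value_2_nonpos:
  assumes "- g \<le> 4 * s - 3 / 4 * half_cot 1 - half_cot 3 / 4" "4 * s - 3 / 4 * half_cot 1 - half_cot 3 / 4 \<le> g"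
    and "0 < k" "k \<le> 16 * s - 9 / 4 * half_cot 1 - half_cot 3 / 4"
    and "s - 3 / 8 * half_cot 1 + half_cot 3 / 8 \<le> - y" "g\<^sup>2 \<le> 2 * k * y"
  shows "critical_value 2 \<le> 0"
proof -
  define G where "G = 4 * s - 3 / 4 * half_cot 1 - half_cot 3 / 4"
  define K where "K = 16 * s - 9 / 4 * half_cot 1 - half_cot 3 / 4"
  have "\<bar>G\<bar> \<le> \<bar>g\<bar>" using assms(1,2) by (auto simp: G_def)
  then have "G\<^sup>2 \<le> g\<^sup>2" by (simp only: abs_le_square_iff)
  then have "G\<^sup>2 / (2 * K) \<le> g\<^sup>2 / (2 * k)" using assms(3,4) by (intro frac_le) (auto simp: K_def)
  also have "\<dots> \<le> y" using assms(3,6) by (simp add: field_simps)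
  finally show ?thesis
    using assms(5) unfolding critical_value_2 G_def[symmetric] K_def[symmetric] by linarith
qed

text \<open>For n = 4 the index 2 is the middle one and the central slope vanishes by reflection; g
  = 1/100 merely absorbs rounding. In the next cases g, k and y are rounded from the
  enclosures.\<close>

lemma critical_value_2_nonpos_4: "n = 4 \<Longrightarrow> critical_value 2 \<le> 0"
  by (rule critical_value_2_nonpos[of "1/100" "211/100" "9/25"])
    (use trig_enclosure_4 in \<open>simp_all add: power_divide\<close>)

lemma critical_value_2_nonpos_5: "n = 5 \<Longrightarrow> critical_value 2 \<le> 0"
  by (rule critical_value_2_nonpos[of "7/25" "389/100" "9/25"])
    (use trig_enclosure_5 in \<open>simp_all add: power_divide\<close>)

lemma critical_value_2_nonpos_6: "n = 6 \<Longrightarrow> critical_value 2 \<le> 0"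
  by (rule critical_value_2_nonpos[of "31/50" "149/25" "7/20"])
    (use trig_enclosure_6 in \<open>simp_all add: power_divide\<close>)

lemma critical_value_2_nonpos_7: "n = 7 \<Longrightarrow> critical_value 2 \<le> 0"
  by (rule critical_value_2_nonpos[of "103/100" "33/4" "8/25"])
    (use trig_enclosure_7 in \<open>simp_all add: power_divide\<close>)

lemma critical_value_2_nonpos_8: "n = 8 \<Longrightarrow> critical_value 2 \<le> 0"
  by (rule critical_value_2_nonpos[of "37/25" "537/50" "7/25"])
    (use trig_enclosure_8 in \<open>simp_all add: power_divide\<close>)

lemma critical_value_2_nonpos_9: "n = 9 \<Longrightarrow> critical_value 2 \<le> 0"
  by (rule critical_value_2_nonpos[of "99/50" "1339/100" "23/100"])
    (use trig_enclosure_9 in \<open>simp_all add: power_divide\<close>)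

lemma critical_value_2_nonpos_small: "4 \<le> n \<Longrightarrow> n \<le> 9 \<Longrightarrow> critical_value 2 \<le> 0"
  using critical_value_2_nonpos_4 critical_value_2_nonpos_5 critical_value_2_nonpos_6
    critical_value_2_nonpos_7 critical_value_2_nonpos_8 critical_value_2_nonpos_9 by linarith

text \<open>The tangent bound is sharpest at \<open>\<theta>\<close> = G / K, which is about 0.1542
  for n = 10; 77/500 is close to it.\<close>

lemma critical_value_2_pos_10: "n = 10 \<Longrightarrow> 0 < critical_value 2"
  by (rule critical_value_2_pos[of "77 / 500"])
    (use trig_enclosure_10 in \<open>simp_all add: power_divide\<close>)

text \<open>Five outer pairs give the constants: 137/240 is a quarter of 1 + 1/2 + ... + 1/5, and
  5/8 = (1 + ... + 5) / 24.\<close>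

lemma large_bounds:
  assumes "11 \<le> n"
  shows "137 / 240 * (n / pi) + 5 / 8 * (pi / n) \<le> s" "half_cot 1 \<le> 2 * (n / pi)"
    "2 / 3 * (n / pi) - 3 / 4 * (pi / n) \<le> half_cot 3" "half_cot 3 \<le> 2 / 3 * (n / pi)"
    "0 < n / pi" "0 < pi / n" "n \<le> 7 / 2 * (n / pi)"
proof -
  have "1 / ang l = n / pi / l" "ang l / 6 = pi / n * l / 6" for l
    by (simp_all add: ang_def)
  then show "137 / 240 * (n / pi) + 5 / 8 * (pi / n) \<le> s"
    using ring_sum_1_ge[of 5] assms unfolding sum_upto_numeral by simp
  show "half_cot 1 \<le> 2 * (n / pi)" using half_cot_le[of 1] assms by simp
  show "2 / 3 * (n / pi) - 3 / 4 * (pi / n) \<le> half_cot 3" using half_cot_ge[of 3] assms by simp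
  show "half_cot 3 \<le> 2 / 3 * (n / pi)" using half_cot_le[of 3] assms by simp
  show "0 < n / pi" "0 < pi / n" using n_pos by simp_all
  have "pi \<le> 7 / 2" using pi_approx(2) by simp
  then show "n \<le> 7 / 2 * (n / pi)" using n_pos by (simp add: field_simps)
qed

lemma critical_value_2_pos_large: "10 \<le> n \<Longrightarrow> 0 < critical_value 2"
proof -
  assume n: "10 \<le> n"
  define \<nu> \<kappa> where "\<nu> = n / pi" and "\<kappa> = pi / n"
  \<comment> \<open>3/20 is a round \<open>\<theta>\<close> near the one for n = 10. The first
    alternative for x uses six outer pairs, available from n = 13 on: 49/80 is a quarter of 1 + 1/2
    + ... + 1/6, and 7/8 = 21/24. For n = 11 and 12 there are only five pairs, compensated by bounds
    on n / pi and pi / n taken at n = 12.\<close>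
  have lin: "0 < (1 + 4 * (3 / 20) - 8 * (3 / 20)\<^sup>2) * x - (3 / 8 + 3 / 4 * (3 / 20) - 9 / 8 * (3 / 20)\<^sup>2) * y
      + (1 / 8 - 3 / 20 / 4 + (3 / 20)\<^sup>2 / 8) * z"
    if "y \<le> 2 * \<nu>" "2 / 3 * \<nu> - 3 / 4 * \<kappa> \<le> z" "0 < \<nu>" "0 < \<kappa>"
      "49 / 80 * \<nu> + 7 / 8 * \<kappa> \<le> x \<or> 137 / 240 * \<nu> + 5 / 8 * \<kappa> \<le> x \<and> \<nu> \<le> 382 / 100 \<and> 2617 / 10000 \<le> \<kappa>"
    for x y z
    using that by (elim disjE) (simp_all add: power_divide)
  consider "n = 10" | "n = 11 \<or> n = 12" | "13 \<le> n" using n by linarith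
  then show ?thesis
  proof cases
    case 1
    then show ?thesis by (rule critical_value_2_pos_10)
  next
    case 2
    then have "\<nu> \<le> 382 / 100" "2617 / 10000 \<le> \<kappa>"
      using pi_approx by (auto simp: \<nu>_def \<kappa>_def field_simps)
    then have "0 < (1 + 4 * (3 / 20) - 8 * (3 / 20)\<^sup>2) * s
      - (3 / 8 + 3 / 4 * (3 / 20) - 9 / 8 * (3 / 20)\<^sup>2) * half_cot 1
      + (1 / 8 - 3 / 20 / 4 + (3 / 20)\<^sup>2 / 8) * half_cot 3"
      using large_bounds 2 by (intro lin) (auto simp: \<nu>_def \<kappa>_def)
    then show ?thesis by (intro critical_value_2_pos[of "3 / 20"]) (use n in auto)
  next
    case 3
    have "1 / ang l = n / pi / l" "ang l / 6 = pi / n * l / 6" for l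
      by (simp_all add: ang_def)
    then have "49 / 80 * (n / pi) + 7 / 8 * (pi / n) \<le> s"
      using ring_sum_1_ge[of 6] 3 unfolding sum_upto_numeral by simp
    then have "0 < (1 + 4 * (3 / 20) - 8 * (3 / 20)\<^sup>2) * s
      - (3 / 8 + 3 / 4 * (3 / 20) - 9 / 8 * (3 / 20)\<^sup>2) * half_cot 1
      + (1 / 8 - 3 / 20 / 4 + (3 / 20)\<^sup>2 / 8) * half_cot 3"
      using large_bounds 3 by (intro lin) (auto simp: \<nu>_def \<kappa>_def)
    then show ?thesis by (intro critical_value_2_pos[of "3 / 20"]) (use n in auto)
  qed
qed

text \<open>The square quotient is nonnegative; without it only linear terms remain.\<close>

lemma critical_value_3_ge:
  assumes "6 \<le> n"
  shows "6 * s - 11 / 8 * half_cot 1 - 3 / 8 * half_cot 3 + half_cot 5 / 8 \<le> critical_value 3"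
proof -
  have "bend 3 = 2 * s - half_cot 1 / 2 - half_cot 3 / 2 - half_cot 5 / 2"
    using bend_difference[of 2] bend_2 n_ge_3 by simp
  moreover have "0 < stiffness 3" using stiffness_pos[of 3] assms by simp
  then have "0 \<le> (central_slope 3)\<^sup>2 / (2 * stiffness 3)" by simp
  ultimately show ?thesis
    unfolding critical_value_def using ring_sum_3 bend_0 by (simp add: add_divide_distrib)
qed

lemma critical_value_3_pos:
  assumes "6 \<le> n" "n \<le> 9"
  shows "0 < critical_value 3"
proof -
  have "0 < half_cot 5" using half_cot_pos[of 5] assms by simp
  moreover have "n = 6 \<or> n = 7 \<or> n = 8 \<or> n = 9" using assms by auto
  ultimately show ?thesis
    using critical_value_3_ge[OF assms(1)] trig_enclosure_6 trig_enclosure_7 trig_enclosure_8 trig_enclosure_9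
    by (elim disjE) (simp; linarith)+
qed

text \<open>Provides the hypothesis of \<open>critical_value_increasing\<close> at p = 2 and, since
  the ring sums increase, at every larger p.\<close>

lemma ring_sum_3_gt:
  assumes "8 \<le> n"
  shows "2 * s < ring_sum 3"
proof -
  have "n = 8 \<or> n = 9 \<or> n = 10 \<or> 11 \<le> n" using assms by auto
  then show ?thesis
    unfolding ring_sum_3
    using trig_enclosure_8 trig_enclosure_9 trig_enclosure_10 large_bounds
    by (elim disjE) (simp; linarith)+
qed

text \<open>Negative leading coefficient of \<open>centre_poly\<close>; the sign changes between n =
  6 and n = 7.\<close>

lemma centre_balance_small:
  assumes "n \<le> 6"
  shows "8 * s - half_cot 1 / 2 < n"
proof -
  have "n = 3 \<or> n = 4 \<or> n = 5 \<or> n = 6" using assms n_ge_3 by auto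
  then show ?thesis
    using trig_enclosure_3 trig_enclosure_4 trig_enclosure_5 trig_enclosure_6 by (elim disjE) (simp; linarith)+
qed

text \<open>For n = 7 the margin is about 0.03. For n >= 11 it suffices to compare the multiples of
  n / pi: 8 * 137/240 - 1 > 7/2.\<close>

lemma centre_balance_large:
  assumes "7 \<le> n"
  shows "n \<le> 8 * s - half_cot 1 / 2"
proof -
  have "n = 7 \<or> n = 8 \<or> n = 9 \<or> n = 10 \<or> 11 \<le> n" using assms by auto
  then show ?thesis
    using trig_enclosure_7 trig_enclosure_8 trig_enclosure_9 trig_enclosure_10 large_bounds
    by (elim disjE) (simp; linarith)+
qed

text \<open>For n = 6 both mode 1 and mode 3 have a positive root, and equal roots would give one
  mass instead of two. As u_3 lies in (0, 1/10], the quadratic term costs at most 2/100 there, the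
  linear one is nonnegative, and the constant term exceeds 1.\<close>

lemma critical_value_3_hexagon:
  assumes n: "n = 6"
  shows "centre_poly (critical_value 3) \<noteq> 0"
proof -
  \<comment> \<open>3 is the middle index of the hexagon, so reflection identifies S_4 with
    S_2.\<close>
  have "central_slope 3 = 0"
    unfolding central_slope_def using ring_sum_reflect[of 2] by (simp add: n)
  moreover have "bend 3 = 2 * s - half_cot 1 / 2 - half_cot 3 / 2 - half_cot 5 / 2"
    using bend_difference[of 2] bend_2 n_ge_3 by simp
  ultimately have v: "critical_value 3 = 6 * s - 11 / 8 * half_cot 1 - 3 / 8 * half_cot 3 + half_cot 5 / 8"
    unfolding critical_value_def using ring_sum_3 bend_0 by (simp add: add_divide_distrib)
  let ?x = "critical_value 3"
  note e = trig_enclosure_6[OF n]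
  have x: "0 < ?x" "?x \<le> 1 / 10" unfolding v using e by (simp; linarith)+
  let ?c = "half_cot 1"
  have "48 * (9 / 10)\<^sup>2 \<le> 48 * s\<^sup>2" using e by (intro mult_left_mono power_mono) auto
  moreover have "s * ?c \<le> 1 * 4" using e ring_sum_1_pos by (intro mult_mono) auto
  moreover have "?c \<le> 4" using e by simp
  ultimately have "0 \<le> 48 * s\<^sup>2 - 10 / 3 * (s * ?c) - real n * ?c / 3" by (simp add: n power_divide)
  then have "0 \<le> (48 * s\<^sup>2 - 10 / 3 * (s * ?c) - real n * ?c / 3) * ?x"
    using x by (intro mult_nonneg_nonneg) auto
  moreover have "(1 / 10)\<^sup>2 * - 2 \<le> 4 / 3 * (8 * s - ?c / 2 - n) * ?x\<^sup>2"
  proof -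
    have "?x\<^sup>2 \<le> (1 / 10)\<^sup>2" using x by (intro power_mono) auto
    then have "?x\<^sup>2 * - 2 \<ge> (1 / 10)\<^sup>2 * - 2" by simp
    moreover have "- 2 \<le> 4 / 3 * (8 * s - ?c / 2 - n)" using e by (simp add: n)
    then have "?x\<^sup>2 * - 2 \<le> ?x\<^sup>2 * (4 / 3 * (8 * s - ?c / 2 - n))" by (rule mult_left_mono) simp
    ultimately show ?thesis by (simp add: mult.commute)
  qed
  moreover have "1 < (n + 4 * s) * (ring_sum 2 + 2 * s) * (2 * s)"
  proof -
    have "6 * 1 * 1 \<le> (n + 4 * s) * (ring_sum 2 + 2 * s) * (2 * s)"
      using e n ring_sum_nonneg[of 2] by (intro mult_mono) auto
    then show ?thesis by linarith
  qed
  ultimately show ?thesis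
    unfolding centre_poly_eq by (simp add: power_divide)
qed

end

section \<open>Second derivative of the scaled potential\<close>

definition planar :: "real vec \<Rightarrow> nat \<Rightarrow> complex" where
  "planar z i = Complex (vec_index z (2 * (i - 1))) (vec_index z (2 * (i - 1) + 1))"

lemma DERIV_cmod_line:
  assumes "X \<noteq> 0"
  shows "((\<lambda>t. cmod (X + t *\<^sub>R Y)) has_real_derivative inner X Y / cmod X) (at 0)"
proof -
  have pos: "0 < (Re X)\<^sup>2 + (Im X)\<^sup>2"
    using assms by (simp add: complex_neq_0)
  have inside: "((\<lambda>t. (Re X + t * Re Y)\<^sup>2 + (Im X + t * Im Y)\<^sup>2) has_real_derivative 2 * inner X Y) (at 0)"
    by (auto intro!: derivative_eq_intros simp: inner_complex_def)
  have root: "(sqrt has_real_derivative inverse (cmod X) / 2) (at ((Re X + 0 * Re Y)\<^sup>2 + (Im X + 0 * Im Y)\<^sup>2))"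
    using pos by (simp add: DERIV_real_sqrt cmod_def)
  have "inverse (cmod X) / 2 * (2 * inner X Y) = inner X Y / cmod X"
    by (simp add: field_simps)
  with DERIV_chain2[OF root inside] show ?thesis
    by (simp only: cmod_def scaleR_complex.sel plus_complex.sel)
qed

lemma DERIV_inverse_cmod_line:
  assumes "X \<noteq> 0"
  shows "((\<lambda>t. c / cmod (X + t *\<^sub>R Y)) has_real_derivative - (c * inner X Y / cmod X ^ 3)) (at 0)"
  using DERIV_divide[OF DERIV_const[of c] DERIV_cmod_line[OF assms, of Y]] assms
  by (simp add: power3_eq_cube mult.assoc)

lemma DERIV_force_line:
  assumes "X \<noteq> 0"
  shows "((\<lambda>t. inner (X + t *\<^sub>R D) Y / cmod (X + t *\<^sub>R D) ^ 3) has_real_derivative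
    inner D Y / cmod X ^ 3 - 3 * inner X D * inner X Y / cmod X ^ 5) (at 0)"
proof -
  have num: "((\<lambda>t. inner (X + t *\<^sub>R D) Y) has_real_derivative inner D Y) (at 0)"
    unfolding inner_add_left inner_scaleR_left by (rule derivative_eq_intros refl | simp)+
  then have "((\<lambda>t. inner (X + t *\<^sub>R D) Y / cmod (X + t *\<^sub>R D) ^ 3) has_real_derivative
      (inner D Y * cmod X ^ 3 - inner X Y * (3 * (cmod X)\<^sup>2 * (inner X D / cmod X))) / (cmod X ^ 3 * cmod X ^ 3)) (at 0)"
    using DERIV_divide[OF num DERIV_power[OF DERIV_cmod_line[OF assms, of D], of 3]] assms
    by (simp add: mult.commute mult.left_commute)
  also have "(inner D Y * cmod X ^ 3 - inner X Y * (3 * (cmod X)\<^sup>2 * (inner X D / cmod X))) / (cmod X ^ 3 * cmod X ^ 3)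
     = inner D Y / cmod X ^ 3 - 3 * inner X D * inner X Y / cmod X ^ 5"
  proof -
    have "(a * r ^ 3 - b * (3 * r\<^sup>2 * (c / r))) / (r ^ 3 * r ^ 3) = a / r ^ 3 - 3 * c * b / r ^ 5"
      if "0 < r" for a b c r :: real
    proof -
      have "3 * r\<^sup>2 * (c / r) = 3 * r * c" using that by (simp add: power2_eq_square)
      moreover have "(a * r ^ 3) / (r ^ 3 * r ^ 3) = a / r ^ 3" using that by (subst mult_divide_mult_cancel_right) auto
      moreover have "b * (3 * r * c) / (r ^ 3 * r ^ 3) = 3 * c * b / r ^ 5"
        using that by (simp add: power3_eq_cube eval_nat_numeral)
      ultimately show ?thesis by (simp add: diff_divide_distrib)
    qed
    then show ?thesis using assms by simp
  qed
  finally show ?thesis .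
qed

section \<open>First and second derivatives along lines\<close>

locale ngon_mass = ngon +
  fixes m :: real
  assumes m_pos: "0 < m"
begin

abbreviation "\<mu> \<equiv> mass n m"

definition pairs :: "(nat \<times> nat) set" where
  "pairs = {(i, j). 1 \<le> i \<and> i < j \<and> j \<le> n + 1}"

lemma finite_pairs [simp]: "finite pairs"
  by (rule finite_subset[of _ "{1..n + 1} \<times> {1..n + 1}"]) (auto simp: pairs_def)

definition mass_inner :: "(nat \<Rightarrow> complex) \<Rightarrow> (nat \<Rightarrow> complex) \<Rightarrow> real" where
  "mass_inner x y = (\<Sum>i = 1..n + 1. \<mu> i * inner (x i) (y i))"

definition potential :: "(nat \<Rightarrow> complex) \<Rightarrow> real" where
  "potential x = (\<Sum>(i, j) \<in> pairs. \<mu> i * \<mu> j / cmod (x i - x j))"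

text \<open>Minus the derivative of \<open>potential\<close> at x along y;
  \<open>tidal x d y\<close> is in turn the derivative of \<open>attraction x y\<close> when x moves
  along d.\<close>

definition attraction :: "(nat \<Rightarrow> complex) \<Rightarrow> (nat \<Rightarrow> complex) \<Rightarrow> real" where
  "attraction x y = (\<Sum>(i, j) \<in> pairs. \<mu> i * \<mu> j * (inner (x i - x j) (y i - y j) / cmod (x i - x j) ^ 3))"

definition tidal :: "(nat \<Rightarrow> complex) \<Rightarrow> (nat \<Rightarrow> complex) \<Rightarrow> (nat \<Rightarrow> complex) \<Rightarrow> real" where
  "tidal x d y = (\<Sum>(i, j) \<in> pairs. \<mu> i * \<mu> j * (inner (d i - d j) (y i - y j) / cmod (x i - x j) ^ 3
      - 3 * inner (x i - x j) (d i - d j) * inner (x i - x j) (y i - y j) / cmod (x i - x j) ^ 5))"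

definition scaled :: "(nat \<Rightarrow> complex) \<Rightarrow> real" where
  "scaled x = sqrt (mass_inner x x) * potential x"

definition scaled_deriv :: "(nat \<Rightarrow> complex) \<Rightarrow> (nat \<Rightarrow> complex) \<Rightarrow> real" where
  "scaled_deriv x y = mass_inner x y / sqrt (mass_inner x x) * potential x
     - sqrt (mass_inner x x) * attraction x y"

definition regular :: "(nat \<Rightarrow> complex) \<Rightarrow> bool" where
  "regular x \<longleftrightarrow> 0 < mass_inner x x \<and> (\<forall>(i, j) \<in> pairs. x i \<noteq> x j)"

abbreviation shift :: "(nat \<Rightarrow> complex) \<Rightarrow> real \<Rightarrow> (nat \<Rightarrow> complex) \<Rightarrow> nat \<Rightarrow> complex" where
  "shift x t y i \<equiv> x i + t *\<^sub>R y i"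

lemma shift_diff: "shift x t y i - shift x t y j = (x i - x j) + t *\<^sub>R (y i - y j)"
  by (simp add: scaleR_diff_right)

lemma DERIV_mass_inner: "((\<lambda>t. mass_inner (shift x t d) y) has_real_derivative mass_inner d y) (at 0)"
  unfolding mass_inner_def inner_add_left inner_scaleR_left
  by (rule DERIV_sum) (auto intro!: derivative_eq_intros)

lemma DERIV_mass_inner_self:
  "((\<lambda>t. mass_inner (shift x t y) (shift x t y)) has_real_derivative 2 * mass_inner x y) (at 0)"
  unfolding mass_inner_def inner_add_left inner_scaleR_left inner_add_right inner_scaleR_right sum_distrib_left
  by (rule DERIV_sum) (auto intro!: derivative_eq_intros simp: inner_commute)

lemma DERIV_potential:
  assumes "regular x"
  shows "((\<lambda>t. potential (shift x t y)) has_real_derivative - attraction x y) (at 0)"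
proof -
  have "((\<lambda>t. \<Sum>p\<in>pairs. case p of (i, j) \<Rightarrow> \<mu> i * \<mu> j / cmod (shift x t y i - shift x t y j))
     has_real_derivative (\<Sum>p\<in>pairs. case p of (i, j) \<Rightarrow>
       - (\<mu> i * \<mu> j * inner (x i - x j) (y i - y j) / cmod (x i - x j) ^ 3))) (at 0)"
  proof (rule DERIV_sum, clarify)
    fix i j assume "(i, j) \<in> pairs"
    then have "x i - x j \<noteq> 0" using assms by (auto simp: regular_def)
    from DERIV_inverse_cmod_line[OF this]
    show "((\<lambda>t. \<mu> i * \<mu> j / cmod (shift x t y i - shift x t y j)) has_real_derivative
       - (\<mu> i * \<mu> j * inner (x i - x j) (y i - y j) / cmod (x i - x j) ^ 3)) (at 0)"
      unfolding shift_diff .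
  qed
  then show ?thesis
    by (simp add: potential_def attraction_def sum_negf case_prod_unfold)
qed

lemma DERIV_attraction:
  assumes "regular x"
  shows "((\<lambda>t. attraction (shift x t d) y) has_real_derivative tidal x d y) (at 0)"
  unfolding attraction_def tidal_def
proof (rule DERIV_sum, clarify)
  fix i j assume "(i, j) \<in> pairs"
  then have "x i - x j \<noteq> 0" using assms by (auto simp: regular_def)
  from DERIV_cmult[OF DERIV_force_line[OF this]]
  show "((\<lambda>t. \<mu> i * \<mu> j * (inner (shift x t d i - shift x t d j) (y i - y j) /
             cmod (shift x t d i - shift x t d j) ^ 3)) has_real_derivative
       \<mu> i * \<mu> j * (inner (d i - d j) (y i - y j) / cmod (x i - x j) ^ 3
      - 3 * inner (x i - x j) (d i - d j) * inner (x i - x j) (y i - y j) / cmod (x i - x j) ^ 5)) (at 0)"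
    unfolding shift_diff .
qed

lemma DERIV_sqrt_mass_inner:
  assumes "regular x"
  shows "((\<lambda>t. sqrt (mass_inner (shift x t y) (shift x t y))) has_real_derivative
    mass_inner x y / sqrt (mass_inner x x)) (at 0)"
proof -
  have "(sqrt has_real_derivative inverse (sqrt (mass_inner x x)) / 2)
     (at (mass_inner (shift x 0 y) (shift x 0 y)))"
    using assms by (simp add: regular_def DERIV_real_sqrt)
  from DERIV_chain2[OF this DERIV_mass_inner_self]
  show ?thesis by (simp add: field_simps)
qed

lemma DERIV_scaled:
  assumes "regular x"
  shows "((\<lambda>t. scaled (shift x t y)) has_real_derivative scaled_deriv x y) (at 0)"
  unfolding scaled_def scaled_deriv_def
  using DERIV_mult[OF DERIV_sqrt_mass_inner[OF assms] DERIV_potential[OF assms]] by (simp add: mult.commute)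

definition second_form :: "(nat \<Rightarrow> complex) \<Rightarrow> (nat \<Rightarrow> complex) \<Rightarrow> (nat \<Rightarrow> complex) \<Rightarrow> real" where
  "second_form x d y =
     (mass_inner d y / sqrt (mass_inner x x) - mass_inner x d * mass_inner x y / sqrt (mass_inner x x) ^ 3) * potential x
     - mass_inner x y / sqrt (mass_inner x x) * attraction x d
     - mass_inner x d / sqrt (mass_inner x x) * attraction x y - sqrt (mass_inner x x) * tidal x d y"

lemma DERIV_scaled_deriv:
  assumes "regular x"
  shows "((\<lambda>t. scaled_deriv (shift x t d) y) has_real_derivative second_form x d y) (at 0)"
proof -
  let ?J = "mass_inner x x"
  have J: "0 < ?J" using assms by (simp add: regular_def)
  note sq = DERIV_sqrt_mass_inner[OF assms, of d]
  have "((\<lambda>t. mass_inner (shift x t d) y / sqrt (mass_inner (shift x t d) (shift x t d)))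
      has_real_derivative mass_inner d y / sqrt ?J - mass_inner x d * mass_inner x y / sqrt ?J ^ 3) (at 0)"
  proof -
    have "((\<lambda>t. mass_inner (shift x t d) y / sqrt (mass_inner (shift x t d) (shift x t d)))
      has_real_derivative (mass_inner d y * sqrt ?J - mass_inner x y * (mass_inner x d / sqrt ?J)) / (sqrt ?J * sqrt ?J)) (at 0)"
      using DERIV_divide[OF DERIV_mass_inner[of x d y] sq] J by simp
    moreover have eq: "(a * r - b * (c / r)) / (r * r) = a / r - c * b / r ^ 3" if "0 < r" for a b c r :: real
      using that by (simp add: diff_divide_distrib power3_eq_cube mult.assoc mult.commute)
    ultimately show ?thesis
      by (simp only: eq[OF real_sqrt_gt_zero[OF J]])
  qed
  from DERIV_diff[OF DERIV_mult[OF this DERIV_potential[OF assms, of d]] DERIV_mult[OF sq DERIV_attraction[OF assms, of d y]]]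
  have deriv: "((\<lambda>t. scaled_deriv (shift x t d) y) has_real_derivative
     (mass_inner d y / sqrt ?J - mass_inner x d * mass_inner x y / sqrt ?J ^ 3) * potential x
     + - attraction x d * (mass_inner x y / sqrt ?J)
     - (mass_inner x d / sqrt ?J * attraction x y + tidal x d y * sqrt ?J)) (at 0)"
    by (simp only: scaled_deriv_def scaleR_zero_left add_0_right)
  have eq: "a * p + - q * b - (c * r + t * w) = a * p - b * q - c * r - w * t"
    for a p q b c r t w :: real by (simp add: algebra_simps)
  show ?thesis
    using deriv unfolding second_form_def eq .
qed

text \<open>The formula for a first partial derivative holds at regular configurations only, whereas
  differentiating it again requires it in a neighbourhood.\<close>

lemma eventually_regular:
  assumes "regular x"
  shows "\<forall>\<^sub>F t in nhds 0. regular (shift x t d)"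
proof -
  have "isCont (\<lambda>t. mass_inner (shift x t d) (shift x t d)) 0"
    using DERIV_mass_inner_self DERIV_isCont by blast
  then have "((\<lambda>t. mass_inner (shift x t d) (shift x t d)) \<longlongrightarrow> mass_inner x x) (nhds 0)"
    using tendsto_at_iff_tendsto_nhds[of "\<lambda>t. mass_inner (shift x t d) (shift x t d)" 0] by (simp add: isCont_def)
  then have "\<forall>\<^sub>F t in nhds 0. 0 < mass_inner (shift x t d) (shift x t d)"
    using assms order_tendstoD(1) by (auto simp: regular_def)
  moreover have "\<forall>\<^sub>F t in nhds 0. \<forall>p\<in>pairs. case p of (i, j) \<Rightarrow> shift x t d i \<noteq> shift x t d j"
  proof (rule eventually_ball_finite, simp, clarify)
    fix i j assume "(i, j) \<in> pairs"
    then have "x i - x j \<noteq> 0" using assms by (auto simp: regular_def)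
    moreover have "((\<lambda>t. shift x t d i - shift x t d j) \<longlongrightarrow> shift x 0 d i - shift x 0 d j) (nhds 0)"
      by (intro tendsto_intros filterlim_ident)
    ultimately have "\<forall>\<^sub>F t in nhds 0. shift x t d i - shift x t d j \<noteq> 0"
      by (intro tendsto_imp_eventually_ne) auto
    then show "\<forall>\<^sub>F t in nhds 0. shift x t d i \<noteq> shift x t d j"
      by (auto elim: eventually_mono)
  qed
  ultimately show ?thesis
    by eventually_elim (auto simp: regular_def)
qed

section \<open>From real vectors to complex configurations\<close>

lemma planar_norm: "norm (body z i - body z j) = cmod (planar z i - planar z j)"
  "norm (body z i) = cmod (planar z i)"
  by (simp_all add: body_def planar_def norm_Pair cmod_def)

lemma scaled_potential_planar: "scaled_potential n m z = scaled (planar z)"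
  unfolding scaled_potential_def scaled_def inertia_def newton_potential_def mass_inner_def potential_def
    planar_norm pairs_def[symmetric]
  by (simp add: power2_norm_eq_inner)

lemma planar_shift:
  assumes "dim_vec z = 2 * n + 2" "dim_vec e = 2 * n + 2" "i \<in> {1..n + 1}"
  shows "planar (z + t \<cdot>\<^sub>v e) i = shift (planar z) t (planar e) i"
  using assms by (auto simp: planar_def complex_eq_iff)

text \<open>Configurations are functions on all naturals, but two descriptions of the same one, as
  in \<open>planar_shift\<close>, agree only on the bodies 1 to n + 1.\<close>

lemma eq_on_bodies:
  assumes "\<And>i. i \<in> {1..n + 1} \<Longrightarrow> x i = x' i"
  shows "mass_inner x y = mass_inner x' y" "mass_inner y x = mass_inner y x'"
    "potential x = potential x'" "attraction x y = attraction x' y" "attraction y x = attraction y x'"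
    "tidal y x d = tidal y x' d" "tidal y d x = tidal y d x'"
    "regular x = regular x'"
proof -
  have x: "x i = x' i" "x j = x' j" if "(i, j) \<in> pairs" for i j
    using that by (auto simp: pairs_def intro!: assms)
  show P: "mass_inner x y = mass_inner x' y" "mass_inner y x = mass_inner y x'" for y
    unfolding mass_inner_def by (auto intro!: sum.cong simp: assms)
  show "potential x = potential x'" "attraction x y = attraction x' y" "attraction y x = attraction y x'"
    "tidal y x d = tidal y x' d" "tidal y d x = tidal y d x'"
    unfolding potential_def attraction_def tidal_def by (auto intro!: sum.cong simp: x)
  show "regular x = regular x'"
    unfolding regular_def using x P by auto
qed

lemma scaled_eq_on_bodies:
  assumes "\<And>i. i \<in> {1..n + 1} \<Longrightarrow> x i = x' i"
  shows "scaled x = scaled x'" "scaled_deriv x y = scaled_deriv x' y"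
  using eq_on_bodies[of x x', OF assms] unfolding scaled_def scaled_deriv_def by simp_all

lemma partial_deriv_scaled_potential:
  assumes "dim_vec z = 2 * n + 2" "regular (planar z)"
  shows "partial_deriv j (scaled_potential n m) z = scaled_deriv (planar z) (planar (unit_vec (2 * n + 2) j))"
proof -
  let ?e = "unit_vec (2 * n + 2) j :: real vec"
  have "scaled_potential n m (z + t \<cdot>\<^sub>v ?e) = scaled (shift (planar z) t (planar ?e))" for t
    unfolding scaled_potential_planar by (intro scaled_eq_on_bodies planar_shift) (simp_all add: assms)
  then have "partial_deriv j (scaled_potential n m) z = deriv (\<lambda>t. scaled (shift (planar z) t (planar ?e))) 0"
    unfolding partial_deriv_def assms(1) by presburger
  also have "\<dots> = scaled_deriv (planar z) (planar ?e)"
    by (rule DERIV_imp_deriv[OF DERIV_scaled[OF assms(2)]])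
  finally show ?thesis .
qed

lemma second_partial_deriv_scaled_potential:
  assumes z: "dim_vec z = 2 * n + 2" "regular (planar z)"
  shows "partial_deriv i (partial_deriv j (scaled_potential n m)) z
    = second_form (planar z) (planar (unit_vec (2 * n + 2) i)) (planar (unit_vec (2 * n + 2) j))"
proof -
  let ?e = "\<lambda>j. unit_vec (2 * n + 2) j :: real vec"
  have eq: "planar (z + t \<cdot>\<^sub>v ?e i) k = shift (planar z) t (planar (?e i)) k" if "k \<in> {1..n + 1}" for t k
    using planar_shift[of z "?e i" k t] z that by simp
  have "\<forall>\<^sub>F t in nhds 0. partial_deriv j (scaled_potential n m) (z + t \<cdot>\<^sub>v ?e i)
     = scaled_deriv (shift (planar z) t (planar (?e i))) (planar (?e j))"
    using eventually_regular[OF z(2), of "planar (?e i)"]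
  proof eventually_elim
    case (elim t)
    then have "regular (planar (z + t \<cdot>\<^sub>v ?e i))"
      using eq_on_bodies(8)[OF eq] by simp
    then have "partial_deriv j (scaled_potential n m) (z + t \<cdot>\<^sub>v ?e i)
       = scaled_deriv (planar (z + t \<cdot>\<^sub>v ?e i)) (planar (?e j))"
      by (intro partial_deriv_scaled_potential) (use z in auto)
    also have "\<dots> = scaled_deriv (shift (planar z) t (planar (?e i))) (planar (?e j))"
      by (rule scaled_eq_on_bodies) (rule eq)
    finally show ?case .
  qed
  then have "partial_deriv i (partial_deriv j (scaled_potential n m)) z
     = deriv (\<lambda>t. scaled_deriv (shift (planar z) t (planar (?e i))) (planar (?e j))) 0"
    unfolding partial_deriv_def[of i] z(1) by (rule deriv_cong_ev) simp
  also have "\<dots> = second_form (planar z) (planar (?e i)) (planar (?e j))"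
    by (rule DERIV_imp_deriv) (rule DERIV_scaled_deriv[OF z(2)])
  finally show ?thesis .
qed

end

section \<open>Linearisation at the centred polygon\<close>

lemma inner_divide_of_real: "inner D (Z / of_real r) = inner D Z / r" for D Z :: complex
proof -
  have "Z / of_real r = (1 / r) *\<^sub>R Z" by (simp add: scaleR_conv_of_real)
  then show ?thesis by (simp del: scaleR_conv_of_real)
qed

lemma inner_mult_of_real: "inner D (of_real c * Z) = c * inner D Z" for D Z :: complex
  by (simp add: inner_complex_def algebra_simps)

section \<open>Roots of unity, chords and sums around the ring\<close>

context ngon
begin

definition zeta :: "int \<Rightarrow> complex" where
  "zeta k = cis (2 * (of_int k * (pi / n)))"

lemma zeta_0 [simp]: "zeta 0 = 1"
  by (simp add: zeta_def)

lemma zeta_add: "zeta (a + b) = zeta a * zeta b"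
  by (simp add: zeta_def cis_mult distrib_left distrib_right add_divide_distrib)

lemma cnj_zeta [simp]: "cnj (zeta k) = zeta (- k)"
  by (simp add: zeta_def cis_cnj)

lemma norm_zeta [simp]: "cmod (zeta k) = 1"
  by (simp add: zeta_def)

lemma zeta_nonzero [simp]: "zeta k \<noteq> 0"
  by (simp add: zeta_def)

lemma zeta_cancel [simp]: "zeta k * zeta (- k) = 1" "zeta (- k) * zeta k = 1"
  by (simp_all flip: zeta_add)

lemma zeta_period [simp]: "zeta (int n * k) = 1" "zeta (k * int n) = 1"
proof -
  have "zeta (int n * k) = cis (2 * pi * of_int k)" using n_pos by (simp add: zeta_def mult_ac)
  also have "\<dots> = 1" by (rule cis_multiple_2pi) simp
  finally show "zeta (int n * k) = 1" .
  then show "zeta (k * int n) = 1" by (simp add: mult.commute)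
qed

definition chord :: "int \<Rightarrow> real" where
  "chord l = cmod (1 - zeta l)"

lemma chord_minus [simp]: "chord (- l) = chord l"
proof -
  have "cnj (1 - zeta l) = 1 - zeta (- l)" by simp
  then show ?thesis unfolding chord_def by (metis complex_mod_cnj)
qed

lemma chord_nat:
  assumes "l < n"
  shows "chord (int l) = 2 * sin (ang l)"
proof -
  have "(cmod (1 - cis (2 * t)))\<^sup>2 = (2 * sin t)\<^sup>2" for t
  proof -
    have "(1 - cos (2 * t))\<^sup>2 + (sin (2 * t))\<^sup>2 = 2 - 2 * cos (2 * t)"
      using sin_cos_squared_add[of "2 * t"] by (simp add: power2_diff)
    also have "\<dots> = (2 * sin t)\<^sup>2" by (simp add: cos_double_sin power_mult_distrib)
    finally show ?thesis by (simp add: cmod_power2)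
  qed
  from this[of "ang l"] have sq: "(chord (int l))\<^sup>2 = (2 * sin (ang l))\<^sup>2"
    by (simp add: chord_def zeta_def ang_def mult.commute)
  have "0 \<le> sin (ang l)"
    using sin_ang_pos[of l] assms by (cases "l = 0") (auto simp: ang_def)
  then have nonneg: "0 \<le> chord (int l)" "0 \<le> 2 * sin (ang l)"
    by (simp_all add: chord_def)
  show ?thesis
    by (rule power2_eq_imp_eq[OF sq nonneg])
qed

text \<open>On the unit circle 1 - cnj z = - (1 - z) / z. This turns X^2 / |X|^5 in the tidal force
  into a root of unity over |X|^3.\<close>

lemma one_minus_zeta_squared: "(1 - zeta l)\<^sup>2 = - zeta l * (complex_of_real (chord l))\<^sup>2"
proof -
  have "(complex_of_real (chord l))\<^sup>2 = (1 - zeta l) * (1 - zeta (- l))"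
    using complex_norm_square[of "1 - zeta l"] by (simp add: chord_def)
  then have "- zeta l * (complex_of_real (chord l))\<^sup>2 = - zeta l * (1 - zeta (- l)) * (1 - zeta l)"
    by simp
  also have "\<dots> = (1 - zeta l) * (1 - zeta l)" by (simp add: right_diff_distrib)
  finally show ?thesis by (simp add: power2_eq_square)
qed

lemma sum_periodic_interval:
  fixes f :: "int \<Rightarrow> complex"
  assumes per: "\<And>i. f (i + int n) = f i"
  shows "(\<Sum>i\<in>{a..<a + int n}. f i) = (\<Sum>i\<in>{0..<int n}. f i)"
proof -
  have step: "(\<Sum>i\<in>{a + 1..<a + 1 + int n}. f i) = (\<Sum>i\<in>{a..<a + int n}. f i)" for a
  proof -
    have "{a..<a + int n} = insert a {a + 1..<a + int n}"
      "{a + 1..<a + 1 + int n} = insert (a + int n) {a + 1..<a + int n}"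
      using n_ge_3 by auto
    then show ?thesis using per[of a] by simp
  qed
  show ?thesis
  proof (induction a rule: int_induct[of _ 0])
    case (step1 i)
    then show ?case using step[of i] by simp
  next
    case (step2 i)
    then show ?case using step[of "i - 1"] by simp
  qed simp
qed

text \<open>Lets the ring be summed by the difference j - k, that is, as seen from the k-th
  vertex.\<close>

lemma sum_periodic_shift:
  fixes f :: "int \<Rightarrow> complex"
  assumes per: "\<And>i. f (i + int n) = f i"
  shows "(\<Sum>j = 1..n. f (int j - k)) = (\<Sum>l = 0..<n. f (int l))"
proof -
  have "(\<Sum>j = 1..n. f (int j - k)) = (\<Sum>i\<in>{1 - k..<1 - k + int n}. f i)"
    by (rule sum.reindex_bij_witness[of _ "\<lambda>i. nat (i + k)" "\<lambda>j. int j - k"]) auto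
  also have "\<dots> = (\<Sum>i\<in>{0..<int n}. f i)" by (rule sum_periodic_interval) (rule per)
  also have "\<dots> = (\<Sum>l = 0..<n. f (int l))"
    by (rule sum.reindex_bij_witness[of _ int nat]) auto
  finally show ?thesis .
qed

lemma sum_periodic_minus:
  fixes f :: "int \<Rightarrow> complex"
  assumes per: "\<And>i. f (i + int n) = f i"
  shows "(\<Sum>l = 0..<n. f (- int l)) = (\<Sum>l = 0..<n. f (int l))"
proof -
  have "(\<Sum>l = 0..<n. f (- int l)) = (\<Sum>i\<in>{1 - int n..<1 - int n + int n}. f i)"
    by (rule sum.reindex_bij_witness[of _ "\<lambda>i. nat (- i)" "\<lambda>j. - int j"]) auto
  also have "\<dots> = (\<Sum>i\<in>{0..<int n}. f i)" by (rule sum_periodic_interval) (rule per)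
  also have "\<dots> = (\<Sum>l = 0..<n. f (int l))"
    by (rule sum.reindex_bij_witness[of _ int nat]) auto
  finally show ?thesis .
qed

lemma zeta_neq_1:
  assumes "0 < q" "q < int n"
  shows "zeta q \<noteq> 1"
proof -
  have "nat q < n" "1 \<le> nat q" using assms by auto
  then have "chord q = 2 * sin (ang (nat q))" "0 < sin (ang (nat q))"
    using chord_nat[of "nat q"] sin_ang_pos[of "nat q"] assms by auto
  then show ?thesis by (auto simp: chord_def)
qed

text \<open>A shift of the index by one multiplies the sum by \<open>zeta (- q)\<close>, which is
  not 1, yet periodicity leaves the sum unchanged.\<close>

lemma sum_zeta:
  assumes "0 < \<bar>q\<bar>" "\<bar>q\<bar> < int n"
  shows "(\<Sum>j = 1..n. zeta (q * int j)) = 0"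
proof -
  let ?S = "\<lambda>k. \<Sum>j = 1..n. zeta (q * (int j - k))"
  have "zeta (q * (i + int n)) = zeta (q * i)" for i
    by (simp add: distrib_left zeta_add)
  then have "?S 0 = ?S 1"
    using sum_periodic_shift[of "\<lambda>i. zeta (q * i)" 0] sum_periodic_shift[of "\<lambda>i. zeta (q * i)" 1] by simp
  also have "?S 1 = zeta (- q) * ?S 0"
    by (simp add: sum_distrib_left right_diff_distrib flip: zeta_add)
  finally have "(1 - zeta (- q)) * ?S 0 = 0" by (simp add: algebra_simps)
  moreover have "zeta (- q) \<noteq> 1"
  proof (cases "0 < q")
    case True
    then have "zeta q \<noteq> 1" using zeta_neq_1 assms by simp
    moreover have "cnj (zeta (- q)) = zeta q" by simp
    ultimately show ?thesis by (metis complex_cnj_one)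
  qed (use zeta_neq_1[of "- q"] assms in simp)
  ultimately show ?thesis by simp
qed

text \<open>Fourier coefficient of the inverse cube of the chord length 2 sin (pi l / n). Forces
  lead to differences of such coefficients, and these are ring sums because 1 - cos 2y = 2 sin^2
  y.\<close>

definition inv_cube_sum :: "int \<Rightarrow> real" where
  "inv_cube_sum q = (\<Sum>l = 1..<n. cos (2 * (q * ang l)) / (8 * sin (ang l) ^ 3))"

lemma inv_cube_sum_diff: "inv_cube_sum q - inv_cube_sum p = 2 * (ring_sum p - ring_sum q)"
proof -
  have eq: "inv_cube_sum 0 - inv_cube_sum p = 2 * ring_sum p" for p
  proof -
    have "1 / (8 * x) - cos (2 * y) / (8 * x) = 2 * ((sin y)\<^sup>2 / (8 * x))" for x y :: real
      by (simp add: cos_double_sin diff_divide_distrib)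
    then show ?thesis
      by (simp add: inv_cube_sum_def ring_sum_def sum_distrib_left flip: sum_subtractf)
  qed
  show ?thesis using eq[of p] eq[of q] by simp
qed

lemma inv_cube_sum_minus [simp]: "inv_cube_sum (- q) = inv_cube_sum q"
  by (simp add: inv_cube_sum_def)

text \<open>The term \<open>j = k\<close> is \<open>0\<close> by the convention \<open>x / 0 = 0\<close>, so no index has to be excluded.\<close>

lemma sum_zeta_inv_cube:
  "(\<Sum>j = 1..n. zeta (q * (int j - k)) / complex_of_real (chord (int j - k) ^ 3)) = inv_cube_sum q"
proof -
  define f where "f i = zeta (q * i) / complex_of_real (chord i ^ 3)" for i
  have per: "f (i + int n) = f i" for i
    using zeta_period(1)[of 1] by (simp add: f_def distrib_left zeta_add chord_def)
  let ?S = "\<Sum>l = 0..<n. f (int l)"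
  \<comment> \<open>Conjugation reverses the direction around the ring, so the sum is real.\<close>
  have "cnj ?S = (\<Sum>l = 0..<n. f (- int l))"
    by (simp add: f_def)
  also have "\<dots> = ?S" by (rule sum_periodic_minus) (rule per)
  finally have "?S \<in> \<real>" by (simp add: Reals_cnj_iff)
  then have "?S = complex_of_real (Re ?S)" by (simp only: of_real_Re)
  also have "Re ?S = (\<Sum>l = 0..<n. cos (2 * (q * ang l)) / (8 * sin (ang l) ^ 3))"
  proof -
    have "Re (f (int l)) = cos (2 * (q * ang l)) / (8 * sin (ang l) ^ 3)" if "l < n" for l
    proof -
      have "Re (zeta (q * int l)) = cos (2 * (q * ang l))"
        by (simp add: zeta_def ang_def algebra_simps)
      then show ?thesis
        using that by (simp add: f_def chord_nat Re_divide_of_real power_mult_distrib del: of_real_power)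
    qed
    then show ?thesis by simp
  qed
  also have "\<dots> = inv_cube_sum q"
  proof -
    have "{0..<n} = insert 0 {1..<n}" using n_ge_3 by auto
    then show ?thesis by (simp add: inv_cube_sum_def ang_def)
  qed
  finally show ?thesis
    using sum_periodic_shift[of f k] per by (simp add: f_def)
qed

end

section \<open>Equilibrium at the polygon and the linearised operator\<close>

context ngon_mass
begin

definition gon :: "nat \<Rightarrow> complex" where
  "gon k = (if k \<le> n then zeta (int k) else 0)"

text \<open>The \<open>\<lambda>\<close> of the central configuration equation: m is the pull of the
  centre on a vertex, 2 s that of the ring.\<close>

definition multiplier :: real where
  "multiplier = m + 2 * s"

text \<open>Action equals reaction: each pair i < j supplies the two ordered pairs, and the diagonal
  vanishes by antisymmetry.\<close>

lemma sum_pairs_antisym: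
  assumes "\<And>i j. h j i = - h i j"
  shows "(\<Sum>(i, j) \<in> pairs. inner (d i - d j) (h i j)) = (\<Sum>i = 1..n + 1. inner (d i) (\<Sum>j = 1..n + 1. h i j :: complex))"
proof -
  let ?A = "{1..n + 1}"
  let ?g = "\<lambda>(i, j). inner (d i) (h i j)"
  have h0: "h i i = 0" for i using assms[of i i] by simp
  have "(\<Sum>i\<in>?A. inner (d i) (\<Sum>j\<in>?A. h i j)) = (\<Sum>p\<in>?A \<times> ?A. ?g p)"
    by (simp only: sum.cartesian_product[symmetric] inner_sum_right prod.case)
  also have "?A \<times> ?A = (pairs \<union> prod.swap ` pairs) \<union> (\<lambda>i. (i, i)) ` ?A"
    by (auto simp: pairs_def image_iff)
  also have "sum ?g \<dots> = sum ?g (pairs \<union> prod.swap ` pairs) + sum ?g ((\<lambda>i. (i, i)) ` ?A)"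
    by (rule sum.union_disjoint) (simp, simp, auto simp: pairs_def)
  also have "sum ?g ((\<lambda>i. (i, i)) ` ?A) = 0"
    by (rule sum.neutral) (auto simp: h0)
  also have "sum ?g (pairs \<union> prod.swap ` pairs) = sum ?g pairs + sum ?g (prod.swap ` pairs)"
    by (rule sum.union_disjoint) (simp, simp, auto simp: pairs_def)
  also have "sum ?g (prod.swap ` pairs) = (\<Sum>(i, j)\<in>pairs. inner (d j) (h j i))"
    by (subst sum.reindex) (auto simp: inj_on_def case_prod_unfold)
  also have "sum ?g pairs + \<dots> = (\<Sum>(i, j) \<in> pairs. inner (d i - d j) (h i j))"
    unfolding sum.distrib[symmetric]
  proof (rule sum.cong[OF refl], clarify)
    fix i j
    show "inner (d i) (h i j) + inner (d j) (h j i) = inner (d i - d j) (h i j)"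
      unfolding assms[of i j] inner_diff_left by simp
  qed
  finally show ?thesis by simp
qed

definition force :: "(nat \<Rightarrow> complex) \<Rightarrow> nat \<Rightarrow> nat \<Rightarrow> complex" where
  "force x i j = of_real (\<mu> i * \<mu> j) * ((x i - x j) / of_real (cmod (x i - x j) ^ 3))"

text \<open>Writes the bilinear form of \<open>tidal\<close> as an operator on y, by inner D (|X|^2
  Y + X^2 cnj Y) = 2 (inner X D) (inner X Y). The conjugate is what couples the frequencies p and
  -p.\<close>

definition tidal_force :: "(nat \<Rightarrow> complex) \<Rightarrow> (nat \<Rightarrow> complex) \<Rightarrow> nat \<Rightarrow> nat \<Rightarrow> complex" where
  "tidal_force x y i j = of_real (\<mu> i * \<mu> j / 2) *
     ((y i - y j) / of_real (cmod (x i - x j) ^ 3)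
      + 3 * (x i - x j)\<^sup>2 * cnj (y i - y j) / of_real (cmod (x i - x j) ^ 5))"

lemma attraction_eq: "attraction x y = (\<Sum>i = 1..n + 1. inner (y i) (\<Sum>j = 1..n + 1. force x i j))"
proof -
  have antisym: "force x j i = - force x i j" for i j
  proof -
    have "x j - x i = - (x i - x j)" by simp
    then show ?thesis
      unfolding force_def by (simp only: norm_minus_cancel mult.commute[of "\<mu> j"] minus_divide_left[symmetric] mult_minus_right)
  qed
  have "inner (y i - y j) (force x i j) = \<mu> i * \<mu> j * (inner (x i - x j) (y i - y j) / cmod (x i - x j) ^ 3)" for i j
    unfolding force_def inner_mult_of_real inner_divide_of_real by (simp add: inner_commute)
  then show ?thesis
    unfolding attraction_def sum_pairs_antisym[OF antisym, of y, symmetric] by simp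
qed

lemma tidal_eq: "tidal x d y = - (\<Sum>i = 1..n + 1. inner (d i) (\<Sum>j = 1..n + 1. tidal_force x y i j))"
proof -
  have tf: "tidal_force x y j i = - tidal_force x y i j" for i j
  proof -
    have *: "c / 2 * ((- a) / r + 3 * X\<^sup>2 * (- b) / q) = - (c / 2 * (a / r + 3 * X\<^sup>2 * b / q))"
      for a b c r q X :: complex by (simp add: algebra_simps)
    have "x j - x i = - (x i - x j)" "y j - y i = - (y i - y j)" by simp_all
    then show ?thesis
      unfolding tidal_force_def
      by (simp only: complex_cnj_minus norm_minus_cancel power2_minus mult.commute[of "\<mu> j"] of_real_divide of_real_numeral *)
  qed
  have "c * (inner D Y / r ^ 3 - 3 * inner X D * inner X Y / r ^ 5)
     = - inner D (of_real (c / 2) * (Y / of_real (r ^ 3) + 3 * X\<^sup>2 * cnj Y / of_real (r ^ 5)))"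
    if r: "r = cmod X" for c r :: real and D Y X :: complex
  \<comment> \<open>For X = 0 both sides are 0 by the convention x / 0 = 0.\<close>
  proof (cases "X = 0")
    case False
    then have "0 < r" using r by simp
    then have "r \<noteq> 0" by simp
    have "inner D (3 * X\<^sup>2 * cnj Y) = 6 * inner X D * inner X Y - 3 * r\<^sup>2 * inner D Y"
      unfolding r cmod_power2 by (simp add: inner_complex_def power2_eq_square algebra_simps)
    then have "inner D (3 * X\<^sup>2 * cnj Y / of_real (r ^ 5)) = (6 * inner X D * inner X Y - 3 * r\<^sup>2 * inner D Y) / r ^ 5"
      by (simp only: inner_divide_of_real)
    also have "\<dots> = 6 * inner X D * inner X Y / r ^ 5 - 3 * inner D Y / r ^ 3"
      using \<open>r \<noteq> 0\<close> by (simp add: diff_divide_distrib power2_eq_square eval_nat_numeral)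
    finally have a: "inner D (3 * X\<^sup>2 * cnj Y / of_real (r ^ 5)) = 6 * inner X D * inner X Y / r ^ 5 - 3 * inner D Y / r ^ 3" .
    have b: "inner D (Y / of_real (r ^ 3)) = inner D Y / r ^ 3"
      by (simp only: inner_divide_of_real)
    show ?thesis by (simp only: inner_mult_of_real inner_add_right a b) (simp add: algebra_simps)
  qed (use r in simp)
  then show ?thesis
    unfolding sum_pairs_antisym[OF tf, of d, symmetric] tidal_def sum_negf[symmetric]
    by (intro sum.cong refl) (auto simp: tidal_force_def)
qed

lemma sum_bodies: "(\<Sum>j = 1..n + 1. g j) = (\<Sum>j = 1..n. g j) + g (n + 1)"
  by simp

lemma mass_simps [simp]: "i \<le> n \<Longrightarrow> \<mu> i = 1" "\<mu> (n + 1) = m" "\<mu> (Suc n) = m"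
  by (simp_all add: mass_def)

lemma gon_simps [simp]: "i \<le> n \<Longrightarrow> gon i = zeta (int i)" "gon (n + 1) = 0" "gon (Suc n) = 0"
  by (simp_all add: gon_def)

lemma gon_diff:
  assumes "i \<le> n" "j \<le> n"
  shows "gon i - gon j = zeta (int i) * (1 - zeta (int j - int i))"
  using assms by (simp add: right_diff_distrib flip: zeta_add)

lemma cmod_gon_diff:
  assumes "i \<le> n" "j \<le> n"
  shows "cmod (gon i - gon j) = chord (int j - int i)"
  unfolding gon_diff[OF assms] by (simp add: norm_mult chord_def)

lemma force_gon:
  assumes "k \<in> {1..n}"
  shows "(\<Sum>j = 1..n + 1. force gon k j) = of_real multiplier * zeta (int k)"
proof -
  let ?r = "\<lambda>j. complex_of_real (chord (int j - int k) ^ 3)"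
  have "force gon k j = zeta (int k) * (zeta (0 * (int j - int k)) / ?r j - zeta (1 * (int j - int k)) / ?r j)"
    if "j \<in> {1..n}" for j
  proof -
    have "force gon k j = zeta (int k) * (1 - zeta (int j - int k)) / ?r j"
    proof -
      have le: "k \<le> n" "j \<le> n" using that assms by auto
      show ?thesis
        unfolding force_def cmod_gon_diff[OF le] unfolding gon_diff[OF le] by (simp add: le)
    qed
    then show ?thesis by (simp add: diff_divide_distrib right_diff_distrib)
  qed
  then have "(\<Sum>j = 1..n. force gon k j)
     = (\<Sum>j = 1..n. zeta (int k) * (zeta (0 * (int j - int k)) / ?r j - zeta (1 * (int j - int k)) / ?r j))"
    by (intro sum.cong) auto
  also have "\<dots> = zeta (int k) * (inv_cube_sum 0 - inv_cube_sum 1)"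
    unfolding sum_distrib_left[symmetric] sum_subtractf sum_zeta_inv_cube by simp
  also have "\<dots> = zeta (int k) * of_real (2 * s)"
    by (simp only: inv_cube_sum_diff) simp
  finally show ?thesis
    unfolding sum_bodies using assms by (simp add: force_def multiplier_def algebra_simps)
qed

lemma force_gon_centre: "(\<Sum>j = 1..n + 1. force gon (n + 1) j) = 0"
proof -
  have "(\<Sum>j = 1..n + 1. force gon (n + 1) j) = (\<Sum>j = 1..n. of_real (- m) * zeta (1 * int j))"
    unfolding sum_bodies by (simp add: force_def)
  also have "\<dots> = 0"
    unfolding sum_distrib_left[symmetric] using sum_zeta[of 1] n_ge_3 by simp
  finally show ?thesis .
qed

lemma attraction_gon: "attraction gon y = multiplier * mass_inner gon y"
proof -
  have "attraction gon y = (\<Sum>i = 1..n. inner (y i) (of_real multiplier * zeta (int i)))"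
  proof -
    have "(\<Sum>i = 1..n. inner (y i) (\<Sum>j = 1..n + 1. force gon i j))
       = (\<Sum>i = 1..n. inner (y i) (of_real multiplier * zeta (int i)))"
      by (intro sum.cong refl) (simp only: force_gon)
    then show ?thesis
      unfolding attraction_eq sum_bodies[of "\<lambda>i. inner (y i) (\<Sum>j = 1..n + 1. force gon i j)"] force_gon_centre
      by simp
  qed
  then show ?thesis
    by (simp add: mass_inner_def sum_distrib_left inner_mult_of_real inner_commute)
qed

lemma mass_inner_gon: "mass_inner gon gon = n"
  by (simp add: mass_inner_def flip: power2_norm_eq_inner)

text \<open>Euler's identity for the potential, which is homogeneous of degree -1.\<close>

lemma potential_gon: "potential gon = multiplier * n"
proof -
  have "potential gon = attraction gon gon"
    unfolding potential_def attraction_def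
  proof (rule sum.cong[OF refl], clarify)
    fix i j
    have "1 / r = r\<^sup>2 / r ^ 3" for r :: real
      by (cases "r = 0") (simp_all add: power2_eq_square power3_eq_cube)
    from this[of "cmod (gon i - gon j)"]
    show "\<mu> i * \<mu> j / cmod (gon i - gon j)
       = \<mu> i * \<mu> j * (inner (gon i - gon j) (gon i - gon j) / cmod (gon i - gon j) ^ 3)"
      unfolding power2_norm_eq_inner by (metis times_divide_eq_right mult.right_neutral)
  qed
  then show ?thesis by (simp add: attraction_gon mass_inner_gon)
qed

lemma regular_gon: "regular gon"
proof -
  have "gon i \<noteq> gon j" if "(i, j) \<in> pairs" for i j
  proof (cases "j \<le> n")
    case True
    then have "zeta (int j - int i) \<noteq> 1"
      using that by (intro zeta_neq_1) (auto simp: pairs_def)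
    then have "gon i - gon j \<noteq> 0"
      using gon_diff[of i j] that True by (simp add: pairs_def)
    then show ?thesis by simp
  next
    case False
    then have "j = n + 1" "i \<le> n" using that by (auto simp: pairs_def)
    then show ?thesis by simp
  qed
  then show ?thesis using n_pos by (auto simp: regular_def mass_inner_gon)
qed

text \<open>The Hessian of \<open>scaled\<close> at the polygon divided by sqrt n, as an operator on
  displacements. Of the factor 3, one unit comes from the second derivative of the square root and
  two from the mixed products.\<close>

definition linearised :: "(nat \<Rightarrow> complex) \<Rightarrow> nat \<Rightarrow> complex" where
  "linearised y i = of_real (multiplier * \<mu> i) * y i
     - of_real (3 * multiplier / n * mass_inner gon y * \<mu> i) * gon i + (\<Sum>j = 1..n + 1. tidal_force gon y i j)"

lemma second_form_gon:
  "second_form gon d y = sqrt n * (\<Sum>i = 1..n + 1. inner (d i) (linearised y i))"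
proof -
  have r: "sqrt n * sqrt n = n" "sqrt n \<noteq> 0" "real n \<noteq> 0" using n_pos by auto
  have eq: "(a / r - b * c / r ^ 3) * (l * r\<^sup>2) - c / r * (l * b) - b / r * (l * c) - r * t
     = r * (l * a - 3 * l / r\<^sup>2 * c * b - t)" if "r \<noteq> 0" for a b c l t r :: real
    using that by (simp add: field_simps power2_eq_square power3_eq_cube)
  have "second_form gon d y = sqrt n * (multiplier * mass_inner d y
      - 3 * multiplier / n * mass_inner gon y * mass_inner gon d - tidal gon d y)"
    using eq[OF r(2), of "mass_inner d y" "mass_inner gon d" "mass_inner gon y" multiplier "tidal gon d y"]
    by (simp add: second_form_def attraction_gon mass_inner_gon potential_gon)
  also have "multiplier * mass_inner d y - 3 * multiplier / n * mass_inner gon y * mass_inner gon d - tidal gon d y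
     = (\<Sum>i = 1..n + 1. inner (d i) (linearised y i))"
  proof -
    have "inner (d i) (linearised y i) = multiplier * (\<mu> i * inner (d i) (y i))
       - 3 * multiplier / n * mass_inner gon y * (\<mu> i * inner (gon i) (d i))
       + inner (d i) (\<Sum>j = 1..n + 1. tidal_force gon y i j)" for i
      unfolding linearised_def inner_add_right inner_diff_right inner_mult_of_real inner_commute[of "gon i"] by simp
    then show ?thesis
      unfolding tidal_eq mass_inner_def[of d] mass_inner_def[of gon d] sum_distrib_left
      by (simp only: sum.distrib sum_subtractf)
  qed
  finally show ?thesis .
qed

lemma second_form_commute: "second_form x d y = second_form x y d"
  unfolding second_form_def mass_inner_def tidal_def
  by (simp add: inner_commute mult.commute mult.left_commute)

end

section \<open>Fourier modes\<close>

context ngon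
begin

lemma ring_sum_minus [simp]: "ring_sum (- p) = ring_sum p"
  by (simp add: ring_sum_def)

definition zeta_sum :: "int \<Rightarrow> complex" where
  "zeta_sum q = (\<Sum>j = 1..n. zeta (q * int j))"

lemma zeta_sum_0 [simp]: "zeta_sum 0 = of_nat n"
  by (simp add: zeta_sum_def)

lemma zeta_sum_eq_0 [simp]: "0 < \<bar>q\<bar> \<Longrightarrow> \<bar>q\<bar> < int n \<Longrightarrow> zeta_sum q = 0"
  unfolding zeta_sum_def by (rule sum_zeta)

text \<open>Fourier inversion in which only q = n survives, where all exponentials are 1.\<close>

lemma fourier_const:
  fixes a :: "nat \<Rightarrow> complex"
  assumes zero: "\<And>q. 0 < q \<Longrightarrow> q < int n \<Longrightarrow> (\<Sum>k = 1..n. a k * zeta (q * int k)) = 0"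
    and j: "j \<in> {1..n}"
  shows "of_nat n * a j = (\<Sum>k = 1..n. a k)"
proof -
  have "(\<Sum>q = 1..n. zeta (- (int q * int j)) * (\<Sum>k = 1..n. a k * zeta (int q * int k)))
      = (\<Sum>k = 1..n. a k * zeta_sum (int k - int j))"
  proof -
    have eq: "zeta (- (int q * int j)) * (a k * zeta (int q * int k)) = a k * zeta ((int k - int j) * int q)" for q k
    proof -
      have "(int k - int j) * int q = - (int q * int j) + int q * int k" by (simp add: algebra_simps)
      then show ?thesis by (simp only: zeta_add) (simp only: mult_ac)
    qed
    then show ?thesis
      unfolding sum_distrib_left zeta_sum_def by (subst sum.swap) (simp only: eq)
  qed
  also have "\<dots> = (\<Sum>k = 1..n. if k = j then of_nat n * a j else 0)"
  proof (intro sum.cong refl)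
    fix k assume k: "k \<in> {1..n}"
    have "zeta_sum (int k - int j) = 0" if "k \<noteq> j"
      by (rule zeta_sum_eq_0) (use that k j in auto)
    then show "a k * zeta_sum (int k - int j) = (if k = j then of_nat n * a j else 0)"
      by simp
  qed
  also have "\<dots> = of_nat n * a j" using j by simp
  also have "(\<Sum>q = 1..n. zeta (- (int q * int j)) * (\<Sum>k = 1..n. a k * zeta (int q * int k)))
     = (\<Sum>q = 1..n. if q = n then (\<Sum>k = 1..n. a k) else 0)"
  proof (intro sum.cong refl)
    fix q assume q: "q \<in> {1..n}"
    have "zeta (- (int n * int j)) = 1" using zeta_period(1)[of "- int j"] by simp
    moreover have "(\<Sum>k = 1..n. a k * zeta (int q * int k)) = 0" if "q \<noteq> n"
      by (rule zero) (use q that in auto)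
    ultimately show "zeta (- (int q * int j)) * (\<Sum>k = 1..n. a k * zeta (int q * int k))
      = (if q = n then (\<Sum>k = 1..n. a k) else 0)" by simp
  qed
  also have "\<dots> = (\<Sum>k = 1..n. a k)" using n_ge_3 by simp
  finally show ?thesis by simp
qed

end

section \<open>Action of the operator on waves\<close>

context ngon_mass
begin

definition wave :: "int \<Rightarrow> complex \<Rightarrow> complex \<Rightarrow> complex \<Rightarrow> nat \<Rightarrow> complex" where
  "wave p \<alpha> \<beta> c k = (if k \<le> n then zeta (int k) * (\<alpha> * zeta (p * int k) + \<beta> * zeta (- (p * int k))) else c)"

abbreviation "u \<equiv> 3 * m / 2"

text \<open>By \<open>one_minus_zeta_squared\<close> each summand combines exponentials in j - k of
  frequencies 0, p + 1, 1 - p, 1, -p and p over the cubed chord. In every coefficient of the sum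
  \<open>inv_cube_sum 0\<close> cancels.\<close>

lemma sum_tidal_force_ring:
  assumes k: "k \<in> {1..n}"
  shows "(\<Sum>j = 1..n. tidal_force gon (wave p \<alpha> \<beta> c) k j) = zeta (int k) *
    (zeta (p * int k) * (of_real (ring_sum (p + 1)) * \<alpha> + of_real (3 * (s - ring_sum p)) * cnj \<beta>)
     + zeta (- (p * int k)) * (of_real (ring_sum (p - 1)) * \<beta> + of_real (3 * (s - ring_sum p)) * cnj \<alpha>))"
proof -
  let ?r = "\<lambda>j. complex_of_real (chord (int j - int k) ^ 3)"
  let ?T = "\<lambda>q j. zeta (q * (int j - int k)) / ?r j"
  define zp zm where "zp = zeta (p * int k)" and "zm = zeta (- (p * int k))"
  define a where "a = \<alpha> * zp + \<beta> * zm"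
  have term_eq: "tidal_force gon (wave p \<alpha> \<beta> c) k j = zeta (int k) / 2 *
      (a * ?T 0 j - \<alpha> * zp * ?T (p + 1) j - \<beta> * zm * ?T (1 - p) j - 3 * cnj a * ?T 1 j
       + 3 * cnj \<alpha> * zm * ?T (- p) j + 3 * cnj \<beta> * zp * ?T p j)" if "j \<in> {1..n}" for j
  proof -
    define l where "l = int j - int k"
    define R where "R = chord l"
    have le: "k \<le> n" "j \<le> n" using that k by auto
    define a' where "a' = \<alpha> * (zp * zeta (p * l)) + \<beta> * (zm * zeta (- (p * l)))"
    have j: "int j = int k + l" by (simp add: l_def)
    have y: "wave p \<alpha> \<beta> c k = zeta (int k) * a" "wave p \<alpha> \<beta> c j = zeta (int k) * (zeta l * a')"
      using le by (simp_all only: wave_def if_True a_def a'_def zp_def zm_def j distrib_left zeta_add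
          minus_add_distrib mult.assoc mult.left_commute)
    have d: "gon k - gon j = zeta (int k) * (1 - zeta l)"
      using gon_diff[OF le] by (simp add: l_def)
    have c: "cmod (gon k - gon j) = R"
      using cmod_gon_diff[OF le] by (simp add: l_def R_def)
    have conj: "zeta (int k) * cnj (zeta (int k)) = 1" "zeta l * cnj (zeta l) = 1" by simp_all
    have "(gon k - gon j)\<^sup>2 * cnj (zeta (int k) * a - zeta (int k) * (zeta l * a'))
       = - (zeta (int k) * (zeta (int k) * cnj (zeta (int k)))) * (of_real R)\<^sup>2
          * (zeta l * cnj a - (zeta l * cnj (zeta l)) * cnj a')"
      unfolding d power_mult_distrib one_minus_zeta_squared R_def[symmetric]
      by (simp add: algebra_simps power2_eq_square del: cnj_zeta zeta_cancel)
    then have num: "(gon k - gon j)\<^sup>2 * cnj (wave p \<alpha> \<beta> c k - wave p \<alpha> \<beta> c j)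
       = - zeta (int k) * (of_real R)\<^sup>2 * (zeta l * cnj a - cnj a')"
      unfolding conj y by simp
    have red: "b * (of_real R)\<^sup>2 * e / of_real (R ^ 5) = b * e / of_real (R ^ 3)" for b e :: complex
      by (cases "R = 0") (simp_all add: power2_eq_square eval_nat_numeral)
    have "tidal_force gon (wave p \<alpha> \<beta> c) k j = zeta (int k) / 2 * ((a - zeta l * a' - 3 * zeta l * cnj a + 3 * cnj a') / of_real (R ^ 3))"
    proof -
      have "3 * (gon k - gon j)\<^sup>2 * cnj (wave p \<alpha> \<beta> c k - wave p \<alpha> \<beta> c j) / of_real (R ^ 5)
        = 3 * (- zeta (int k) * (zeta l * cnj a - cnj a') / of_real (R ^ 3))"
        unfolding red[symmetric] by (simp only: mult.assoc[of 3] num times_divide_eq_right)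
      then show ?thesis
        unfolding tidal_force_def c mass_simps(1)[OF le(1)] mass_simps(1)[OF le(2)]
        by (simp only: y) (simp add: algebra_simps add_divide_distrib diff_divide_distrib)
    qed
    also have "zeta l * a' = \<alpha> * zp * zeta ((p + 1) * l) + \<beta> * zm * zeta ((1 - p) * l)"
      by (simp add: a'_def distrib_right left_diff_distrib algebra_simps zeta_add flip: zeta_add)
    also have "cnj a' = cnj \<alpha> * zm * zeta (- p * l) + cnj \<beta> * zp * zeta (p * l)"
      by (simp add: a'_def zp_def zm_def)
    finally show ?thesis
      unfolding l_def[symmetric] R_def[symmetric]
      by (simp add: algebra_simps add_divide_distrib diff_divide_distrib)
  qed
  have c: "inv_cube_sum q = inv_cube_sum 0 - 2 * ring_sum q" for q
    using inv_cube_sum_diff[of 0 q] by simp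
  have "(\<Sum>j = 1..n. tidal_force gon (wave p \<alpha> \<beta> c) k j) = zeta (int k) / 2 *
      (a * inv_cube_sum 0 - \<alpha> * zp * inv_cube_sum (p + 1) - \<beta> * zm * inv_cube_sum (1 - p)
       - 3 * cnj a * inv_cube_sum 1 + 3 * cnj \<alpha> * zm * inv_cube_sum (- p) + 3 * cnj \<beta> * zp * inv_cube_sum p)"
    unfolding sum_zeta_inv_cube[of _ "int k", symmetric]
    by (simp only: sum_distrib_left sum.distrib[symmetric] sum_subtractf[symmetric] term_eq cong: sum.cong)
  also have "cnj a = cnj \<alpha> * zm + cnj \<beta> * zp"
    by (simp add: a_def zp_def zm_def)
  finally have sum_eq: "(\<Sum>j = 1..n. tidal_force gon (wave p \<alpha> \<beta> c) k j) = zeta (int k) / 2 *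
      ((\<alpha> * zp + \<beta> * zm) * inv_cube_sum 0 - \<alpha> * zp * inv_cube_sum (p + 1) - \<beta> * zm * inv_cube_sum (1 - p)
       - 3 * (cnj \<alpha> * zm + cnj \<beta> * zp) * inv_cube_sum 1 + 3 * cnj \<alpha> * zm * inv_cube_sum (- p) + 3 * cnj \<beta> * zp * inv_cube_sum p)"
    by (simp only: a_def)
  have "ring_sum (1 - p) = ring_sum (p - 1)" using ring_sum_minus[of "p - 1"] by simp
  then show ?thesis
    unfolding sum_eq c[of "p + 1"] c[of "1 - p"] c[of 1] c[of "- p"] c[of p] zp_def[symmetric] zm_def[symmetric]
    by (simp add: algebra_simps)
qed

lemma tidal_force_centre:
  assumes k: "k \<in> {1..n}"
  shows "tidal_force gon (wave p \<alpha> \<beta> c) k (n + 1) = zeta (int k) * (of_real (m / 2) *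
    (zeta (p * int k) * (\<alpha> + 3 * cnj \<beta>) + zeta (- (p * int k)) * (\<beta> + 3 * cnj \<alpha>)
      - (zeta (- int k) * c + 3 * zeta (int k) * cnj c)))"
proof -
  define z w zp zm where "z = zeta (int k)" and "w = zeta (- int k)"
    and "zp = zeta (p * int k)" and "zm = zeta (- (p * int k))"
  have cz: "cnj z = w" "cnj zp = zm" "cnj zm = zp" and zw: "z * w = 1"
    by (simp_all add: z_def w_def zp_def zm_def)
  have "z\<^sup>2 * (w * x) = (z * w) * (z * x)" "z * (w * x) = (z * w) * x" for x
    by (simp_all only: power2_eq_square mult_ac)
  then have red: "z\<^sup>2 * (w * x) = z * x" "z * (w * x) = x" for x
    by (simp_all only: zw mult_1)
  have "tidal_force gon (wave p \<alpha> \<beta> c) k (n + 1) = of_real (m / 2) *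
     ((z * (\<alpha> * zp + \<beta> * zm) - c) + 3 * (z\<^sup>2 * cnj (z * (\<alpha> * zp + \<beta> * zm) - c)))"
    using k by (simp add: tidal_force_def wave_def z_def zp_def zm_def)
  also have "z\<^sup>2 * cnj (z * (\<alpha> * zp + \<beta> * zm) - c) = z * (cnj \<alpha> * zm + cnj \<beta> * zp) - z\<^sup>2 * cnj c"
    by (simp only: complex_cnj_diff complex_cnj_mult complex_cnj_add cz right_diff_distrib red)
  also have "of_real (m / 2) * (z * (\<alpha> * zp + \<beta> * zm) - c + 3 * (z * (cnj \<alpha> * zm + cnj \<beta> * zp) - z\<^sup>2 * cnj c))
    = z * (of_real (m / 2) * (zp * (\<alpha> + 3 * cnj \<beta>) + zm * (\<beta> + 3 * cnj \<alpha>)))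
      - of_real (m / 2) * (z * (w * c) + 3 * z\<^sup>2 * cnj c)"
    unfolding red by (simp add: algebra_simps)
  also have "\<dots> = z * (of_real (m / 2) * (zp * (\<alpha> + 3 * cnj \<beta>) + zm * (\<beta> + 3 * cnj \<alpha>) - (w * c + 3 * z * cnj c)))"
    by (simp add: algebra_simps power2_eq_square)
  finally show ?thesis unfolding z_def w_def zp_def zm_def .
qed

lemma mass_inner_gon_wave: "mass_inner gon (wave p \<alpha> \<beta> c) = Re (\<alpha> * zeta_sum p + \<beta> * zeta_sum (- p))"
proof -
  have "inner (zeta i) (zeta i * x) = Re x" for i x
  proof -
    have "inner (zeta i) (zeta i * x) = Re (cnj (zeta i) * (zeta i * x))"
      by (simp add: inner_complex_def del: cnj_zeta)
    then show ?thesis by (simp flip: mult.assoc)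
  qed
  then have "mass_inner gon (wave p \<alpha> \<beta> c) = (\<Sum>i = 1..n. Re (\<alpha> * zeta (p * int i) + \<beta> * zeta (- (p * int i))))"
    by (simp add: mass_inner_def wave_def)
  then show ?thesis
    by (simp only: zeta_sum_def sum_distrib_left sum.distrib[symmetric] Re_sum mult_minus_left)
qed

text \<open>The centre enters both parts of the block through u = 3 m / 2: once as m from
  \<open>multiplier\<close> plus m / 2 from its tidal force, once as 3 (m / 2) from the conjugate
  term.\<close>

lemma linearised_wave:
  assumes "k \<in> {1..n}"
  shows "linearised (wave p \<alpha> \<beta> c) k = zeta (int k) *
    (zeta (p * int k) * (of_real (ring_sum (p + 1) + 2 * s + u) * \<alpha> + of_real (3 * (s - ring_sum p) + u) * cnj \<beta>)
     + zeta (- (p * int k)) * (of_real (ring_sum (p - 1) + 2 * s + u) * \<beta> + of_real (3 * (s - ring_sum p) + u) * cnj \<alpha>)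
     - of_real (m / 2) * (zeta (- int k) * c + 3 * zeta (int k) * cnj c)
     - of_real (3 * multiplier / n * Re (\<alpha> * zeta_sum p + \<beta> * zeta_sum (- p))))"
proof -
  have w: "wave p \<alpha> \<beta> c k = zeta (int k) * (\<alpha> * zeta (p * int k) + \<beta> * zeta (- (p * int k)))"
    and g: "gon k = zeta (int k)" and one: "\<mu> k = 1"
    using assms by (simp_all add: wave_def)
  show ?thesis
    unfolding linearised_def sum_bodies sum_tidal_force_ring[OF assms] tidal_force_centre[OF assms]
      mass_inner_gon_wave w g one
    by (simp add: multiplier_def algebra_simps add_divide_distrib)
qed

text \<open>For 0 <= p <= n/2 the ring acts on the centre only through
  \<open>zeta_sum (1 - p)\<close>, nonzero for p = 1 alone.\<close>

lemma linearised_wave_centre: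
  "linearised (wave p \<alpha> \<beta> c) (n + 1) = of_real (m * multiplier) * c + of_real (m / 2) *
    (of_nat n * c - (\<alpha> * zeta_sum (p + 1) + \<beta> * zeta_sum (1 - p))
     - 3 * (cnj \<alpha> * zeta_sum (1 - p) + cnj \<beta> * zeta_sum (p + 1)))"
proof -
  have "tidal_force gon (wave p \<alpha> \<beta> c) (n + 1) j = of_real (m / 2) *
     (c - (\<alpha> * zeta ((p + 1) * int j) + \<beta> * zeta ((1 - p) * int j))
      + 3 * (zeta (2 * int j) * cnj c - (cnj \<alpha> * zeta ((1 - p) * int j) + cnj \<beta> * zeta ((p + 1) * int j))))"
    if "j \<in> {1..n}" for j
  proof -
    have z2: "(zeta (int j))\<^sup>2 = zeta (2 * int j)" by (simp add: power2_eq_square flip: zeta_add)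
    have "zeta (2 * int j) * (zeta (- int j) * zeta (- (p * int j))) = zeta ((1 - p) * int j)"
      "zeta (2 * int j) * (zeta (- int j) * zeta (p * int j)) = zeta ((p + 1) * int j)"
      by (simp_all add: algebra_simps flip: zeta_add)
    moreover have "zeta (int j) * zeta (- (p * int j)) = zeta ((1 - p) * int j)"
      "zeta (int j) * zeta (p * int j) = zeta ((p + 1) * int j)"
      by (simp_all add: algebra_simps flip: zeta_add)
    moreover have "tidal_force gon (wave p \<alpha> \<beta> c) (n + 1) j = of_real (m / 2) *
      ((c - zeta (int j) * (\<alpha> * zeta (p * int j) + \<beta> * zeta (- (p * int j))))
        + 3 * zeta (2 * int j) * (cnj c - zeta (- int j) * (cnj \<alpha> * zeta (- (p * int j)) + cnj \<beta> * zeta (p * int j))))"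
      using that by (simp add: tidal_force_def wave_def z2)
    moreover have "z * (w * (A * zm + B * zp)) = A * (z * (w * zm)) + B * (z * (w * zp))"
      "z * (A * zp + B * zm) = A * (z * zp) + B * (z * zm)" for A B z w zp zm :: complex
      by (simp_all add: algebra_simps)
    ultimately show ?thesis
      by (simp only: mult.assoc right_diff_distrib[of "zeta (2 * int j)"])
  qed
  then have "(\<Sum>j = 1..n. tidal_force gon (wave p \<alpha> \<beta> c) (n + 1) j) = of_real (m / 2) *
     (of_nat n * c - (\<alpha> * zeta_sum (p + 1) + \<beta> * zeta_sum (1 - p))
      + 3 * (zeta_sum 2 * cnj c - (cnj \<alpha> * zeta_sum (1 - p) + cnj \<beta> * zeta_sum (p + 1))))"
    by (simp only: zeta_sum_def sum.distrib sum_subtractf sum_distrib_left[symmetric]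
        sum_distrib_right[symmetric] sum_constant card_atLeastAtMost cong: sum.cong) simp
  moreover have "zeta_sum 2 = 0" using n_ge_3 by simp
  moreover have "tidal_force gon y (n + 1) (n + 1) = 0" for y by (simp add: tidal_force_def)
  ultimately show ?thesis
    unfolding linearised_def sum_bodies[of "tidal_force gon (wave p \<alpha> \<beta> c) (n + 1)"]
    by (simp add: wave_def algebra_simps)
qed

text \<open>
  For \<open>p = 1\<close> the equation of the central body determines its displacement \<open>centre_response\<close>; substituting
  it leaves a symmetric \<open>2 \<times> 2\<close> matrix as for the other modes.
\<close>

definition elimination :: real where
  "elimination = n + 2 * m + 4 * s"

lemma elimination_pos: "0 < elimination"
  using n_pos m_pos ring_sum_1_pos by (simp add: elimination_def)

definition centre_response :: "int \<Rightarrow> complex \<Rightarrow> complex \<Rightarrow> complex" where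
  "centre_response p \<alpha> \<beta> = (if p = 1 then of_real (n / elimination) * (\<beta> + 3 * cnj \<alpha>) else 0)"

text \<open>A, B, C are the entries of the block on (\<open>\<alpha>\<close>,
  \<open>cnj \<beta>\<close>). The corrections for p = 1 form a Schur complement: minus n u / (3
  \<open>elimination\<close>) times the rank one matrix of the vector (3, 1).\<close>

definition mode_A :: "int \<Rightarrow> real" where
  "mode_A p = ring_sum (p + 1) + 2 * s + u - (if p = 1 then 3 * n * u / elimination else 0)"

definition mode_B :: "int \<Rightarrow> real" where
  "mode_B p = 3 * (s - ring_sum p) + u - (if p = 1 then n * u / elimination else 0)"

definition mode_C :: "int \<Rightarrow> real" where
  "mode_C p = ring_sum (p - 1) + 2 * s + u - (if p = 1 then n * u / (3 * elimination) else 0)"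

definition mode_wave :: "int \<Rightarrow> complex \<Rightarrow> complex \<Rightarrow> nat \<Rightarrow> complex" where
  "mode_wave p \<alpha> \<beta> = wave p \<alpha> \<beta> (centre_response p \<alpha> \<beta>)"

lemma linearised_mode_wave:
  assumes p: "1 \<le> p" "2 * p \<le> int n" and k: "k \<in> {1..n}"
  shows "linearised (mode_wave p \<alpha> \<beta>) k = zeta (int k) *
    (zeta (p * int k) * (of_real (mode_A p) * \<alpha> + of_real (mode_B p) * cnj \<beta>)
     + zeta (- (p * int k)) * (of_real (mode_C p) * \<beta> + of_real (mode_B p) * cnj \<alpha>))"
proof -
  have "zeta_sum p = 0" "zeta_sum (- p) = 0" using p n_ge_3 by simp_all
  then have "linearised (mode_wave p \<alpha> \<beta>) k = zeta (int k) *
    (zeta (p * int k) * (of_real (ring_sum (p + 1) + 2 * s + u) * \<alpha> + of_real (3 * (s - ring_sum p) + u) * cnj \<beta>)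
     + zeta (- (p * int k)) * (of_real (ring_sum (p - 1) + 2 * s + u) * \<beta> + of_real (3 * (s - ring_sum p) + u) * cnj \<alpha>)
     - of_real (m / 2) * (zeta (- int k) * centre_response p \<alpha> \<beta> + 3 * zeta (int k) * cnj (centre_response p \<alpha> \<beta>)))"
    unfolding mode_wave_def linearised_wave[OF k] by simp
  also have "\<dots> = zeta (int k) *
    (zeta (p * int k) * (of_real (mode_A p) * \<alpha> + of_real (mode_B p) * cnj \<beta>)
     + zeta (- (p * int k)) * (of_real (mode_C p) * \<beta> + of_real (mode_B p) * cnj \<alpha>))"
  proof (cases "p = 1")
    case False
    then show ?thesis by (simp add: mode_A_def mode_B_def mode_C_def centre_response_def)
  next
    case True
    define e where "e = n / elimination"
    have "3 * n * u / elimination = 3 * u * e" "n * u / elimination = u * e" "n * u / (3 * elimination) = u * e / 3"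
      by (simp_all add: e_def)
    then have ABC: "mode_A p = ring_sum (p + 1) + 2 * s + u - 3 * u * e"
      "mode_B p = 3 * (s - ring_sum p) + u - u * e" "mode_C p = ring_sum (p - 1) + 2 * s + u - u * e / 3"
      using True by (simp_all only: mode_A_def mode_B_def mode_C_def if_True simp_thms)
    have c: "centre_response p \<alpha> \<beta> = of_real e * (\<beta> + 3 * cnj \<alpha>)"
      "cnj (centre_response p \<alpha> \<beta>) = of_real e * (cnj \<beta> + 3 * \<alpha>)"
      using True by (simp_all add: centre_response_def e_def)
    show ?thesis
      unfolding ABC c using True by (simp add: algebra_simps)
  qed
  finally show ?thesis .
qed

lemma linearised_mode_wave_centre:
  assumes p: "1 \<le> p" "2 * p \<le> int n"
  shows "linearised (mode_wave p \<alpha> \<beta>) (n + 1) = 0"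
proof (cases "p = 1")
  case False
  then have "zeta_sum (p + 1) = 0" "zeta_sum (1 - p) = 0"
    using p n_ge_3 by (intro zeta_sum_eq_0; simp)+
  then show ?thesis
    using False unfolding mode_wave_def linearised_wave_centre by (simp add: centre_response_def)
next
  case True
  have "zeta_sum 2 = 0" using n_ge_3 by simp
  then have "linearised (mode_wave p \<alpha> \<beta>) (n + 1) = of_real (m * multiplier) * centre_response p \<alpha> \<beta> +
      of_real (m / 2) * (of_nat n * centre_response p \<alpha> \<beta> - of_nat n * (\<beta> + 3 * cnj \<alpha>))"
    using True unfolding mode_wave_def linearised_wave_centre by (simp add: algebra_simps)
  also have "\<dots> = of_real (m / 2) * (of_real elimination * centre_response p \<alpha> \<beta> - of_nat n * (\<beta> + 3 * cnj \<alpha>))"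
    by (simp add: elimination_def multiplier_def algebra_simps)
  also have "of_real elimination * centre_response p \<alpha> \<beta> = of_nat n * (\<beta> + 3 * cnj \<alpha>)"
    using True elimination_pos by (simp add: centre_response_def)
  finally show ?thesis by simp
qed

section \<open>Kernel directions of the operator\<close>

definition critical_direction :: "(nat \<Rightarrow> complex) \<Rightarrow> bool" where
  "critical_direction y \<longleftrightarrow> (\<forall>i\<in>{1..n + 1}. linearised y i = 0)"

text \<open>The real part of the factor gives the radial, the imaginary part the rotational
  direction.\<close>

definition trivial_direction :: "(nat \<Rightarrow> complex) \<Rightarrow> bool" where
  "trivial_direction y \<longleftrightarrow> (\<exists>\<alpha>. \<forall>i\<in>{1..n + 1}. y i = \<alpha> * gon i)"

lemma linearised_cong:
  assumes "\<And>i. i \<in> {1..n + 1} \<Longrightarrow> y i = y' i" "i \<in> {1..n + 1}"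
  shows "linearised y i = linearised y' i"
proof -
  have "mass_inner gon y = mass_inner gon y'"
    using eq_on_bodies(2)[of y y' gon] assms by blast
  moreover have "(\<Sum>j = 1..n + 1. tidal_force gon y i j) = (\<Sum>j = 1..n + 1. tidal_force gon y' i j)"
    unfolding tidal_force_def by (intro sum.cong refl) (simp only: assms)
  ultimately show ?thesis
    unfolding linearised_def using assms by (simp only:)
qed

text \<open>For p = 0 the block gives (3 s + u) times \<open>\<alpha> + cnj \<alpha>\<close>, which
  the rank one term cancels because 2 (3 s + u) = 3 \<open>multiplier\<close>.\<close>

lemma trivial_imp_critical:
  assumes "trivial_direction y"
  shows "critical_direction y"
proof -
  obtain \<alpha> where \<alpha>: "\<And>i. i \<in> {1..n + 1} \<Longrightarrow> y i = \<alpha> * gon i"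
    using assms unfolding trivial_direction_def by blast
  have "y i = wave 0 \<alpha> 0 0 i" if "i \<in> {1..n + 1}" for i
    using \<alpha>[OF that] by (simp add: wave_def gon_def)
  then have eq: "linearised y i = linearised (wave 0 \<alpha> 0 0) i" if "i \<in> {1..n + 1}" for i
    using linearised_cong that by blast
  have "linearised (wave 0 \<alpha> 0 0) (n + 1) = 0"
    unfolding linearised_wave_centre using n_ge_3 by simp
  moreover have "linearised (wave 0 \<alpha> 0 0) k = 0" if k: "k \<in> {1..n}" for k
  proof -
    have "linearised (wave 0 \<alpha> 0 0) k = zeta (int k) *
       (of_real (3 * s + u) * (\<alpha> + cnj \<alpha>) - of_real (3 * multiplier * Re \<alpha>))"
      using n_pos ring_sum_minus[of 1] unfolding linearised_wave[OF k] by (simp add: algebra_simps)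
    also have "\<alpha> + cnj \<alpha> = of_real (2 * Re \<alpha>)" by (simp add: complex_add_cnj)
    finally show ?thesis by (simp add: multiplier_def algebra_simps)
  qed
  ultimately show ?thesis
    unfolding critical_direction_def using eq by (metis atLeastAtMost_iff le_Suc_eq Suc_eq_plus1)
qed

text \<open>
  For \<open>p = n / 2\<close> the two exponentials coincide and the wave of a real null vector may vanish; then the
  wave rotated by \<open>\<i>\<close> does not.
\<close>

lemma critical_mode_wave:
  assumes p: "1 \<le> p" "2 * p \<le> int n" and sing: "mode_A p * mode_C p - (mode_B p)\<^sup>2 = 0"
  shows "\<exists>y. critical_direction y \<and> \<not> trivial_direction y"
proof -
  obtain a b :: real where ab: "mode_A p * a + mode_B p * b = 0" "mode_B p * a + mode_C p * b = 0"
    "a \<noteq> 0 \<or> b \<noteq> 0"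
  proof (cases "mode_A p = 0 \<and> mode_B p = 0")
    case True
    then show ?thesis using that[of 1 0] by simp
  next
    case False
    show ?thesis
    proof (rule that)
      show "mode_A p * mode_B p + mode_B p * - mode_A p = 0" by simp
      show "mode_B p * mode_B p + mode_C p * - mode_A p = 0"
        using sing by (simp add: power2_eq_square mult.commute)
      show "mode_B p \<noteq> 0 \<or> - mode_A p \<noteq> 0" using False by auto
    qed
  qed
  \<comment> \<open>The block has real entries, so the real null vector (a, b) may be multiplied by
    any complex v; its second coordinate is the conjugate of the amplitude.\<close>
  have crit: "critical_direction (mode_wave p (of_real a * v) (of_real b * cnj v))" for v
  proof -
    have "of_real (mode_A p) * (of_real a * v) + of_real (mode_B p) * cnj (of_real b * cnj v)
       = of_real (mode_A p * a + mode_B p * b) * v"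
      "of_real (mode_C p) * (of_real b * cnj v) + of_real (mode_B p) * cnj (of_real a * v)
       = of_real (mode_B p * a + mode_C p * b) * cnj v"
      by (simp_all add: algebra_simps)
    then have "linearised (mode_wave p (of_real a * v) (of_real b * cnj v)) k = 0" if "k \<in> {1..n}" for k
      unfolding linearised_mode_wave[OF p that] ab by simp
    then show ?thesis
      unfolding critical_direction_def using linearised_mode_wave_centre[OF p]
      by (metis atLeastAtMost_iff le_Suc_eq Suc_eq_plus1)
  qed
  have zero: "of_real a * v + of_real b * cnj v = 0"
    if triv: "trivial_direction (mode_wave p (of_real a * v) (of_real b * cnj v))" for v
  proof -
    obtain \<gamma> where "\<And>i. i \<in> {1..n + 1} \<Longrightarrow> mode_wave p (of_real a * v) (of_real b * cnj v) i = \<gamma> * gon i"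
      using triv unfolding trivial_direction_def by blast
    then have "zeta (int i) * (of_real a * v * zeta (p * int i) + of_real b * cnj v * zeta (- (p * int i))) = \<gamma> * zeta (int i)"
      if "i \<in> {1..n}" for i
      using that by (force simp: mode_wave_def wave_def gon_def)
    then have eq: "of_real a * v * zeta (p * int i) + of_real b * cnj v * zeta (- (p * int i)) = \<gamma>"
      if "i \<in> {1..n}" for i
      using that by (metis mult.commute mult_cancel_left zeta_nonzero)
    \<comment> \<open>The mean over the ring shows that the factor is 0; then k = n, where all
      exponentials are 1, leaves the sum of the amplitudes.\<close>
    have "of_nat n * \<gamma> = (\<Sum>i = 1..n. of_real a * v * zeta (p * int i) + of_real b * cnj v * zeta (- p * int i))"
      using eq by simp
    also have "\<dots> = of_real a * v * zeta_sum p + of_real b * cnj v * zeta_sum (- p)"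
      by (simp only: zeta_sum_def sum.distrib sum_distrib_left)
    also have "\<dots> = 0" using p n_ge_3 by simp
    finally have "\<gamma> = 0" using n_pos by simp
    moreover have "zeta (p * int n) = 1" "zeta (- (p * int n)) = 1"
      using zeta_period(2)[of p] zeta_period(2)[of "- p"] by simp_all
    ultimately show ?thesis using eq[of n] n_ge_3 by simp
  qed
  have "a + b \<noteq> 0 \<or> a - b \<noteq> 0" using ab(3) by auto
  then show ?thesis
  proof
    assume "a + b \<noteq> 0"
    then have "of_real a * 1 + of_real b * cnj 1 \<noteq> (0 :: complex)"
      by (simp flip: of_real_add)
    then show ?thesis using crit[of 1] zero[of 1] by blast
  next
    assume "a - b \<noteq> 0"
    then have "of_real a * \<i> + of_real b * cnj \<i> \<noteq> 0"
      by (simp add: complex_eq_iff)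
    then show ?thesis using crit[of \<i>] zero[of \<i>] by blast
  qed
qed

lemma linearised_self_adjoint:
  "(\<Sum>i = 1..n + 1. inner (d i) (linearised y i)) = (\<Sum>i = 1..n + 1. inner (y i) (linearised d i))"
  using second_form_gon[of d y] second_form_gon[of y d] second_form_commute[of gon d y] n_pos by simp

text \<open>
  The range of the operator on each nonsingular mode is the whole mode, so by self-adjointness a kernel
  vector is orthogonal to all modes \<open>p \<ge> 1\<close>.
\<close>

lemma critical_imp_trivial:
  assumes nonsing: "\<And>p. 1 \<le> p \<Longrightarrow> 2 * p \<le> int n \<Longrightarrow> mode_A p * mode_C p - (mode_B p)\<^sup>2 \<noteq> 0"
    and crit: "critical_direction y"
  shows "trivial_direction y"
proof -
  define a where "a k = zeta (- int k) * y k" for k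
  have y: "y k = zeta (int k) * a k" for k
    by (simp add: a_def flip: mult.assoc)
  have orth: "(\<Sum>k = 1..n. inner (a k) (zeta (p * int k) * \<gamma> + zeta (- (p * int k)) * \<delta>)) = 0"
    if p: "1 \<le> p" "2 * p \<le> int n" for p \<gamma> \<delta>
  proof -
    define A B C where "A = mode_A p" and "B = mode_B p" and "C = mode_C p"
    define \<Delta> where "\<Delta> = A * C - B\<^sup>2"
    have \<Delta>: "\<Delta> \<noteq> 0" using nonsing[OF p] by (simp add: \<Delta>_def A_def B_def C_def)
    \<comment> \<open>Cramer's rule for the unknowns \<open>\<alpha>\<close> and
      \<open>cnj \<beta>\<close>.\<close>
    define \<alpha> where "\<alpha> = (of_real C * \<gamma> - of_real B * cnj \<delta>) / of_real \<Delta>"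
    define \<beta> where "\<beta> = (of_real A * \<delta> - of_real B * cnj \<gamma>) / of_real \<Delta>"
    have "of_real A * \<alpha> + of_real B * cnj \<beta> = of_real \<Delta> * \<gamma> / of_real \<Delta>"
      "of_real C * \<beta> + of_real B * cnj \<alpha> = of_real \<Delta> * \<delta> / of_real \<Delta>"
      unfolding \<alpha>_def \<beta>_def \<Delta>_def times_divide_eq_right complex_cnj_divide complex_cnj_complex_of_real
        add_divide_distrib[symmetric]
      by (simp_all add: algebra_simps power2_eq_square)
    then have inv: "of_real A * \<alpha> + of_real B * cnj \<beta> = \<gamma>" "of_real C * \<beta> + of_real B * cnj \<alpha> = \<delta>"
      using \<Delta> by simp_all
    have "0 = (\<Sum>i = 1..n + 1. inner (y i) (linearised (mode_wave p \<alpha> \<beta>) i))"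
      using crit linearised_self_adjoint[of "mode_wave p \<alpha> \<beta>" y] by (simp add: critical_direction_def)
    also have "\<dots> = (\<Sum>i = 1..n. inner (y i) (zeta (int i) * (zeta (p * int i) * \<gamma> + zeta (- (p * int i)) * \<delta>)))"
    proof -
      have "linearised (mode_wave p \<alpha> \<beta>) i = zeta (int i) * (zeta (p * int i) * \<gamma> + zeta (- (p * int i)) * \<delta>)"
        if "i \<in> {1..n}" for i
        unfolding linearised_mode_wave[OF p that] using inv by (simp only: A_def B_def C_def)
      then have "(\<Sum>i = 1..n. inner (y i) (linearised (mode_wave p \<alpha> \<beta>) i))
         = (\<Sum>i = 1..n. inner (y i) (zeta (int i) * (zeta (p * int i) * \<gamma> + zeta (- (p * int i)) * \<delta>)))"
        by (intro sum.cong refl) (simp only:)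
      then show ?thesis
        unfolding sum_bodies[of "\<lambda>i. inner (y i) (linearised (mode_wave p \<alpha> \<beta>) i)"]
          linearised_mode_wave_centre[OF p] by simp
    qed
    also have "\<dots> = (\<Sum>k = 1..n. inner (a k) (zeta (p * int k) * \<gamma> + zeta (- (p * int k)) * \<delta>))"
    proof (intro sum.cong refl)
      fix k
      have "inner (z * v) (z * w) = (cmod z)\<^sup>2 * inner v w" for z v w :: complex
        unfolding cmod_power2 by (simp add: inner_complex_def power2_eq_square algebra_simps)
      then show "inner (y k) (zeta (int k) * (zeta (p * int k) * \<gamma> + zeta (- (p * int k)) * \<delta>))
         = inner (a k) (zeta (p * int k) * \<gamma> + zeta (- (p * int k)) * \<delta>)"
        unfolding y by simp
    qed
    finally show ?thesis by simp
  qed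
  have zero_if: "S = 0" if "\<And>\<gamma>. Re (cnj S * \<gamma>) = 0" for S
  proof -
    have "(cmod S)\<^sup>2 = Re (cnj S * S)" unfolding cmod_power2 by (simp add: power2_eq_square)
    then show ?thesis using that[of S] by simp
  qed
  have inner_Re: "inner v (w * \<gamma>) = Re (cnj (v * cnj w) * \<gamma>)" for v w \<gamma> :: complex
    by (simp add: inner_complex_def algebra_simps)
  have both: "(\<Sum>k = 1..n. a k * zeta (p * int k)) = 0" "(\<Sum>k = 1..n. a k * zeta (- p * int k)) = 0"
    if p: "1 \<le> p" "2 * p \<le> int n" for p
  proof -
    show "(\<Sum>k = 1..n. a k * zeta (- p * int k)) = 0"
    proof (rule zero_if)
      fix \<gamma>
      have "Re (cnj (\<Sum>k = 1..n. a k * zeta (- p * int k)) * \<gamma>) = (\<Sum>k = 1..n. inner (a k) (zeta (p * int k) * \<gamma>))"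
        unfolding inner_Re by (simp only: cnj_sum sum_distrib_right Re_sum cnj_zeta mult_minus_left)
      also have "\<dots> = 0" using orth[OF p, of \<gamma> 0] by simp
      finally show "Re (cnj (\<Sum>k = 1..n. a k * zeta (- p * int k)) * \<gamma>) = 0" .
    qed
    show "(\<Sum>k = 1..n. a k * zeta (p * int k)) = 0"
    proof (rule zero_if)
      fix \<gamma>
      have "Re (cnj (\<Sum>k = 1..n. a k * zeta (p * int k)) * \<gamma>) = (\<Sum>k = 1..n. inner (a k) (zeta (- (p * int k)) * \<gamma>))"
        unfolding inner_Re by (simp only: cnj_sum sum_distrib_right Re_sum cnj_zeta minus_minus)
      also have "\<dots> = 0" using orth[OF p, of 0 \<gamma>] by simp
      finally show "Re (cnj (\<Sum>k = 1..n. a k * zeta (p * int k)) * \<gamma>) = 0" .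
    qed
  qed
  have coeff: "(\<Sum>k = 1..n. a k * zeta (q * int k)) = 0" if q: "0 < q" "q < int n" for q
  proof (cases "2 * q \<le> int n")
    case True
    then show ?thesis using both(1)[of q] q by simp
  next
    case False
    \<comment> \<open>Frequencies above n/2 are aliases of -(n - q).\<close>
    have "zeta (- (int n - q) * int k) = zeta (q * int k)" for k
    proof -
      have "- (int n - q) * int k = q * int k + int n * (- int k)" by (simp add: algebra_simps)
      then show ?thesis by (simp only: zeta_add zeta_period) simp
    qed
    then show ?thesis using both(2)[of "int n - q"] False q by simp
  qed
  have const: "of_nat n * a k = (\<Sum>k = 1..n. a k)" if "k \<in> {1..n}" for k
    by (rule fourier_const[OF coeff that])
  define \<alpha> where "\<alpha> = (\<Sum>k = 1..n. a k) / of_nat n"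
  have a: "a k = \<alpha>" if "k \<in> {1..n}" for k
    using const[OF that] n_pos by (simp add: \<alpha>_def field_simps)
  have w: "y i = wave 0 \<alpha> 0 (y (n + 1)) i" if "i \<in> {1..n + 1}" for i
  proof (cases "i \<le> n")
    case True
    then show ?thesis using a[of i] y[of i] that by (simp add: wave_def)
  next
    case False
    then have "i = n + 1" using that by simp
    then show ?thesis by (simp add: wave_def)
  qed
  \<comment> \<open>A constant wave has no effect on the centre, whose equation is then a positive
    multiple of its own displacement.\<close>
  have "linearised y (n + 1) = linearised (wave 0 \<alpha> 0 (y (n + 1))) (n + 1)"
    by (rule linearised_cong[OF w]) simp_all
  also have "\<dots> = of_real (m * multiplier) * y (n + 1) + of_real (m / 2) * (of_nat n * y (n + 1))"
    using n_ge_3 unfolding linearised_wave_centre by simp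
  also have "\<dots> = of_real (m * multiplier + m / 2 * n) * y (n + 1)" by (simp add: algebra_simps)
  finally have "of_real (m * multiplier + m / 2 * n) * y (n + 1) = 0"
    using crit by (simp add: critical_direction_def)
  moreover have "0 < m * multiplier + m / 2 * n"
    using m_pos n_pos ring_sum_1_pos by (simp add: multiplier_def add_pos_pos)
  ultimately have y0: "y (n + 1) = 0" by (simp only: mult_eq_0_iff of_real_eq_0_iff) auto
  have "y i = \<alpha> * gon i" if "i \<in> {1..n + 1}" for i
    unfolding w[OF that] y0 by (simp add: wave_def gon_def)
  then show ?thesis unfolding trivial_direction_def by blast
qed

section \<open>Kernel of the Hessian\<close>

lemma planar_config:
  assumes "i \<in> {1..n + 1}"
  shows "planar (config n x) i = Complex (fst (x i)) (snd (x i))"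
proof -
  have "2 * (i - 1) + 1 < 2 * n + 2" "i - 1 + 1 = i" using assms by auto
  then show ?thesis by (simp add: planar_def config_def)
qed

lemma planar_centred_ngon:
  assumes "i \<in> {1..n + 1}"
  shows "planar (centred_ngon n) i = gon i"
  unfolding centred_ngon_def planar_config[OF assms]
  by (simp add: gon_def ngon_point_def zeta_def complex_eq_iff mult_ac)

lemma planar_rotation_direction:
  assumes "i \<in> {1..n + 1}"
  shows "planar (rotation_direction n) i = \<i> * gon i"
  unfolding rotation_direction_def planar_config[OF assms]
  by (simp add: gon_def ngon_tangent_def zeta_def complex_eq_iff mult_ac)

lemma second_form_cong:
  assumes "\<And>i. i \<in> {1..n + 1} \<Longrightarrow> x i = x' i"
  shows "second_form x d y = second_form x' d y"
proof -
  have "x i = x' i" "x j = x' j" if "(i, j) \<in> pairs" for i j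
    using that by (auto simp: pairs_def intro!: assms)
  then have "tidal x d y = tidal x' d y"
    unfolding tidal_def by (auto intro!: sum.cong)
  moreover have "mass_inner x x = mass_inner x' x'"
    using eq_on_bodies(1,2)[of x x', OF assms] by simp
  ultimately show ?thesis
    unfolding second_form_def using eq_on_bodies(1,3,4)[of x x', OF assms] by simp
qed

lemma hessian_entry:
  assumes "i < 2 * n + 2" "j < 2 * n + 2"
  shows "hessian (scaled_potential n m) (centred_ngon n) $$ (i, j)
    = second_form gon (planar (unit_vec (2 * n + 2) i)) (planar (unit_vec (2 * n + 2) j))"
proof -
  have dim: "dim_vec (centred_ngon n) = 2 * n + 2" by (simp add: centred_ngon_def config_def)
  have "regular (planar (centred_ngon n))"
    using regular_gon eq_on_bodies(8)[OF planar_centred_ngon] by simp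
  from second_partial_deriv_scaled_potential[OF dim this, of i j]
  show ?thesis
    using assms second_form_cong[OF planar_centred_ngon] by (simp add: hessian_def dim)
qed

lemma planar_unit_vec:
  assumes "k \<in> {1..n + 1}" "j < 2 * n + 2"
  shows "planar (unit_vec (2 * n + 2) j) k = Complex (of_bool (j = 2 * (k - 1))) (of_bool (j = 2 * (k - 1) + 1))"
  using assms by (auto simp: planar_def)

lemma planar_eq_sum:
  assumes "v \<in> carrier_vec (2 * n + 2)" "k \<in> {1..n + 1}"
  shows "planar v k = (\<Sum>j = 0..<2 * n + 2. vec_index v j *\<^sub>R planar (unit_vec (2 * n + 2) j) k)"
proof -
  have "2 * (k - 1) + 1 < 2 * n + 2" using assms by auto
  moreover have "(\<Sum>j = 0..<2 * n + 2. vec_index v j *\<^sub>R planar (unit_vec (2 * n + 2) j) k)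
     = (\<Sum>j = 0..<2 * n + 2. Complex (if j = 2 * (k - 1) then vec_index v j else 0)
         (if j = 2 * (k - 1) + 1 then vec_index v j else 0))"
  proof (intro sum.cong refl)
    fix j assume "j \<in> {0..<2 * n + 2}"
    then have "j < 2 * n + 2" by simp
    note e = planar_unit_vec[OF assms(2) this]
    show "vec_index v j *\<^sub>R planar (unit_vec (2 * n + 2) j) k
      = Complex (if j = 2 * (k - 1) then vec_index v j else 0) (if j = 2 * (k - 1) + 1 then vec_index v j else 0)"
      unfolding e by (simp add: complex_eq_iff)
  qed
  ultimately show ?thesis
    by (simp add: planar_def complex_eq_iff)
qed

text \<open>By symmetry each entry is the operator on the i-th unit vector tested with the j-th.
  Summation assembles v from the latter, and self-adjointness moves the operator onto v.\<close>

lemma hessian_mult_vec: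
  assumes v: "v \<in> carrier_vec (2 * n + 2)" and i: "i < 2 * n + 2"
  shows "vec_index (hessian (scaled_potential n m) (centred_ngon n) *\<^sub>v v) i
    = sqrt n * (\<Sum>k = 1..n + 1. inner (planar (unit_vec (2 * n + 2) i) k) (linearised (planar v) k))"
proof -
  let ?H = "hessian (scaled_potential n m) (centred_ngon n)"
  let ?e = "\<lambda>j. planar (unit_vec (2 * n + 2) j)"
  have dim: "dim_row ?H = 2 * n + 2" "dim_col ?H = 2 * n + 2"
    by (simp_all add: hessian_def centred_ngon_def config_def)
  have "vec_index (?H *\<^sub>v v) i = (\<Sum>j = 0..<2 * n + 2. ?H $$ (i, j) * vec_index v j)"
    using v i dim by (simp add: scalar_prod_def)
  also have "\<dots> = (\<Sum>j = 0..<2 * n + 2. vec_index v j * (sqrt n * (\<Sum>k = 1..n + 1. inner (?e j k) (linearised (?e i) k))))"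
  proof (intro sum.cong refl)
    fix j assume "j \<in> {0..<2 * n + 2}"
    then show "?H $$ (i, j) * vec_index v j = vec_index v j * (sqrt n * (\<Sum>k = 1..n + 1. inner (?e j k) (linearised (?e i) k)))"
      using hessian_entry[OF i, of j] second_form_commute[of gon "?e i" "?e j"]
      by (simp only: second_form_gon[of "?e j" "?e i"]) simp
  qed
  also have "\<dots> = sqrt n * (\<Sum>j = 0..<2 * n + 2. \<Sum>k = 1..n + 1. inner (vec_index v j *\<^sub>R ?e j k) (linearised (?e i) k))"
    by (simp only: inner_scaleR_left sum_distrib_left mult.left_commute)
  also have "(\<Sum>j = 0..<2 * n + 2. \<Sum>k = 1..n + 1. inner (vec_index v j *\<^sub>R ?e j k) (linearised (?e i) k))
     = (\<Sum>k = 1..n + 1. inner (planar v k) (linearised (?e i) k))"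
    by (subst sum.swap, intro sum.cong refl) (simp only: inner_sum_left[symmetric] planar_eq_sum[OF v])
  finally show ?thesis
    unfolding linearised_self_adjoint[of "planar v" "?e i"] .
qed

lemma mat_kernel_hessian:
  "v \<in> mat_kernel (hessian (scaled_potential n m) (centred_ngon n)) \<longleftrightarrow>
     v \<in> carrier_vec (2 * n + 2) \<and> critical_direction (planar v)"
proof -
  let ?H = "hessian (scaled_potential n m) (centred_ngon n)"
  have dim: "dim_row ?H = 2 * n + 2" "dim_col ?H = 2 * n + 2"
    by (simp_all add: hessian_def centred_ngon_def config_def)
  have "?H *\<^sub>v v = 0\<^sub>v (2 * n + 2) \<longleftrightarrow> critical_direction (planar v)"
    if v: "v \<in> carrier_vec (2 * n + 2)"
  proof
    assume zero: "?H *\<^sub>v v = 0\<^sub>v (2 * n + 2)"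
    have "linearised (planar v) k = 0" if k: "k \<in> {1..n + 1}" for k
    proof -
      \<comment> \<open>The unit vectors 2 (k - 1) and 2 (k - 1) + 1 read off the real and imaginary
        part of the k-th component.\<close>
      have pick: "(\<Sum>l = 1..n + 1. inner (planar (unit_vec (2 * n + 2) i) l) (linearised (planar v) l)) = 0"
        if "i < 2 * n + 2" for i
        using hessian_mult_vec[OF v that] zero that n_pos by simp
      have i: "2 * (k - 1) < 2 * n + 2" "2 * (k - 1) + 1 < 2 * n + 2" using k by auto
      have *: "2 * (k - 1) = 2 * (l - 1) \<longleftrightarrow> l = k" "2 * (k - 1) \<noteq> 2 * (l - 1) + 1" "2 * (k - 1) + 1 \<noteq> 2 * (l - 1)"
        "2 * (k - 1) + 1 = 2 * (l - 1) + 1 \<longleftrightarrow> l = k" if "l \<in> {1..n + 1}" for l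
        using that k by (auto, presburger+)
      have "(\<Sum>l = 1..n + 1. inner (planar (unit_vec (2 * n + 2) (2 * (k - 1))) l) (linearised (planar v) l))
        = (\<Sum>l = 1..n + 1. if l = k then Re (linearised (planar v) k) else 0)"
        by (intro sum.cong refl) (auto simp only: planar_unit_vec[OF _ i(1)] * inner_complex_def complex.sel of_bool_eq simp_thms mult_1_left mult_zero_left add_0_left add_0_right split: if_split)
      moreover have "(\<Sum>l = 1..n + 1. inner (planar (unit_vec (2 * n + 2) (2 * (k - 1) + 1)) l) (linearised (planar v) l))
        = (\<Sum>l = 1..n + 1. if l = k then Im (linearised (planar v) k) else 0)"
        by (intro sum.cong refl) (auto simp only: planar_unit_vec[OF _ i(2)] * inner_complex_def complex.sel of_bool_eq simp_thms mult_1_left mult_zero_left add_0_left add_0_right split: if_split)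
      ultimately have "Re (linearised (planar v) k) = 0" "Im (linearised (planar v) k) = 0"
        using pick[OF i(1)] pick[OF i(2)] k by (simp_all only: sum.delta finite_atLeastAtMost if_True)
      then show ?thesis by (simp add: complex_eq_iff)
    qed
    then show "critical_direction (planar v)" unfolding critical_direction_def by blast
  next
    assume "critical_direction (planar v)"
    then have "vec_index (?H *\<^sub>v v) i = 0" if "i < 2 * n + 2" for i
      unfolding hessian_mult_vec[OF v that] critical_direction_def by simp
    then show "?H *\<^sub>v v = 0\<^sub>v (2 * n + 2)"
      using dim by (intro eq_vecI) auto
  qed
  then show ?thesis by (auto simp: mat_kernel_def dim)
qed

lemma span_trivial:
  "v \<in> LinearCombinations.module.span class_ring (module_vec TYPE(real) (2 * n + 2))
       {centred_ngon n, rotation_direction n}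
   \<longleftrightarrow> v \<in> carrier_vec (2 * n + 2) \<and> trivial_direction (planar v)" (is "v \<in> ?span \<longleftrightarrow> _")
proof -
  interpret V: vec_space "TYPE(real)" "2 * n + 2" .
  let ?v0 = "centred_ngon n" and ?w0 = "rotation_direction n"
  have carrier: "?v0 \<in> carrier_vec (2 * n + 2)" "?w0 \<in> carrier_vec (2 * n + 2)"
    by (simp_all add: centred_ngon_def rotation_direction_def config_def)
  have sub: "{?v0, ?w0} \<subseteq> carrier_vec (2 * n + 2)" using carrier by simp
  show ?thesis
  proof
    assume "v \<in> ?span"
    then obtain a A where v: "v = V.lincomb a A" "finite A" "A \<subseteq> {?v0, ?w0}"
      unfolding V.span_def by blast
    have A: "A \<subseteq> carrier_vec (2 * n + 2)" using v sub by blast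
    define b where "b x = (if x = ?v0 then 1 else \<i>)" for x
    have "planar v i = (\<Sum>x\<in>A. of_real (a x) * b x) * gon i" if i: "i \<in> {1..n + 1}" for i
    proof -
      have ii: "2 * (i - 1) < 2 * n + 2" "2 * (i - 1) + 1 < 2 * n + 2" using i by auto
      have "planar v i = (\<Sum>x\<in>A. of_real (a x) * planar x i)"
        unfolding planar_def v(1) V.lincomb_index[OF ii(1) A] V.lincomb_index[OF ii(2) A]
        by (simp add: complex_eq_iff)
      also have "\<dots> = (\<Sum>x\<in>A. of_real (a x) * b x * gon i)"
      proof (intro sum.cong refl)
        fix x assume "x \<in> A"
        then have "x = ?v0 \<or> x = ?w0" using v by auto
        then have "planar x i = b x * gon i"
          using planar_centred_ngon[OF i] planar_rotation_direction[OF i] by (auto simp: b_def)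
        then show "of_real (a x) * planar x i = of_real (a x) * b x * gon i" by simp
      qed
      finally show ?thesis by (simp only: sum_distrib_right)
    qed
    then have "trivial_direction (planar v)" unfolding trivial_direction_def by blast
    moreover have "v \<in> carrier_vec (2 * n + 2)"
      unfolding v(1) by (rule carrier_vecI) (rule V.lincomb_dim[OF v(2) A])
    ultimately show "v \<in> carrier_vec (2 * n + 2) \<and> trivial_direction (planar v)" by simp
  next
    assume v: "v \<in> carrier_vec (2 * n + 2) \<and> trivial_direction (planar v)"
    then obtain \<alpha> where \<alpha>: "\<And>i. i \<in> {1..n + 1} \<Longrightarrow> planar v i = \<alpha> * gon i"
      unfolding trivial_direction_def by blast
    have "v = Re \<alpha> \<cdot>\<^sub>v ?v0 + Im \<alpha> \<cdot>\<^sub>v ?w0"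
    proof (rule eq_vecI)
      fix j assume "j < dim_vec (Re \<alpha> \<cdot>\<^sub>v ?v0 + Im \<alpha> \<cdot>\<^sub>v ?w0)"
      then have j: "j < 2 * n + 2" using carrier by simp
      define i where "i = j div 2 + 1"
      have i: "i \<in> {1..n + 1}" using j by (auto simp: i_def)
      have "\<alpha> * gon i = of_real (Re \<alpha>) * gon i + of_real (Im \<alpha>) * (\<i> * gon i)"
        by (simp add: complex_eq_iff)
      then have "planar v i = of_real (Re \<alpha>) * planar ?v0 i + of_real (Im \<alpha>) * planar ?w0 i"
        using \<alpha>[OF i] planar_centred_ngon[OF i] planar_rotation_direction[OF i] by simp
      then have "vec_index v (2 * (i - 1)) = Re \<alpha> * vec_index ?v0 (2 * (i - 1)) + Im \<alpha> * vec_index ?w0 (2 * (i - 1))"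
        "vec_index v (2 * (i - 1) + 1) = Re \<alpha> * vec_index ?v0 (2 * (i - 1) + 1) + Im \<alpha> * vec_index ?w0 (2 * (i - 1) + 1)"
        by (simp_all add: planar_def complex_eq_iff)
      moreover have "j = 2 * (i - 1) \<or> j = 2 * (i - 1) + 1" by (auto simp: i_def)
      ultimately have "vec_index v j = Re \<alpha> * vec_index ?v0 j + Im \<alpha> * vec_index ?w0 j" by auto
      then show "vec_index v j = vec_index (Re \<alpha> \<cdot>\<^sub>v ?v0 + Im \<alpha> \<cdot>\<^sub>v ?w0) j"
        using j carrier by simp
    qed (use v carrier in simp)
    moreover have "?v0 \<in> ?span" "?w0 \<in> ?span" using V.span_mem[OF sub] by auto
    ultimately show "v \<in> ?span"
      using V.span_add1[OF sub] V.smult_in_span[OF sub] by simp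
  qed
qed

lemma nontrivially_degenerate_iff:
  "nontrivially_degenerate n m \<longleftrightarrow>
    (\<exists>p. 1 \<le> p \<and> 2 * p \<le> int n \<and> mode_A p * mode_C p - (mode_B p)\<^sup>2 = 0)" (is "_ \<longleftrightarrow> ?singular")
proof -
  let ?span = "LinearCombinations.module.span class_ring (module_vec TYPE(real) (2 * n + 2))
       {centred_ngon n, rotation_direction n}"
  let ?ker = "mat_kernel (hessian (scaled_potential n m) (centred_ngon n))"
  have sub: "?span \<subseteq> ?ker"
    using span_trivial mat_kernel_hessian trivial_imp_critical by blast
  show ?thesis
  proof
    assume "nontrivially_degenerate n m"
    then obtain v where "v \<in> ?ker" "v \<notin> ?span"
      unfolding nontrivially_degenerate_def by blast
    then show ?singular
      using span_trivial mat_kernel_hessian critical_imp_trivial by blast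
  next
    assume ?singular
    then obtain y where y: "critical_direction y" "\<not> trivial_direction y"
      using critical_mode_wave by blast
    define v where "v = config n (\<lambda>k. (Re (y k), Im (y k)))"
    have v: "planar v i = y i" if "i \<in> {1..n + 1}" for i
      unfolding v_def planar_config[OF that] by simp
    have "v \<in> carrier_vec (2 * n + 2)" by (simp add: v_def config_def)
    moreover have "critical_direction (planar v)"
    proof -
      have "linearised (planar v) i = linearised y i" if "i \<in> {1..n + 1}" for i
        by (rule linearised_cong[OF v that])
      then show ?thesis using y(1) unfolding critical_direction_def by simp
    qed
    moreover have "\<not> trivial_direction (planar v)"
      using y(2) v unfolding trivial_direction_def by metis
    ultimately have "v \<in> ?ker" "v \<notin> ?span"
      using span_trivial mat_kernel_hessian by blast+
    then show "nontrivially_degenerate n m"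
      unfolding nontrivially_degenerate_def using sub by blast
  qed
qed

section \<open>Counting critical masses\<close>

text \<open>The correction of the block has rank one, so the determinant is affine in n /
  \<open>elimination\<close> and a single multiplication clears the denominator.\<close>

lemma mode_det_1: "elimination * (mode_A 1 * mode_C 1 - (mode_B 1)\<^sup>2) = centre_poly u"
proof -
  define P Q x where "P = ring_sum 2 + 2 * s" and "Q = 2 * s" and "x = u"
  define e where "e = n / elimination"
  have W: "elimination * e = n" "elimination = real n + 4 * x / 3 + 4 * s"
    using elimination_pos by (simp_all add: e_def elimination_def x_def)
  have abc: "mode_A 1 = P + x - 3 * x * e" "mode_B 1 = x - x * e" "mode_C 1 = Q + x - x * e / 3"
    by (simp_all add: mode_A_def mode_B_def mode_C_def P_def Q_def x_def e_def)
  have "elimination * (mode_A 1 * mode_C 1 - (mode_B 1)\<^sup>2)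
     = elimination * ((P + x) * (Q + x) - x\<^sup>2) - (elimination * e) * x * ((P + x) / 3 + 3 * (Q + x) - 2 * x)"
    unfolding abc by (simp add: field_simps power2_eq_square)
  also have "\<dots> = centre_poly u"
    unfolding W(1) centre_poly_def x_def[symmetric] unfolding W(2)
    by (simp add: P_def Q_def field_simps power2_eq_square)
  finally show ?thesis .
qed

lemma mode_det_ge_2:
  assumes "2 \<le> p" "2 * p \<le> int n"
  shows "mode_A p * mode_C p - (mode_B p)\<^sup>2 = 2 * stiffness p * (u - critical_value p)"
proof -
  have "mode_A p = ring_sum (p + 1) + 2 * s + u" "mode_B p = 3 * (s - ring_sum p) + u"
    "mode_C p = ring_sum (p - 1) + 2 * s + u"
    using assms(1) by (simp_all add: mode_A_def mode_B_def mode_C_def)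
  then show ?thesis using mode_det[of p u] assms by simp
qed

lemma nontrivially_degenerate_cases:
  "nontrivially_degenerate n m \<longleftrightarrow> centre_poly u = 0 \<or> (\<exists>p. 2 \<le> p \<and> 2 * p \<le> int n \<and> u = critical_value p)"
proof -
  have one: "mode_A 1 * mode_C 1 - (mode_B 1)\<^sup>2 = 0 \<longleftrightarrow> centre_poly u = 0"
    using mode_det_1 elimination_pos by (metis mult_eq_0_iff less_irrefl)
  have two: "mode_A p * mode_C p - (mode_B p)\<^sup>2 = 0 \<longleftrightarrow> u = critical_value p"
    if "2 \<le> p" "2 * p \<le> int n" for p
    using mode_det_ge_2[OF that] stiffness_pos[of p] that by simp
  show ?thesis
    unfolding nontrivially_degenerate_iff
  proof
    assume "\<exists>p. 1 \<le> p \<and> 2 * p \<le> int n \<and> mode_A p * mode_C p - (mode_B p)\<^sup>2 = 0"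
    then obtain p where p: "1 \<le> p" "2 * p \<le> int n" "mode_A p * mode_C p - (mode_B p)\<^sup>2 = 0" by blast
    show "centre_poly u = 0 \<or> (\<exists>p. 2 \<le> p \<and> 2 * p \<le> int n \<and> u = critical_value p)"
    proof (cases "p = 1")
      case True
      then show ?thesis using p(3) one by simp
    next
      case False
      then have "2 \<le> p" using p(1) by simp
      then show ?thesis using two p by blast
    qed
  next
    assume "centre_poly u = 0 \<or> (\<exists>p. 2 \<le> p \<and> 2 * p \<le> int n \<and> u = critical_value p)"
    then show "\<exists>p. 1 \<le> p \<and> 2 * p \<le> int n \<and> mode_A p * mode_C p - (mode_B p)\<^sup>2 = 0"
    proof
      assume "centre_poly u = 0"
      then show ?thesis using one n_ge_3 by (intro exI[of _ 1]) simp
    next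
      assume "\<exists>p. 2 \<le> p \<and> 2 * p \<le> int n \<and> u = critical_value p"
      then obtain p where "2 \<le> p" "2 * p \<le> int n" "u = critical_value p" by blast
      then show ?thesis using two by (intro exI[of _ p]) simp
    qed
  qed
qed

end

section \<open>Distinct positive roots and the final count\<close>

context ngon
begin

lemma critical_masses_eq:
  "critical_masses n = (\<lambda>x. 2 / 3 * x) `
     ({x. 0 < x \<and> centre_poly x = 0} \<union> {x. 0 < x \<and> (\<exists>p. 2 \<le> p \<and> 2 * p \<le> int n \<and> x = critical_value p)})"
proof -
  have iff: "m \<in> critical_masses n \<longleftrightarrow> 0 < m \<and>
     (centre_poly (3 * m / 2) = 0 \<or> (\<exists>p. 2 \<le> p \<and> 2 * p \<le> int n \<and> 3 * m / 2 = critical_value p))" for m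
  proof (cases "0 < m")
    case True
    then interpret ngon_mass n m by unfold_locales
    show ?thesis using True nontrivially_degenerate_cases by (simp add: critical_masses_def)
  qed (simp add: critical_masses_def)
  show ?thesis
  proof (intro equalityI subsetI)
    fix m assume "m \<in> critical_masses n"
    then show "m \<in> (\<lambda>x. 2 / 3 * x) `
     ({x. 0 < x \<and> centre_poly x = 0} \<union> {x. 0 < x \<and> (\<exists>p. 2 \<le> p \<and> 2 * p \<le> int n \<and> x = critical_value p)})"
      unfolding iff by (intro image_eqI[of _ _ "3 * m / 2"]) auto
  next
    fix m assume "m \<in> (\<lambda>x. 2 / 3 * x) `
     ({x. 0 < x \<and> centre_poly x = 0} \<union> {x. 0 < x \<and> (\<exists>p. 2 \<le> p \<and> 2 * p \<le> int n \<and> x = critical_value p)})"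
    then obtain x where x: "m = 2 / 3 * x" "0 < x"
      "centre_poly x = 0 \<or> (\<exists>p. 2 \<le> p \<and> 2 * p \<le> int n \<and> x = critical_value p)" by blast
    have e: "3 * m / 2 = x" using x(1) by simp
    have "0 < m" using x(1,2) by simp
    then show "m \<in> critical_masses n" unfolding iff e using x(3) by blast
  qed
qed

lemma centre_root_small:
  assumes "n \<le> 6"
  obtains r where "{x. 0 < x \<and> centre_poly x = 0} = {r}"
proof -
  have "\<exists>!x. 0 < x \<and> centre_poly x = 0"
    unfolding centre_poly_eq
    by (rule quadratic_unique_positive_root) (use centre_balance_small[OF assms] centre_poly_0_pos in auto)
  then obtain r where "0 < r \<and> centre_poly r = 0" "\<And>x. 0 < x \<and> centre_poly x = 0 \<Longrightarrow> x = r" by blast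
  then have "{x. 0 < x \<and> centre_poly x = 0} = {r}" by blast
  then show thesis by (rule that)
qed

lemma centre_root_large: "7 \<le> n \<Longrightarrow> {x. 0 < x \<and> centre_poly x = 0} = {}"
  using centre_poly_pos centre_balance_large by force

lemma critical_value_strict_mono:
  assumes "8 \<le> n" "2 \<le> p" "p < q" "2 * q \<le> int n"
  shows "critical_value p < critical_value q"
proof -
  have step: "critical_value i < critical_value (i + 1)" if "2 \<le> i" "2 * i + 2 \<le> int n" for i
    by (rule critical_value_increasing)
      (use that ring_sum_3_gt[OF assms(1)] ring_sum_mono[of 3 "i + 1"] in auto)
  have "p + 1 \<le> q" using assms by simp
  then show ?thesis using assms(4)
  proof (induction q rule: int_ge_induct)
    case base
    then show ?case using step assms(2) by simp
  next
    case (step i)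
    then show ?case using \<open>\<And>i. 2 \<le> i \<Longrightarrow> 2 * i + 2 \<le> int n \<Longrightarrow> critical_value i < critical_value (i + 1)\<close>[of i] assms(2) by simp
  qed
qed

text \<open>a is the index of the first positive root: 3 for n = 8 and 9, 2 from n = 10 on.
  Monotonicity makes all later roots positive and distinct.\<close>

lemma positive_critical_values_large:
  assumes "8 \<le> n" "2 \<le> a" "0 < critical_value a" "a = 2 \<or> critical_value 2 \<le> 0 \<and> a = 3"
    "2 * a \<le> int n"
  shows "{x. 0 < x \<and> (\<exists>p. 2 \<le> p \<and> 2 * p \<le> int n \<and> x = critical_value p)} = critical_value ` {a..int (n div 2)}"
    "card (critical_value ` {a..int (n div 2)}) = n div 2 + 1 - nat a"
proof -
  have half: "2 * p \<le> int n \<longleftrightarrow> p \<le> int (n div 2)" for p by linarith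
  have pos: "0 < critical_value p" if "a \<le> p" "2 * p \<le> int n" for p
    using critical_value_strict_mono[of a p] assms that by (cases "p = a") auto
  show "{x. 0 < x \<and> (\<exists>p. 2 \<le> p \<and> 2 * p \<le> int n \<and> x = critical_value p)} = critical_value ` {a..int (n div 2)}"
  proof (intro equalityI subsetI)
    fix x assume "x \<in> {x. 0 < x \<and> (\<exists>p. 2 \<le> p \<and> 2 * p \<le> int n \<and> x = critical_value p)}"
    then obtain p where p: "0 < x" "2 \<le> p" "2 * p \<le> int n" "x = critical_value p" by blast
    have "a \<le> p"
    proof (cases "p = 2")
      case True
      then show ?thesis using assms(4) p by auto
    qed (use assms(4) p in auto)
    then show "x \<in> critical_value ` {a..int (n div 2)}" using p half by auto
  next
    fix x assume "x \<in> critical_value ` {a..int (n div 2)}"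
    then obtain p where p: "a \<le> p" "p \<le> int (n div 2)" "x = critical_value p" by auto
    then have "0 < x" "2 \<le> p" "2 * p \<le> int n" using pos[of p] half[of p] assms(2) by auto
    then show "x \<in> {x. 0 < x \<and> (\<exists>p. 2 \<le> p \<and> 2 * p \<le> int n \<and> x = critical_value p)}"
      using p(3) by blast
  qed
  have "inj_on critical_value {a..int (n div 2)}"
  proof (rule linorder_inj_onI')
    fix p q assume "p \<in> {a..int (n div 2)}" "q \<in> {a..int (n div 2)}" "p < q"
    then have "critical_value p < critical_value q"
      using half[of q] assms(1,2) by (intro critical_value_strict_mono) auto
    then show "critical_value p \<noteq> critical_value q" by simp
  qed
  then show "card (critical_value ` {a..int (n div 2)}) = n div 2 + 1 - nat a"
    using assms(2) by (simp add: card_image nat_diff_distrib' nat_add_distrib)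
qed

text \<open>For n <= 7 only p = 2 and p = 3 can occur besides mode 1, and they are inspected singly.
  From n = 8 on mode 1 contributes nothing and the count is the length of an index interval ending
  at n div 2.\<close>

lemma finite_card_critical_masses:
  "finite (critical_masses n)"
  "card (critical_masses n) = (if n = 3 then 1 else if n \<le> 6 then n div 2 - 1
     else if n \<le> 9 then n div 2 - 2 else n div 2 - 1)"
proof -
  define C where "C = {x. 0 < x \<and> centre_poly x = 0}"
  define V where "V = {x. 0 < x \<and> (\<exists>p. 2 \<le> p \<and> 2 * p \<le> int n \<and> x = critical_value p)}"
  have card: "card (critical_masses n) = card (C \<union> V)"
    unfolding critical_masses_eq C_def V_def by (rule card_image) (simp add: inj_on_def)
  have fin: "finite (critical_masses n) \<longleftrightarrow> finite (C \<union> V)"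
    unfolding critical_masses_eq C_def V_def by (rule finite_image_iff) (simp add: inj_on_def)
  consider "n \<le> 5" | "n = 6" | "n = 7" | "8 \<le> n" "n \<le> 9" | "10 \<le> n" by linarith
  then have "finite (C \<union> V) \<and> card (C \<union> V) = (if n = 3 then 1 else if n \<le> 6 then n div 2 - 1
     else if n \<le> 9 then n div 2 - 2 else n div 2 - 1)"
  proof cases
    case 1
    then have "n \<le> 6" by simp
    then obtain r where C: "C = {r}" unfolding C_def by (rule centre_root_small)
    have "x \<notin> V" for x
    proof
      assume "x \<in> V"
      then obtain p where p: "0 < x" "2 \<le> p" "2 * p \<le> int n" "x = critical_value p" unfolding V_def by blast
      have "p = 2" "4 \<le> n" using p 1 by auto
      moreover from this have "critical_value 2 \<le> 0" using critical_value_2_nonpos_small 1 by simp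
      ultimately show False using p(1,4) by simp
    qed
    then have "V = {}" by blast
    moreover have "n = 3 \<or> n = 4 \<or> n = 5" using 1 n_ge_3 by auto
    ultimately show ?thesis using C by (elim disjE) simp_all
  next
    case 2
    then have "n \<le> 6" by simp
    then obtain r where C: "C = {r}" unfolding C_def by (rule centre_root_small)
    have "V = {critical_value 3}"
    proof (intro equalityI subsetI)
      fix x assume "x \<in> V"
      then obtain p where p: "0 < x" "2 \<le> p" "2 * p \<le> int n" "x = critical_value p" unfolding V_def by blast
      then have "p = 2 \<or> p = 3" using 2 by auto
      then show "x \<in> {critical_value 3}" using critical_value_2_nonpos_small 2 p by auto
    next
      fix x assume "x \<in> {critical_value 3}"
      then show "x \<in> V" unfolding V_def using critical_value_3_pos 2 by (auto intro!: exI[of _ 3])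
    qed
    moreover have "r \<noteq> critical_value 3"
      using critical_value_3_hexagon[OF 2] C unfolding C_def by blast
    ultimately show ?thesis using C 2 by simp
  next
    case 3
    have "V = {critical_value 3}"
    proof (intro equalityI subsetI)
      fix x assume "x \<in> V"
      then obtain p where p: "0 < x" "2 \<le> p" "2 * p \<le> int n" "x = critical_value p" unfolding V_def by blast
      then have "p = 2 \<or> p = 3" using 3 by auto
      then show "x \<in> {critical_value 3}" using critical_value_2_nonpos_small 3 p by auto
    next
      fix x assume "x \<in> {critical_value 3}"
      then show "x \<in> V" unfolding V_def using critical_value_3_pos 3 by (auto intro!: exI[of _ 3])
    qed
    moreover have "C = {}" unfolding C_def using centre_root_large 3 by simp
    ultimately show ?thesis using 3 by simp
  next
    case 4
    have "C = {}" unfolding C_def using centre_root_large 4 by simp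
    moreover have "V = critical_value ` {3..int (n div 2)}" "card (critical_value ` {3..int (n div 2)}) = n div 2 + 1 - nat 3"
      unfolding V_def
      by (rule positive_critical_values_large; use 4 critical_value_3_pos critical_value_2_nonpos_small in simp)+
    ultimately show ?thesis using 4 by simp
  next
    case 5
    have "C = {}" unfolding C_def using centre_root_large 5 by simp
    moreover have "V = critical_value ` {2..int (n div 2)}" "card (critical_value ` {2..int (n div 2)}) = n div 2 + 1 - nat 2"
      unfolding V_def
      by (rule positive_critical_values_large; use 5 critical_value_2_pos_large in simp)+
    ultimately show ?thesis using 5 by simp
  qed
  then show "finite (critical_masses n)"
    "card (critical_masses n) = (if n = 3 then 1 else if n \<le> 6 then n div 2 - 1
     else if n \<le> 9 then n div 2 - 2 else n div 2 - 1)"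
    using card fin by simp_all
qed

end

theorem theorem4:
  shows "(\<forall>n\<ge>3. finite (critical_masses n) \<and>
            num_critical_masses n =
              (if n = 3 then 1
               else if n \<le> 6 then n div 2 - 1
               else if n \<le> 9 then n div 2 - 2
               else n div 2 - 1)) \<and>
         mono_on {7..} num_critical_masses"
proof -
  have count: "finite (critical_masses n)" "num_critical_masses n = (if n = 3 then 1 else if n \<le> 6 then n div 2 - 1
     else if n \<le> 9 then n div 2 - 2 else n div 2 - 1)" if "3 \<le> n" for n
  proof -
    interpret ngon n using that by unfold_locales
    show "finite (critical_masses n)" "num_critical_masses n = (if n = 3 then 1 else if n \<le> 6 then n div 2 - 1
     else if n \<le> 9 then n div 2 - 2 else n div 2 - 1)"
      using finite_card_critical_masses by (simp_all add: num_critical_masses_def)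
  qed
  \<comment> \<open>Monotonicity is weak, as n div 2 agrees on 2 k and 2 k + 1; the change of
    formula from 9 to 10 raises the count from 2 to 4.\<close>
  have "mono_on {7..} num_critical_masses"
  proof (rule mono_onI)
    fix a b :: nat assume ab: "a \<in> {7..}" "b \<in> {7..}" "a \<le> b"
    then have "a div 2 \<le> b div 2" by (simp add: div_le_mono)
    then show "num_critical_masses a \<le> num_critical_masses b"
      using ab count(2)[of a] count(2)[of b] by (auto; arith)
  qed
  then show ?thesis using count by blast
qed

end
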